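(* Let $f=(f_1,\ldots,f_n)$ have the model property and let $T=(T_1,\ldots,T_n)\in\mathbb B_f(\mathcal H)$ be a pure $n$-tuple of operators. Then the noncommutative Poisson kernel $K_{f,T}:\mathcal H\to\mathbb H^2(f)\otimes\mathcal D_{f,T}$ is an isometry, the subspace $K_{f,T}(\mathcal H)$ is co-invariant under $M_{Z_1}\otimes I_{\mathcal D_{f,T}},\ldots,M_{Z_n}\otimes I_{\mathcal D_{f,T}}$, and $$T_i=K_{f,T}^*(M_{Z_i}\otimes I_{\mathcal D_{f,T}})K_{f,T},\qquad i=1,\ldots,n.$$ Moreover, this dilation is minimal, i.e., $$\mathbb H^2(f)\otimes\mathcal D_{f,T}=\bigvee_{\alpha\in\mathbb F_n^+}(M_{Z_\alpha}\otimes I_{\mathcal D_{f,T}})K_{f,T}(\mathcal H),$$ and unique up to an isomorphism.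
   Context: Notation. $\mathbb F_n^+$ is the free semigroup on $g_1,\ldots,g_n$ with identity $g_0$ and length $|\cdot|$. For an $n$-tuple $X$ of elements of a unital algebra, $X_\alpha=X_{i_1}\cdots X_{i_k}$ if $\alpha=g_{i_1}\cdots g_{i_k}$, $X_{g_0}=I$; $[f(X)]_\alpha$ is the corresponding product of $f_1(X),\ldots,f_n(X)$; $M_{Z_\alpha}:=M_{Z_{i_1}}\cdots M_{Z_{i_k}}$. A tuple $X\in B(\mathcal H)^n$ is viewed as a row operator, so $\|X\|=\|\sum X_iX_i^*\|^{1/2}$; $[B(\mathcal H)^n]_\gamma=\{X:\|X\|<\gamma\}$. A free holomorphic function on $[B(\mathcal H)^n]_\gamma$ is a formal power series $\sum a_\alpha Z_\alpha$ in noncommuting indeterminates (complex coefficients) with radius of convergence $r$, $r^{-1}=\limsup_k(\sum_{|\alpha|=k}|a_\alpha|^2)^{1/2k}$, at least $\gamma$, identified with the map $X\mapsto\sum_k\sum_{|\alpha|=k}a_\alpha X_\alpha$ (norm convergence; $\mathcal H$ separable infinite-dimensional). $H^2_{\bf ball}$ is the Hilbert space of series with $\sum|a_\alpha|^2<\infty$ (the $Z_\alpha$ being orthonormal). Convergence sets. For an $n$-tuple $f$ of formal power series $f_j=\sum c^{(j)}_\alpha Z_\alpha$ and a Hilbert space $\mathcal H$: $\mathcal C_f^{SOT}(\mathcal H)$ is the set of $X\in B(\mathcal H)^n$ such that each series $f_j(X):=\sum_k\sum_{|\alpha|=k}c^{(j)}_\alpha X_\alpha$ is SOT-convergent; $\mathcal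 C_f^{rad}(\mathcal H)$ is the set of $X$ such that for some $\delta\in(0,1)$ these series converge in norm at $rX$ for all $r\in(\delta,1)$ and $f_j(X):=\text{SOT-}\lim_{r\to1}f_j(rX)$ exists for each $j$. Model property. $f=(f_1,\ldots,f_n)$ has the model property if one of the following holds. (A) $f$ is an $n$-tuple of noncommutative polynomials for which there is an $n$-tuple $g$ of noncommutative polynomials with $f\circ g=g\circ f=\mathrm{id}$. Then $\{f_\alpha\}$ is a linear basis of $\mathbb C[Z_1,\ldots,Z_n]$ and $\mathbb H^2(f)$ is the completion of $\mathbb C[Z_1,\ldots,Z_n]$ for the inner product $\langle f_\alpha,f_\beta\rangle=\delta_{\alpha\beta}$. (S) $f$ is an $n$-tuple of formal power series with $f(0)=0$, nonzero radius of convergence and $\det J_f(0)\neq0$ ($J_f(0)_{ij}$ is the coefficient of $Z_j$ in $f_i$); $\mathbb H^2(f)$ is the Hilbert space of formal power series $\sum a_\alpha f_\alpha$, $\sum|a_\alpha|^2<\infty$, with $\{f_\alpha\}$ orthonormal; $Z_1,\ldots,Z_n\in\mathbb H^2(f)$; left multiplication $M_{Z_i}$ by $Z_i$ is bounded on $\mathbb H^2(f)$; and $M_Z=(M_{Z_1},\ldots,M_{Z_n})$ belongs to $\mathcal C_f^{SOT}(\mathbb H^2(f))$ or $\mathcal C_f^{rad}(\mathbb H^2(f))$ with $f_j(M_Z)=M_{f_j}$ (left multiplication by $f_j$), $j=1,\ldots,n$. (F) $f$ is an $n$-tuple of free holomorphic functions on some $[B(\mathcal H)^n]_\gamma$, $\gamma>0$,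 with range in $[B(\mathcal H)^n]_1$, such that $G\circ f\not\equiv0$ for every nonzero free holomorphic $G$ on $[B(\mathcal H)^n]_1$; $\mathbb H^2(f)=\{G\circ f:G\in H^2_{\bf ball}\}$ with $\langle F\circ f,G\circ f\rangle=\langle F,G\rangle$; the coordinate functions $Z_1,\ldots,Z_n$ lie in $\mathbb H^2(f)$, left multiplications $M_{Z_i}$ by them are bounded on $\mathbb H^2(f)$, and $M_Z$ is in $\mathcal C_f^{SOT}(\mathbb H^2(f))$ or $\mathcal C_f^{rad}(\mathbb H^2(f))$ with $f_j(M_Z)=M_{f_j}$ for all $j$. In all cases $\{f_\alpha\}_{\alpha\in\mathbb F_n^+}$ is an orthonormal basis of $\mathbb H^2(f)$, and $M_Z$ is called the universal model. Writing $Z_i=\sum_\alpha a^{(i)}_\alpha f_\alpha$ in $\mathbb H^2(f)$, one has $M_{Z_i}f_\beta=\sum_\alpha a^{(i)}_\alpha f_{\alpha\beta}$, and $g_i:=\sum_\alpha a^{(i)}_\alpha Z_\alpha$ defines the inverse $g=(g_1,\ldots,g_n)$ of $f$ with respect to composition. Domain. $X\in B(\mathcal H)^n$ satisfies $g(f(X))=X$ if $X\in\mathcal C_f^{SOT}(\mathcal H)\cup\mathcal C_f^{rad}(\mathcal H)$ and either (for all $i$) $X_i=\sum_k\sum_{|\alpha|=k}a^{(i)}_\alpha[f(X)]_\alpha$ in the SOT, or (for all $i$) $X_i=\text{SOT-}\lim_{r\to1}\sum_k\sum_{|\alpha|=k}a^{(i)}_\alpha r^{|\alpha|}[f(X)]_\alpha$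 (automatic in case (A)). Then $\mathbb B_f(\mathcal H):=\{X\in B(\mathcal H)^n:\ g(f(X))=X,\ \|f(X)\|\le1\}$. $T\in\mathbb B_f(\mathcal H)$ is pure if $\text{SOT-}\lim_{k\to\infty}\sum_{|\alpha|=k}[f(T)]_\alpha[f(T)]_\alpha^*=0$. Poisson kernel. For $T\in\mathbb B_f(\mathcal H)$: $\Delta_{f,T}:=(I-\sum_{j=1}^nf_j(T)f_j(T)^* )^{1/2}$, $\mathcal D_{f,T}:=\overline{\Delta_{f,T}\mathcal H}$, and $K_{f,T}h:=\sum_{\alpha\in\mathbb F_n^+}f_\alpha\otimes\Delta_{f,T}[f(T)]_\alpha^*h$, $h\in\mathcal H$. Uniqueness up to an isomorphism means: if $V:\mathcal H\to\mathbb H^2(f)\otimes\mathcal E$ is an isometry with $V(\mathcal H)$ co-invariant under all $M_{Z_i}\otimes I_{\mathcal E}$, $T_i=V^*(M_{Z_i}\otimes I_{\mathcal E})V$ for all $i$, and $\mathbb H^2(f)\otimes\mathcal E=\bigvee_\alpha(M_{Z_\alpha}\otimes I_{\mathcal E})V(\mathcal H)$, then there is a unitary $W:\mathbb H^2(f)\otimes\mathcal D_{f,T}\to\mathbb H^2(f)\otimes\mathcal E$ with $W(M_{Z_i}\otimes I_{\mathcal D_{f,T}})=(M_{Z_i}\otimes I_{\mathcal E})W$ for all $i$ and $WK_{f,T}=V$. Co-invariant means invariant under the adjoints; $\bigvee$ is closed linear span. *)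

theory Defs
  imports "HOL-Analysis.Analysis"
begin

section \<open>Complex Hilbert spaces\<close>

text \<open>The inner product is linear in the first argument. Its real part is the inner product of
  the underlying real Hilbert space, so norm and topology are those of \<^class>\<open>real_inner\<close>.\<close>

class complex_hilbert = real_inner + banach +
  fixes scaleC :: "complex \<Rightarrow> 'a \<Rightarrow> 'a" (infixr "*\<^sub>C" 75)
    and cinner :: "'a \<Rightarrow> 'a \<Rightarrow> complex"
  assumes scaleC_add_right: "c *\<^sub>C (x + y) = c *\<^sub>C x + c *\<^sub>C y"
    and scaleC_add_left: "(c + d) *\<^sub>C x = c *\<^sub>C x + d *\<^sub>C x"
    and scaleC_scaleC: "c *\<^sub>C d *\<^sub>C x = (c * d) *\<^sub>C x"
    and scaleC_of_real: "complex_of_real r *\<^sub>C x = r *\<^sub>R x"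
    and cinner_add_left: "cinner (x + y) z = cinner x z + cinner y z"
    and cinner_scaleC_left: "cinner (c *\<^sub>C x) y = c * cinner x y"
    and cinner_commute: "cinner x y = cnj (cinner y x)"
    and Re_cinner: "Re (cinner x y) = inner x y"

instantiation complex :: complex_hilbert
begin

definition scaleC_complex :: "complex \<Rightarrow> complex \<Rightarrow> complex" where
  "scaleC_complex c x = c * x"

definition cinner_complex :: "complex \<Rightarrow> complex \<Rightarrow> complex" where
  "cinner_complex x y = x * cnj y"

instance
  by standard
    (simp_all add: scaleC_complex_def cinner_complex_def inner_complex_def algebra_simps
      scaleR_conv_of_real)

end

lemma scaleC_eq: "c *\<^sub>C x = Re c *\<^sub>R x + Im c *\<^sub>R (\<i> *\<^sub>C x)"
proof -
  have "c *\<^sub>C x = (complex_of_real (Re c) + complex_of_real (Im c) * \<i>) *\<^sub>C x"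
    by (metis complex_eq mult.commute)
  thus ?thesis
    by (simp only: scaleC_add_left scaleC_scaleC[symmetric] scaleC_of_real)
qed

lemma norm_scaleC: "norm (c *\<^sub>C x) = cmod c * norm x"
proof -
  have c: "cinner (c *\<^sub>C x) (c *\<^sub>C x) = c * cnj c * cinner x x"
    by (metis cinner_commute cinner_scaleC_left complex_cnj_mult mult.assoc)
  have "cinner (c *\<^sub>C x) (c *\<^sub>C x) = complex_of_real ((cmod c)\<^sup>2) * cinner x x"
    unfolding c by (metis complex_norm_square)
  hence "inner (c *\<^sub>C x) (c *\<^sub>C x) = (cmod c)\<^sup>2 * inner x x"
    by (metis Re_cinner Re_complex_of_real scaleR_complex.sel(1) scaleR_conv_of_real)
  thus ?thesis
    by (simp add: norm_eq_sqrt_inner real_sqrt_mult)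
qed

lemma cinner_eq: "cinner x y = Complex (inner x y) (inner x (\<i> *\<^sub>C y))"
proof -
  have "cinner x (\<i> *\<^sub>C y) = - \<i> * cinner x y"
    by (metis cinner_commute cinner_scaleC_left complex_cnj_cnj complex_cnj_i complex_cnj_mult)
  hence "Re (cinner x (\<i> *\<^sub>C y)) = Im (cinner x y)"
    by simp
  hence "inner x (\<i> *\<^sub>C y) = Im (cinner x y)"
    by (simp only: Re_cinner)
  thus ?thesis
    by (simp add: Re_cinner complex_eq_iff)
qed

section \<open>Square-summable families\<close>

text \<open>\<open>('i, 'b) ltwo\<close> is the Hilbert space of square-summable families indexed by \<open>'i\<close> with
  values in \<open>'b\<close>; for \<^typ>\<open>complex\<close> as \<open>'b\<close> it is the space \<open>\<ell>\<^sup>2('i)\<close>.\<close>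

definition square_summable :: "('i \<Rightarrow> 'b::real_normed_vector) \<Rightarrow> bool" where
  "square_summable u \<longleftrightarrow> (\<lambda>i. (norm (u i))\<^sup>2) summable_on UNIV"

lemma square_summable_0: "square_summable (\<lambda>_. 0)"
  by (simp add: square_summable_def)

lemma square_summable_bound:
  assumes "square_summable u" "\<And>i. norm (v i) \<le> c * norm (u i)"
  shows "square_summable v"
  unfolding square_summable_def
proof (rule summable_on_comparison_test)
  show "(\<lambda>i. c\<^sup>2 * (norm (u i))\<^sup>2) summable_on UNIV"
    using assms(1) unfolding square_summable_def by (rule summable_on_cmult_right)
  show "(norm (v i))\<^sup>2 \<le> c\<^sup>2 * (norm (u i))\<^sup>2" for i
    using power_mono[OF assms(2)[of i], of 2] by (simp add: power_mult_distrib)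
qed auto

lemma square_summable_add:
  assumes "square_summable u" "square_summable v"
  shows "square_summable (\<lambda>i. u i + v i)"
  unfolding square_summable_def
proof (rule summable_on_comparison_test)
  show "(\<lambda>i. 2 * ((norm (u i))\<^sup>2 + (norm (v i))\<^sup>2)) summable_on UNIV"
    using assms unfolding square_summable_def
    by (intro summable_on_cmult_right summable_on_add)
  show "(norm (u i + v i))\<^sup>2 \<le> 2 * ((norm (u i))\<^sup>2 + (norm (v i))\<^sup>2)" for i
  proof -
    have "(norm (u i + v i))\<^sup>2 \<le> (norm (u i) + norm (v i))\<^sup>2"
      by (rule power_mono[OF norm_triangle_ineq]) simp
    also have "\<dots> \<le> 2 * ((norm (u i))\<^sup>2 + (norm (v i))\<^sup>2)"
      using sum_squares_bound[of "norm (u i)" "norm (v i)"] by (simp add: power2_sum)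
    finally show ?thesis .
  qed
qed auto

lemma square_summable_inner:
  assumes "square_summable u" "square_summable v"
  shows "(\<lambda>i. inner (u i) (v i)) summable_on UNIV"
proof -
  have "(\<lambda>i. norm (inner (u i) (v i))) summable_on UNIV"
  proof (rule Infinite_Sum.abs_summable_on_comparison_test')
    show "(\<lambda>i. (norm (u i))\<^sup>2 + (norm (v i))\<^sup>2) summable_on UNIV"
      using assms unfolding square_summable_def by (rule summable_on_add)
    show "norm (inner (u i) (v i)) \<le> (norm (u i))\<^sup>2 + (norm (v i))\<^sup>2" for i
    proof -
      have "norm (inner (u i) (v i)) \<le> norm (u i) * norm (v i)"
        by (simp add: Cauchy_Schwarz_ineq2)
      also have "\<dots> \<le> (norm (u i))\<^sup>2 + (norm (v i))\<^sup>2"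
      proof -
        have "0 \<le> norm (u i) * norm (v i)"
          by simp
        thus ?thesis
          using sum_squares_bound[of "norm (u i)" "norm (v i)"] by linarith
      qed
      finally show ?thesis .
    qed
  qed
  thus ?thesis
    by (rule Infinite_Sum.abs_summable_summable)
qed

typedef (overloaded) ('i, 'b) ltwo = "{u :: 'i \<Rightarrow> 'b::complex_hilbert. square_summable u}"
  morphisms coord Abs_ltwo
  using square_summable_0 by blast

lemma square_summable_coord: "square_summable (coord u)"
  using coord by blast

lemma ltwo_eqI: "(\<And>i. coord u i = coord v i) \<Longrightarrow> u = v"
  by (metis coord_inject ext)

lemma coord_Abs: "square_summable u \<Longrightarrow> coord (Abs_ltwo u) = u"
  by (simp add: Abs_ltwo_inverse)

instantiation ltwo :: (type, complex_hilbert) real_inner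
begin

definition "0 = Abs_ltwo (\<lambda>_. 0)"
definition "u + v = Abs_ltwo (\<lambda>i. coord u i + coord v i)"
definition "- u = Abs_ltwo (\<lambda>i. - coord u i)"
definition "u - v = Abs_ltwo (\<lambda>i. coord u i - coord v i)"
definition "r *\<^sub>R u = Abs_ltwo (\<lambda>i. r *\<^sub>R coord u i)"
definition "inner u v = (\<Sum>\<^sub>\<infinity>i. inner (coord u i) (coord v i))"
definition "norm (u :: ('a, 'b) ltwo) = sqrt (inner u u)"
definition "sgn (u :: ('a, 'b) ltwo) = inverse (norm u) *\<^sub>R u"
definition "dist (u :: ('a, 'b) ltwo) v = norm (u - v)"
definition
  "(uniformity :: (('a, 'b) ltwo \<times> ('a, 'b) ltwo) filter) =
    (INF e\<in>{0 <..}. principal {(x, y). dist x y < e})"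
definition
  "open (S :: ('a, 'b) ltwo set) \<longleftrightarrow> (\<forall>x\<in>S. \<forall>\<^sub>F (x', y) in uniformity. x' = x \<longrightarrow> y \<in> S)"

lemma coord_zero [simp]: "coord (0 :: ('a, 'b) ltwo) i = 0"
  by (simp add: zero_ltwo_def coord_Abs square_summable_0)

lemma coord_add [simp]: "coord (u + v) i = coord u i + coord v i"
  by (simp add: plus_ltwo_def coord_Abs square_summable_add square_summable_coord)

lemma coord_uminus [simp]: "coord (- u) i = - coord u i"
  unfolding uminus_ltwo_def
  by (subst coord_Abs) (auto intro: square_summable_bound[OF square_summable_coord, of _ 1])

lemma coord_diff [simp]: "coord (u - v) i = coord u i - coord v i"
proof -
  have "square_summable (\<lambda>i. coord u i + coord (- v) i)"
    by (intro square_summable_add square_summable_coord)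
  thus ?thesis
    by (simp add: minus_ltwo_def coord_Abs)
qed

lemma coord_scaleR [simp]: "coord (r *\<^sub>R u) i = r *\<^sub>R coord u i"
  unfolding scaleR_ltwo_def
  by (subst coord_Abs) (auto intro: square_summable_bound[OF square_summable_coord, of _ "\<bar>r\<bar>"])

instance
proof
  fix u v w :: "('a, 'b) ltwo" and r s :: real
  note summ = square_summable_inner[OF square_summable_coord square_summable_coord]
  show "u + v + w = u + (v + w)" "u + v = v + u" "0 + u = u" "- u + u = 0" "u - v = u + - v"
    "r *\<^sub>R (u + v) = r *\<^sub>R u + r *\<^sub>R v" "(r + s) *\<^sub>R u = r *\<^sub>R u + s *\<^sub>R u"
    "r *\<^sub>R s *\<^sub>R u = (r * s) *\<^sub>R u" "1 *\<^sub>R u = u"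
    by (rule ltwo_eqI; simp add: algebra_simps)+
  show "inner u v = inner v u"
    by (simp add: inner_ltwo_def inner_commute)
  show "inner (u + v) w = inner u w + inner v w"
    unfolding inner_ltwo_def by (simp add: inner_add_left infsum_add summ)
  show "inner (r *\<^sub>R u) v = r * inner u v"
    unfolding inner_ltwo_def by (simp add: infsum_cmult_right')
  show "0 \<le> inner u u"
    unfolding inner_ltwo_def by (rule infsum_nonneg) simp
  show "(inner u u = 0) = (u = 0)"
  proof
    assume "inner u u = 0"
    hence "inner (coord u i) (coord u i) = 0" for i
      unfolding inner_ltwo_def
      by (intro nonneg_infsum_le_0D[where A = UNIV]) (auto simp: summ)
    thus "u = 0"
      by (intro ltwo_eqI) simp
  qed (simp add: inner_ltwo_def)
  show "norm u = sqrt (inner u u)" "sgn u = inverse (norm u) *\<^sub>R u" "dist u v = norm (u - v)"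
    by (simp_all add: norm_ltwo_def sgn_ltwo_def dist_ltwo_def)
qed (rule uniformity_ltwo_def open_ltwo_def)+

end

lemma sum_norm_coord_le:
  assumes "finite F"
  shows "(\<Sum>i\<in>F. (norm (coord u i))\<^sup>2) \<le> (norm u)\<^sup>2"
proof -
  have "(norm u)\<^sup>2 = (\<Sum>\<^sub>\<infinity>i. (norm (coord u i))\<^sup>2)"
    by (simp add: power2_norm_eq_inner inner_ltwo_def)
  moreover have "(\<Sum>i\<in>F. (norm (coord u i))\<^sup>2) \<le> (\<Sum>\<^sub>\<infinity>i. (norm (coord u i))\<^sup>2)"
    using assms square_summable_coord[of u] unfolding square_summable_def
    by (intro finite_sum_le_infsum) auto
  ultimately show ?thesis
    by simp
qed

lemma norm_ltwo_le:
  assumes "\<And>F. finite F \<Longrightarrow> (\<Sum>i\<in>F. (norm (coord u i))\<^sup>2) \<le> c\<^sup>2" "0 \<le> c"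
  shows "norm u \<le> c"
proof -
  have "(norm u)\<^sup>2 = (\<Sum>\<^sub>\<infinity>i. (norm (coord u i))\<^sup>2)"
    by (simp add: power2_norm_eq_inner inner_ltwo_def)
  also have "\<dots> \<le> c\<^sup>2"
    using assms square_summable_coord[of u] unfolding square_summable_def
    by (intro infsum_le_finite_sums) auto
  finally show ?thesis
    using assms(2) by (rule power2_le_imp_le)
qed

lemma norm_coord_le: "norm (coord u i) \<le> norm u"
proof (rule power2_le_imp_le)
  show "(norm (coord u i))\<^sup>2 \<le> (norm u)\<^sup>2"
    using sum_norm_coord_le[of "{i}" u] by simp
qed simp

instance ltwo :: (type, complex_hilbert) banach
proof
  fix X :: "nat \<Rightarrow> ('a, 'b) ltwo"
  assume X: "Cauchy X"
  have "Cauchy (\<lambda>n. coord (X n) i)" for i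
  proof (rule CauchyI)
    fix e :: real assume "0 < e"
    then obtain N where "\<forall>m\<ge>N. \<forall>n\<ge>N. norm (X m - X n) < e"
      using CauchyD[OF X] by blast
    thus "\<exists>N. \<forall>m\<ge>N. \<forall>n\<ge>N. norm (coord (X m) i - coord (X n) i) < e"
      by (metis coord_diff norm_coord_le order_le_less_trans)
  qed
  hence "\<exists>l. (\<lambda>n. coord (X n) i) \<longlonglongrightarrow> l" for i
    by (simp add: Cauchy_convergent_iff convergent_def)
  then obtain x where x: "\<And>i. (\<lambda>n. coord (X n) i) \<longlonglongrightarrow> x i"
    by metis
  have bound: "(\<Sum>i\<in>F. (norm (coord (X m) i - x i))\<^sup>2) \<le> e\<^sup>2"
    if N: "\<forall>m\<ge>N. \<forall>n\<ge>N. norm (X m - X n) < e" and m: "m \<ge> N" and F: "finite F" for e N m F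
  proof (rule Lim_bounded)
    show "(\<lambda>n. \<Sum>i\<in>F. (norm (coord (X m) i - coord (X n) i))\<^sup>2)
        \<longlonglongrightarrow> (\<Sum>i\<in>F. (norm (coord (X m) i - x i))\<^sup>2)"
      by (intro tendsto_intros x)
    show "\<forall>n\<ge>N. (\<Sum>i\<in>F. (norm (coord (X m) i - coord (X n) i))\<^sup>2) \<le> e\<^sup>2"
    proof (intro allI impI)
      fix n assume n: "n \<ge> N"
      have "(\<Sum>i\<in>F. (norm (coord (X m) i - coord (X n) i))\<^sup>2) \<le> (norm (X m - X n))\<^sup>2"
        using sum_norm_coord_le[OF F, of "X m - X n"] by simp
      also have "\<dots> \<le> e\<^sup>2"
        using N m n by (intro power_mono) (auto intro: less_imp_le)
      finally show "(\<Sum>i\<in>F. (norm (coord (X m) i - coord (X n) i))\<^sup>2) \<le> e\<^sup>2" .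
    qed
  qed
  obtain N1 where N1: "\<forall>m\<ge>N1. \<forall>n\<ge>N1. norm (X m - X n) < 1"
    using CauchyD[OF X, of 1] by auto
  have "square_summable (\<lambda>i. coord (X N1) i - x i)"
    unfolding square_summable_def
  proof (rule nonneg_bdd_above_summable_on)
    show "bdd_above (sum (\<lambda>i. (norm (coord (X N1) i - x i))\<^sup>2) ` {F. F \<subseteq> UNIV \<and> finite F})"
      using bound[OF N1 order_refl] by (intro bdd_aboveI[of _ "1\<^sup>2"]) blast
  qed (rule zero_le_power2)
  hence "square_summable (\<lambda>i. x i - coord (X N1) i)"
    unfolding square_summable_def by (simp only: norm_minus_commute)
  from square_summable_add[OF this square_summable_coord[of "X N1"]]
  have sx: "square_summable x"
    by (simp only: diff_add_cancel)
  have "X \<longlonglongrightarrow> Abs_ltwo x"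
  proof (rule LIMSEQ_I)
    fix e :: real assume e: "0 < e"
    then obtain N where N: "\<forall>m\<ge>N. \<forall>n\<ge>N. norm (X m - X n) < e / 2"
      using CauchyD[OF X, of "e / 2"] by auto
    have "norm (X m - Abs_ltwo x) < e" if "m \<ge> N" for m
    proof -
      have "norm (X m - Abs_ltwo x) \<le> e / 2"
      proof (rule norm_ltwo_le)
        show "(\<Sum>i\<in>F. (norm (coord (X m - Abs_ltwo x) i))\<^sup>2) \<le> (e / 2)\<^sup>2" if "finite F" for F
          unfolding coord_diff coord_Abs[OF sx] using bound[OF N \<open>m \<ge> N\<close> that] .
        show "0 \<le> e / 2"
          using e by simp
      qed
      thus ?thesis
        using e by linarith
    qed
    thus "\<exists>N. \<forall>m\<ge>N. norm (X m - Abs_ltwo x) < e"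
      by blast
  qed
  thus "convergent X"
    by (rule convergentI)
qed

instantiation ltwo :: (type, complex_hilbert) complex_hilbert
begin

definition "c *\<^sub>C u = Abs_ltwo (\<lambda>i. c *\<^sub>C coord u i)"
definition "cinner u v = (\<Sum>\<^sub>\<infinity>i. cinner (coord u i) (coord v i))"

lemma coord_scaleC [simp]: "coord (c *\<^sub>C u) i = c *\<^sub>C coord u i"
  unfolding scaleC_ltwo_def
  by (subst coord_Abs)
    (auto intro: square_summable_bound[OF square_summable_coord, of _ "cmod c"] simp: norm_scaleC)

lemma summable_cinner: "(\<lambda>i. cinner (coord u i) (coord v i)) summable_on UNIV"
proof -
  have "square_summable (\<lambda>i. \<i> *\<^sub>C coord v i)"
    by (rule square_summable_bound[OF square_summable_coord[of v], of _ 1]) (simp add: norm_scaleC)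
  hence "(\<lambda>i. complex_of_real (inner (coord u i) (coord v i)) +
      \<i> * complex_of_real (inner (coord u i) (\<i> *\<^sub>C coord v i))) summable_on UNIV"
    by (intro summable_on_add summable_on_cmult_right summable_on_of_real square_summable_inner
        square_summable_coord)
  thus ?thesis
    unfolding cinner_eq Complex_eq .
qed

instance
proof
  fix u v w :: "('a, 'b) ltwo" and c d :: complex and r :: real
  show "c *\<^sub>C (u + v) = c *\<^sub>C u + c *\<^sub>C v" "(c + d) *\<^sub>C u = c *\<^sub>C u + d *\<^sub>C u"
    "c *\<^sub>C d *\<^sub>C u = (c * d) *\<^sub>C u" "complex_of_real r *\<^sub>C u = r *\<^sub>R u"
    by (rule ltwo_eqI;
        simp add: scaleC_add_right scaleC_add_left scaleC_scaleC scaleC_of_real)+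
  show "cinner (u + v) w = cinner u w + cinner v w"
    unfolding cinner_ltwo_def by (simp add: cinner_add_left infsum_add summable_cinner)
  show "cinner (c *\<^sub>C u) v = c * cinner u v"
    unfolding cinner_ltwo_def by (simp add: cinner_scaleC_left infsum_cmult_right')
  show "cinner u v = cnj (cinner v u)"
  proof -
    have "cnj (cinner v u) = (\<Sum>\<^sub>\<infinity>i. cnj (cinner (coord v i) (coord u i)))"
      unfolding cinner_ltwo_def by (rule infsum_cnj[symmetric])
    thus ?thesis
      unfolding cinner_ltwo_def by (simp only: cinner_commute[symmetric])
  qed
  have "((\<lambda>i. Re (cinner (coord u i) (coord v i))) has_sum Re (cinner u v)) UNIV"
    unfolding cinner_ltwo_def by (intro has_sum_Re has_sum_infsum summable_cinner)
  thus "Re (cinner u v) = inner u v"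
    unfolding inner_ltwo_def Re_cinner by (rule infsumI[symmetric])
qed

end

section \<open>Operators\<close>

definition bounded_clinear :: "('a::complex_hilbert \<Rightarrow> 'b::complex_hilbert) \<Rightarrow> bool" where
  "bounded_clinear A \<longleftrightarrow> bounded_linear A \<and> (\<forall>c x. A (c *\<^sub>C x) = c *\<^sub>C A x)"

definition cadj :: "('a::complex_hilbert \<Rightarrow> 'b::complex_hilbert) \<Rightarrow> 'b \<Rightarrow> 'a" where
  "cadj A = (SOME B. \<forall>x y. cinner (A x) y = cinner x (B y))"

definition positive_op :: "('a::complex_hilbert \<Rightarrow> 'a) \<Rightarrow> bool" where
  "positive_op A \<longleftrightarrow> bounded_clinear A \<and> (\<forall>x. cinner (A x) x \<in> \<real>\<^sub>\<ge>\<^sub>0)"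

definition op_sqrt :: "('a::complex_hilbert \<Rightarrow> 'a) \<Rightarrow> 'a \<Rightarrow> 'a" where
  "op_sqrt A = (SOME B. positive_op B \<and> (\<forall>x. B (B x) = A x))"

definition isometry :: "('a::complex_hilbert \<Rightarrow> 'b::complex_hilbert) \<Rightarrow> bool" where
  "isometry V \<longleftrightarrow> bounded_clinear V \<and> (\<forall>x. norm (V x) = norm x)"

definition csubspace :: "'a::complex_hilbert set \<Rightarrow> bool" where
  "csubspace S \<longleftrightarrow> 0 \<in> S \<and> (\<forall>x\<in>S. \<forall>y\<in>S. x + y \<in> S) \<and> (\<forall>c. \<forall>x\<in>S. c *\<^sub>C x \<in> S)"

definition closed_span :: "'a::complex_hilbert set \<Rightarrow> 'a set" where
  "closed_span S = closure (csubspace hull S)"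

definition unitary_between ::
    "'a::complex_hilbert set \<Rightarrow> 'b::complex_hilbert set \<Rightarrow> ('a \<Rightarrow> 'b) \<Rightarrow> bool" where
  "unitary_between S S' W \<longleftrightarrow> bij_betw W S S' \<and>
    (\<forall>x\<in>S. \<forall>y\<in>S. W (x + y) = W x + W y) \<and> (\<forall>c. \<forall>x\<in>S. W (c *\<^sub>C x) = c *\<^sub>C W x) \<and>
    (\<forall>x\<in>S. \<forall>y\<in>S. cinner (W x) (W y) = cinner x y)"

text \<open>An \<open>n\<close>-tuple of operators is a family indexed by a finite type \<^typ>\<open>'n\<close>; the free
  semigroup on the index type is \<^typ>\<open>'n list\<close> with \<^term>\<open>(@)\<close>.\<close>

definition op_tuples :: "('n \<Rightarrow> 'h::complex_hilbert \<Rightarrow> 'h) set" where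
  "op_tuples = {X. \<forall>i. bounded_clinear (X i)}"

primrec word_op :: "('n \<Rightarrow> 'h \<Rightarrow> 'h) \<Rightarrow> 'n list \<Rightarrow> 'h \<Rightarrow> 'h" where
  "word_op X [] = id"
| "word_op X (i # \<alpha>) = X i \<circ> word_op X \<alpha>"

definition row_norm :: "('n::finite \<Rightarrow> 'h::complex_hilbert \<Rightarrow> 'h) \<Rightarrow> real" where
  "row_norm X = sqrt (onorm (\<lambda>h. \<Sum>i\<in>UNIV. X i (cadj (X i) h)))"

definition op_ball :: "real \<Rightarrow> ('n::finite \<Rightarrow> 'h::complex_hilbert \<Rightarrow> 'h) set" where
  "op_ball \<gamma> = {X \<in> op_tuples. row_norm X < \<gamma>}"

section \<open>Noncommutative formal power series\<close>

type_synonym 'n nc_series = "'n list \<Rightarrow> complex"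

definition nc_polynomial :: "'n nc_series \<Rightarrow> bool" where
  "nc_polynomial p \<longleftrightarrow> finite {\<alpha>. p \<alpha> \<noteq> 0}"

definition nc_one :: "'n nc_series" where
  "nc_one \<alpha> = (if \<alpha> = [] then 1 else 0)"

definition nc_var :: "'n \<Rightarrow> 'n nc_series" where
  "nc_var i \<alpha> = (if \<alpha> = [i] then 1 else 0)"

definition nc_mult :: "'n nc_series \<Rightarrow> 'n nc_series \<Rightarrow> 'n nc_series" where
  "nc_mult p q \<alpha> = (\<Sum>k\<le>length \<alpha>. p (take k \<alpha>) * q (drop k \<alpha>))"

primrec nc_word :: "('n \<Rightarrow> 'n nc_series) \<Rightarrow> 'n list \<Rightarrow> 'n nc_series" where
  "nc_word f [] = nc_one"
| "nc_word f (i # \<alpha>) = nc_mult (f i) (nc_word f \<alpha>)"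

text \<open>The series \<open>\<Sum>\<^sub>\<alpha> a\<^sub>\<alpha> f\<^sub>\<alpha>\<close>, formed coefficientwise. It is used only when \<open>a\<close> is a polynomial
  or \<open>f(0) = 0\<close>; then every coefficient is a finite sum.\<close>

definition nc_comp :: "'n nc_series \<Rightarrow> ('n \<Rightarrow> 'n nc_series) \<Rightarrow> 'n nc_series" where
  "nc_comp a f \<beta> = (\<Sum>\<^sub>\<infinity>\<alpha>. a \<alpha> * nc_word f \<alpha> \<beta>)"

definition nc_radius :: "'n::finite nc_series \<Rightarrow> ereal" where
  "nc_radius c = conv_radius (\<lambda>k. sqrt (\<Sum>\<alpha> | length \<alpha> = k. (cmod (c \<alpha>))\<^sup>2))"

definition jacobian_0 :: "('n::finite \<Rightarrow> 'n nc_series) \<Rightarrow> complex ^ 'n ^ 'n" where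
  "jacobian_0 f = (\<chi> i j. f i [j])"

section \<open>Evaluation of series at operator tuples\<close>

definition hom_part ::
    "'n::finite nc_series \<Rightarrow> ('n \<Rightarrow> 'h::complex_hilbert \<Rightarrow> 'h) \<Rightarrow> nat \<Rightarrow> 'h \<Rightarrow> 'h" where
  "hom_part c X k h = (\<Sum>\<alpha> | length \<alpha> = k. c \<alpha> *\<^sub>C word_op X \<alpha> h)"

definition norm_sums :: "(nat \<Rightarrow> 'h::complex_hilbert \<Rightarrow> 'h) \<Rightarrow> ('h \<Rightarrow> 'h) \<Rightarrow> bool" where
  "norm_sums A L \<longleftrightarrow> bounded_clinear L \<and>
    (\<lambda>N. onorm (\<lambda>h. (\<Sum>k<N. A k h) - L h)) \<longlonglongrightarrow> 0"

definition sot_sums :: "(nat \<Rightarrow> 'h::complex_hilbert \<Rightarrow> 'h) \<Rightarrow> ('h \<Rightarrow> 'h) \<Rightarrow> bool" where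
  "sot_sums A L \<longleftrightarrow> bounded_clinear L \<and> (\<forall>h. (\<lambda>k. A k h) sums L h)"

definition radial_sums ::
    "real \<Rightarrow> 'n::finite nc_series \<Rightarrow> ('n \<Rightarrow> 'h::complex_hilbert \<Rightarrow> 'h) \<Rightarrow> ('h \<Rightarrow> 'h) \<Rightarrow> bool" where
  "radial_sums \<delta> c X L \<longleftrightarrow> bounded_clinear L \<and>
    (\<exists>S. (\<forall>r\<in>{\<delta><..<1}. norm_sums (hom_part c (\<lambda>i h. r *\<^sub>R X i h)) (S r)) \<and>
         (\<forall>h. ((\<lambda>r. S r h) \<longlongrightarrow> L h) (at_left 1)))"

definition conv_sot ::
    "('n::finite \<Rightarrow> 'n nc_series) \<Rightarrow> ('n \<Rightarrow> 'h::complex_hilbert \<Rightarrow> 'h) set" where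
  "conv_sot f = {X \<in> op_tuples. \<forall>j. \<exists>L. sot_sums (hom_part (f j) X) L}"

definition conv_rad ::
    "('n::finite \<Rightarrow> 'n nc_series) \<Rightarrow> ('n \<Rightarrow> 'h::complex_hilbert \<Rightarrow> 'h) set" where
  "conv_rad f = {X \<in> op_tuples. \<exists>\<delta>\<in>{0<..<1}. \<forall>j. \<exists>L. radial_sums \<delta> (f j) X L}"

text \<open>The tuple \<open>f(X)\<close>. On \<open>conv_sot f \<inter> conv_rad f\<close> the two meanings agree by Abel's theorem.\<close>

definition nc_eval ::
    "('n::finite \<Rightarrow> 'n nc_series) \<Rightarrow> ('n \<Rightarrow> 'h::complex_hilbert \<Rightarrow> 'h) \<Rightarrow> 'n \<Rightarrow> 'h \<Rightarrow> 'h" where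
  "nc_eval f X j =
    (if X \<in> conv_sot f then SOME L. sot_sums (hom_part (f j) X) L
     else SOME L. \<exists>\<delta>\<in>{0<..<1}. radial_sums \<delta> (f j) X L)"

text \<open>The map on \<open>op_ball \<gamma>\<close> given by a free holomorphic function, i.e. by a series \<open>c\<close> with
  \<open>\<gamma> \<le> nc_radius c\<close>. There the series converges in norm, so its sum may be taken pointwise.\<close>

definition nc_map ::
    "'n::finite nc_series \<Rightarrow> ('n \<Rightarrow> 'h::complex_hilbert \<Rightarrow> 'h) \<Rightarrow> 'h \<Rightarrow> 'h" where
  "nc_map c X h = (\<Sum>k. hom_part c X k h)"

section \<open>The model property\<close>

text \<open>Elements of \<open>\<bbbH>\<^sup>2(f)\<close> are represented by their coordinates in the orthonormal basis
  \<open>(f\<^sub>\<alpha>)\<close>, i.e. \<open>b :: ('n list, complex) ltwo\<close> stands for \<open>\<Sum>\<^sub>\<alpha> b\<^sub>\<alpha> f\<^sub>\<alpha>\<close>. Concretely this is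
  \<^item> (polynomial case) the polynomial \<open>nc_comp (coord b) f\<close> if \<open>b\<close> is finitely supported, and a
    point of the completion in general;
  \<^item> (series case) the formal power series \<open>nc_comp (coord b) f\<close>;
  \<^item> (function case) the map \<open>X \<mapsto> G(f(X))\<close> on \<open>[B(H)\<^sup>n]\<^sub>\<gamma>\<close>, where \<open>G = \<Sum>\<^sub>\<alpha> b\<^sub>\<alpha> Z\<^sub>\<alpha>\<close> and
    \<open>H = \<ell>\<^sup>2(\<nat>)\<close>.

  In each case \<open>g i\<close> is the family of coordinates of \<open>Z\<^sub>i\<close>, so that \<open>g\<close> is the inverse of \<open>f\<close>, and
  \<open>M i\<close> is left multiplication by \<open>Z\<^sub>i\<close> in these coordinates.\<close>

text \<open>In the polynomial case \<open>M i\<close> is the continuous extension to the completion of left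
  multiplication by \<open>Z\<^sub>i\<close> on polynomials.\<close>

definition poly_model ::
    "('n::finite \<Rightarrow> 'n nc_series) \<Rightarrow> ('n \<Rightarrow> 'n nc_series) \<Rightarrow>
      ('n \<Rightarrow> ('n list, complex) ltwo \<Rightarrow> ('n list, complex) ltwo) \<Rightarrow> bool" where
  "poly_model f g M \<longleftrightarrow>
    (\<forall>i. nc_polynomial (f i) \<and> nc_polynomial (g i)) \<and>
    (\<forall>i. nc_comp (f i) g = nc_var i \<and> nc_comp (g i) f = nc_var i) \<and>
    (\<forall>i. bounded_clinear (M i) \<and>
      (\<forall>b. nc_polynomial (coord b) \<longrightarrow> nc_polynomial (coord (M i b)) \<and>
        nc_comp (coord (M i b)) f = nc_mult (nc_var i) (nc_comp (coord b) f)))"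

definition series_left_mult ::
    "('n::finite \<Rightarrow> 'n nc_series) \<Rightarrow> 'n nc_series \<Rightarrow>
      (('n list, complex) ltwo \<Rightarrow> ('n list, complex) ltwo) \<Rightarrow> bool" where
  "series_left_mult f \<phi> A \<longleftrightarrow> bounded_clinear A \<and>
    (\<forall>b. nc_comp (coord (A b)) f = nc_mult \<phi> (nc_comp (coord b) f))"

definition series_model ::
    "('n::finite \<Rightarrow> 'n nc_series) \<Rightarrow> ('n \<Rightarrow> 'n nc_series) \<Rightarrow>
      ('n \<Rightarrow> ('n list, complex) ltwo \<Rightarrow> ('n list, complex) ltwo) \<Rightarrow> bool" where
  "series_model f g M \<longleftrightarrow>
    (\<forall>j. f j [] = 0 \<and> 0 < nc_radius (f j)) \<and> det (jacobian_0 f) \<noteq> 0 \<and>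
    (\<forall>i. square_summable (g i) \<and> nc_comp (g i) f = nc_var i) \<and>
    (\<forall>i. series_left_mult f (nc_var i) (M i)) \<and>
    M \<in> conv_sot f \<union> conv_rad f \<and>
    (\<forall>j. series_left_mult f (f j) (nc_eval f M j))"

definition function_left_mult ::
    "real \<Rightarrow> ('n::finite \<Rightarrow> 'n nc_series) \<Rightarrow> 'n nc_series \<Rightarrow>
      (('n list, complex) ltwo \<Rightarrow> ('n list, complex) ltwo) \<Rightarrow> bool" where
  "function_left_mult \<gamma> f \<phi> A \<longleftrightarrow> bounded_clinear A \<and>
    (\<forall>b. \<forall>X \<in> (op_ball \<gamma> :: ('n \<Rightarrow> (nat, complex) ltwo \<Rightarrow> (nat, complex) ltwo) set).
      nc_map (coord (A b)) (\<lambda>j. nc_map (f j) X) =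
      nc_map \<phi> X \<circ> nc_map (coord b) (\<lambda>j. nc_map (f j) X))"

definition function_model ::
    "('n::finite \<Rightarrow> 'n nc_series) \<Rightarrow> ('n \<Rightarrow> 'n nc_series) \<Rightarrow>
      ('n \<Rightarrow> ('n list, complex) ltwo \<Rightarrow> ('n list, complex) ltwo) \<Rightarrow> bool" where
  "function_model f g M \<longleftrightarrow> (\<exists>\<gamma>>0.
    let B = (op_ball \<gamma> :: ('n \<Rightarrow> (nat, complex) ltwo \<Rightarrow> (nat, complex) ltwo) set);
        F = (\<lambda>X j. nc_map (f j) X)
    in
    (\<forall>j. ereal \<gamma> \<le> nc_radius (f j)) \<and> (\<forall>X\<in>B. F X \<in> op_ball 1) \<and>
    (\<forall>G. 1 \<le> nc_radius G \<and> G \<noteq> (\<lambda>_. 0) \<longrightarrow> (\<exists>X\<in>B. nc_map G (F X) \<noteq> (\<lambda>_. 0))) \<and>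
    (\<forall>i. square_summable (g i) \<and> (\<forall>X\<in>B. nc_map (g i) (F X) = X i)) \<and>
    (\<forall>i. function_left_mult \<gamma> f (nc_var i) (M i)) \<and>
    M \<in> conv_sot f \<union> conv_rad f \<and>
    (\<forall>j. function_left_mult \<gamma> f (f j) (nc_eval f M j)))"

text \<open>\<open>f\<close> has the model property iff \<open>model f g M\<close> for some \<open>g\<close> and \<open>M\<close>; these are then the
  inverse of \<open>f\<close> and the universal model of \<open>f\<close>.\<close>

definition model ::
    "('n::finite \<Rightarrow> 'n nc_series) \<Rightarrow> ('n \<Rightarrow> 'n nc_series) \<Rightarrow>
      ('n \<Rightarrow> ('n list, complex) ltwo \<Rightarrow> ('n list, complex) ltwo) \<Rightarrow> bool" where
  "model f g M \<longleftrightarrow> poly_model f g M \<or> series_model f g M \<or> function_model f g M"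

section \<open>The noncommutative domain\<close>

text \<open>\<open>g(f(X)) = X\<close>\<close>

definition inverts_at ::
    "('n::finite \<Rightarrow> 'n nc_series) \<Rightarrow> ('n \<Rightarrow> 'n nc_series) \<Rightarrow>
      ('n \<Rightarrow> 'h::complex_hilbert \<Rightarrow> 'h) \<Rightarrow> bool" where
  "inverts_at g f X \<longleftrightarrow> X \<in> conv_sot f \<union> conv_rad f \<and>
    ((\<forall>i. sot_sums (hom_part (g i) (nc_eval f X)) (X i)) \<or>
     (\<forall>i. radial_sums 0 (g i) (nc_eval f X) (X i)))"

definition nc_domain ::
    "('n::finite \<Rightarrow> 'n nc_series) \<Rightarrow> ('n \<Rightarrow> 'n nc_series) \<Rightarrow>
      ('n \<Rightarrow> 'h::complex_hilbert \<Rightarrow> 'h) set" where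
  "nc_domain f g = {X \<in> op_tuples. inverts_at g f X \<and> row_norm (nc_eval f X) \<le> 1}"

definition pure_tuple ::
    "('n::finite \<Rightarrow> 'n nc_series) \<Rightarrow> ('n \<Rightarrow> 'h::complex_hilbert \<Rightarrow> 'h) \<Rightarrow> bool" where
  "pure_tuple f T \<longleftrightarrow> (\<forall>h. (\<lambda>k. \<Sum>\<alpha> | length \<alpha> = k.
      word_op (nc_eval f T) \<alpha> (cadj (word_op (nc_eval f T) \<alpha>) h)) \<longlonglongrightarrow> 0)"

section \<open>Tensor products and the Poisson kernel\<close>

text \<open>The Hilbert tensor product of \<open>\<bbbH>\<^sup>2(f)\<close> with a closed subspace \<open>E\<close> of \<^typ>\<open>'b\<close> consists of
  the series \<open>\<Sum>\<^sub>\<alpha> f\<^sub>\<alpha> \<otimes> u\<^sub>\<alpha>\<close> with \<open>u\<^sub>\<alpha> \<in> E\<close>, \<open>\<Sum>\<^sub>\<alpha> \<parallel>u\<^sub>\<alpha>\<parallel>\<^sup>2 < \<infinity>\<close>, i.e. of the \<open>u :: ('n list, 'b) ltwo\<close>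
  with values in \<open>E\<close>.\<close>

definition tensor_space :: "'b::complex_hilbert set \<Rightarrow> ('i, 'b) ltwo set" where
  "tensor_space E = {u. \<forall>\<alpha>. coord u \<alpha> \<in> E}"

definition tensor :: "('i, complex) ltwo \<Rightarrow> 'b::complex_hilbert \<Rightarrow> ('i, 'b) ltwo" where
  "tensor \<phi> x = Abs_ltwo (\<lambda>\<alpha>. coord \<phi> \<alpha> *\<^sub>C x)"

definition basis_elem :: "'i \<Rightarrow> ('i, complex) ltwo" where
  "basis_elem \<alpha> = Abs_ltwo (\<lambda>\<beta>. if \<beta> = \<alpha> then 1 else 0)"

text \<open>\<open>ampl A\<close> is \<open>A \<otimes> I\<close> on \<open>('i, 'b) ltwo\<close>. The closed subspaces \<^term>\<open>tensor_space E\<close> reduce it,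
  so \<open>A \<otimes> I\<^sub>E\<close> and its adjoint are the restrictions of \<open>ampl A\<close> and \<open>cadj (ampl A)\<close>.\<close>

definition ampl ::
    "(('i, complex) ltwo \<Rightarrow> ('i, complex) ltwo) \<Rightarrow> ('i, 'b::complex_hilbert) ltwo \<Rightarrow> ('i, 'b) ltwo"
  where
  "ampl A = (SOME B. bounded_clinear B \<and> (\<forall>\<phi> x. B (tensor \<phi> x) = tensor (A \<phi>) x))"

definition defect_op ::
    "('n::finite \<Rightarrow> 'n nc_series) \<Rightarrow> ('n \<Rightarrow> 'h::complex_hilbert \<Rightarrow> 'h) \<Rightarrow> 'h \<Rightarrow> 'h" where
  "defect_op f T = op_sqrt (\<lambda>h. h - (\<Sum>j\<in>UNIV. nc_eval f T j (cadj (nc_eval f T j) h)))"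

definition defect_space ::
    "('n::finite \<Rightarrow> 'n nc_series) \<Rightarrow> ('n \<Rightarrow> 'h::complex_hilbert \<Rightarrow> 'h) \<Rightarrow> 'h set" where
  "defect_space f T = closure (range (defect_op f T))"

definition poisson_kernel ::
    "('n::finite \<Rightarrow> 'n nc_series) \<Rightarrow> ('n \<Rightarrow> 'h::complex_hilbert \<Rightarrow> 'h) \<Rightarrow> 'h \<Rightarrow> ('n list, 'h) ltwo"
  where
  "poisson_kernel f T h =
    (\<Sum>\<^sub>\<infinity>\<alpha>. tensor (basis_elem \<alpha>) (defect_op f T (cadj (word_op (nc_eval f T) \<alpha>) h)))"

section \<open>Dilations\<close>

definition isometric_dilation ::
    "('n \<Rightarrow> ('n list, complex) ltwo \<Rightarrow> ('n list, complex) ltwo) \<Rightarrow>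
      ('n \<Rightarrow> 'h::complex_hilbert \<Rightarrow> 'h) \<Rightarrow> 'e::complex_hilbert set \<Rightarrow>
      ('h \<Rightarrow> ('n list, 'e) ltwo) \<Rightarrow> bool" where
  "isometric_dilation M T E V \<longleftrightarrow>
    isometry V \<and> range V \<subseteq> tensor_space E \<and>
    (\<forall>i. cadj (ampl (M i)) ` range V \<subseteq> range V) \<and>
    (\<forall>i. T i = cadj V \<circ> ampl (M i) \<circ> V)"

definition minimal_dilation ::
    "('n \<Rightarrow> ('n list, complex) ltwo \<Rightarrow> ('n list, complex) ltwo) \<Rightarrow>
      'e::complex_hilbert set \<Rightarrow> ('h::complex_hilbert \<Rightarrow> ('n list, 'e) ltwo) \<Rightarrow> bool" where
  "minimal_dilation M E V \<longleftrightarrow>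
    tensor_space E = closed_span (\<Union>\<alpha>. ampl (word_op M \<alpha>) ` range V)"

end

theory Submission
  imports Defs
begin

text \<open>
  Let \<open>A\<^sub>j = f\<^sub>j(T)\<close> and let \<open>D\<close> be the defect operator. All three cases of the model property are used
  through two facts about the basis \<open>f\<^sub>\<alpha>\<close> only: \<open>f\<^sub>j(M\<^sub>Z)\<close> is the shift \<open>f\<^sub>\<beta> \<mapsto> f\<^sub>j\<^sub>\<beta>\<close>, and
  \<open>M\<^sub>Z\<^sub>i f\<^sub>\<beta>\<close> has the coefficients of \<open>g\<^sub>i\<close> moved from \<open>\<alpha>\<close> to \<open>\<alpha>\<beta>\<close>; both follow from the injectivity of
  \<open>a \<mapsto> \<Sum>\<^sub>\<alpha> a\<^sub>\<alpha> f\<^sub>\<alpha>\<close>. Since the adjoint of the Poisson kernel \<open>K\<close> maps \<open>f\<^sub>\<beta> \<otimes> x\<close> to \<open>A\<^sub>\<beta> D x\<close>, it carries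
  \<open>M\<^sub>Z\<^sub>i \<otimes> I\<close> to \<open>g\<^sub>i(A) = T\<^sub>i\<close>, which gives co-invariance and the dilation formula; \<open>K\<close> is isometric because
  \<open>\<parallel>D h\<parallel>\<^sup>2 = \<parallel>h\<parallel>\<^sup>2 - \<Sum>\<^sub>j \<parallel>A\<^sub>j\<^sup>* h\<parallel>\<^sup>2\<close> telescopes. Strong (or radial) convergence of \<open>f\<^sub>j(M\<^sub>Z)\<close> passes to the
  amplification by uniform boundedness, so the span in the minimality claim is invariant under the shifts and
  hence contains \<open>f\<^sub>\<beta> \<otimes> D h\<close>. For another dilation \<open>V\<close>, Abel summation yields \<open>V\<^sup>* (f\<^sub>j(M\<^sub>Z) \<otimes> I) = A\<^sub>j V\<^sup>*\<close>, so
  \<open>V h = \<Sum>\<^sub>\<alpha> f\<^sub>\<alpha> \<otimes> G A\<^sub>\<alpha>\<^sup>* h\<close> with \<open>\<parallel>G h\<parallel> = \<parallel>D h\<parallel>\<close>, and \<open>D h \<mapsto> G h\<close> induces the unitary.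
\<close>

section \<open>Complex Hilbert spaces\<close>

text \<open>The hypotheses mix two modes of convergence: \<open>f\<close> at \<open>M\<close>,
  \<open>f\<close> at \<open>T\<close> and \<open>g\<close> at \<open>f(T)\<close> may each converge
  strongly or only radially, independently of one another. Applied to a vector, both modes give Abel
  sums, whose limits are unique; this is the common ground on which the series are compared.
  Intertwining is proved on the adjoint side: co-invariance of the range of \<open>V\<close>
  upgrades the compression formula to \<open>cadj V (ampl (M i) u) = T i (cadj V u)\<close>, which
  iterates over words, whereas a compression alone does not. Adjoints, square roots, amplifications
  and values of series are chosen by \<open>SOME\<close>, so nothing is known about them until a
  witness exists; this accounts for the Riesz theorem, the power series of the root and the norm
  bound for \<open>A \<otimes> I\<close>. Minimality uses the limit defining
  \<open>f_j(M) \<otimes> I\<close> at every vector, uniqueness uses it at elementary tensors, where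
  it reduces to a limit in the scalar space.\<close>

lemma scaleC_zero_left [simp]: "(0 :: complex) *\<^sub>C x = 0"
  by (metis add_cancel_left_left scaleC_add_left add.right_neutral)

lemma scaleC_zero_right [simp]: "c *\<^sub>C (0 :: 'a::complex_hilbert) = 0"
  by (metis add_cancel_left_left scaleC_add_right add.right_neutral)

lemma scaleC_one [simp]: "1 *\<^sub>C x = x"
  by (metis of_real_1 scaleC_of_real scaleR_one)

lemma scaleC_minus_left: "(- c) *\<^sub>C x = - (c *\<^sub>C x)"
  by (metis add.right_inverse minus_unique scaleC_add_left scaleC_zero_left)

lemma scaleC_minus_right: "c *\<^sub>C (- x) = - (c *\<^sub>C x)"
  by (metis add.right_inverse minus_unique scaleC_add_right scaleC_zero_right)

lemma scaleC_diff_right: "c *\<^sub>C (x - y) = c *\<^sub>C x - c *\<^sub>C y"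
  by (metis scaleC_add_right scaleC_minus_right diff_conv_add_uminus)

lemma scaleC_diff_left: "(c - d) *\<^sub>C x = c *\<^sub>C x - d *\<^sub>C x"
  by (metis scaleC_add_left scaleC_minus_left diff_conv_add_uminus)

lemma scaleC_sum_left: "(\<Sum>i\<in>F. c i) *\<^sub>C x = (\<Sum>i\<in>F. c i *\<^sub>C x)"
  by (induction F rule: infinite_finite_induct) (simp_all add: scaleC_add_left)

lemma scaleR_scaleC: "r *\<^sub>R c *\<^sub>C x = c *\<^sub>C r *\<^sub>R x"
  by (metis mult.commute scaleC_of_real scaleC_scaleC)

lemma cinner_add_right: "cinner x (y + z) = cinner x y + cinner x z"
  by (metis cinner_add_left cinner_commute complex_cnj_add)

lemma cinner_scaleC_right: "cinner x (c *\<^sub>C y) = cnj c * cinner x y"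
  by (metis cinner_commute cinner_scaleC_left complex_cnj_mult)

lemma cinner_zero_left [simp]: "cinner 0 y = 0"
  by (metis cinner_scaleC_left mult_zero_left scaleC_zero_left)

lemma cinner_zero_right [simp]: "cinner x 0 = 0"
  by (metis cinner_commute cinner_zero_left complex_cnj_zero)

lemma cinner_scaleR_left: "cinner (r *\<^sub>R x) y = of_real r * cinner x y"
  by (metis cinner_scaleC_left scaleC_of_real)

lemma cinner_minus_left: "cinner (- x) y = - cinner x y"
  by (metis add.right_inverse cinner_add_left cinner_zero_left minus_unique)

lemma cinner_minus_right: "cinner x (- y) = - cinner x y"
  by (metis add.right_inverse cinner_add_right cinner_zero_right minus_unique)

lemma cinner_diff_left: "cinner (x - y) z = cinner x z - cinner y z"
  by (metis cinner_add_left cinner_minus_left diff_conv_add_uminus)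

lemma cinner_diff_right: "cinner x (y - z) = cinner x y - cinner x z"
  by (metis cinner_add_right cinner_minus_right diff_conv_add_uminus)

lemma cinner_sum_left: "cinner (\<Sum>i\<in>F. x i) y = (\<Sum>i\<in>F. cinner (x i) y)"
  by (induction F rule: infinite_finite_induct) (simp_all add: cinner_add_left)

lemma cinner_sum_right: "cinner y (\<Sum>i\<in>F. x i) = (\<Sum>i\<in>F. cinner y (x i))"
  by (induction F rule: infinite_finite_induct) (simp_all add: cinner_add_right)

lemma cinner_same: "cinner x x = of_real ((norm x)\<^sup>2)"
proof -
  have "Im (cinner x x) = Im (cnj (cinner x x))"
    by (metis cinner_commute)
  hence "Im (cinner x x) = 0"
    by simp
  thus ?thesis
    by (simp add: complex_eq_iff Re_cinner power2_norm_eq_inner)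
qed

lemma cinner_eqI:
  assumes "\<And>x. cinner x y = cinner x z"
  shows "y = z"
proof -
  have "cinner (y - z) (y - z) = 0"
    by (simp add: cinner_diff_right assms)
  thus ?thesis
    by (simp add: cinner_same)
qed

lemma cmod_cinner_le: "cmod (cinner x y) \<le> norm x * norm y"
proof (cases "cinner x y = 0")
  case False
  \<comment> \<open>Rotating \<open>x\<close> by this unimodular scalar makes the inner product real
    and nonnegative, so the real Cauchy-Schwarz inequality applies.\<close>
  define c where "c = cnj (sgn (cinner x y))"
  have c: "cmod c = 1"
    using False by (simp add: c_def norm_sgn)
  have "c * cinner x y = of_real (cmod (cinner x y))"
    using False unfolding c_def sgn_eq
    by (simp add: field_simps complex_norm_square[symmetric] power2_eq_square)
  hence "cmod (cinner x y) = Re (cinner (c *\<^sub>C x) y)"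
    by (simp add: cinner_scaleC_left)
  also have "\<dots> \<le> norm (c *\<^sub>C x) * norm y"
    unfolding Re_cinner by (rule norm_cauchy_schwarz)
  finally show ?thesis
    by (simp add: norm_scaleC c)
qed simp

lemma bounded_linear_cinner_left: "bounded_linear (\<lambda>x. cinner x y)"
  by (rule bounded_linear_intro[where K = "norm y"])
    (simp_all add: cinner_add_left cinner_scaleR_left scaleR_conv_of_real cmod_cinner_le)

section \<open>Bounded operators\<close>

lemma bounded_clinearI:
  assumes "\<And>x y. A (x + y) = A x + A y" "\<And>c x. A (c *\<^sub>C x) = c *\<^sub>C A x"
    and "\<And>x. norm (A x) \<le> K * norm x"
  shows "bounded_clinear A"
  unfolding bounded_clinear_def
proof (intro conjI allI)
  show "bounded_linear A"
    by (rule bounded_linear_intro[where K = K])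
      (metis assms(1), metis assms(2) scaleC_of_real, metis assms(3) mult.commute)
qed (rule assms(2))

lemma bounded_clinear_linear: "bounded_clinear A \<Longrightarrow> bounded_linear A"
  by (simp add: bounded_clinear_def)

lemma bounded_clinear_scaleC: "bounded_clinear A \<Longrightarrow> A (c *\<^sub>C x) = c *\<^sub>C A x"
  by (simp add: bounded_clinear_def)

lemma bounded_clinear_add: "bounded_clinear A \<Longrightarrow> A (x + y) = A x + A y"
  by (simp add: bounded_clinear_def linear_simps)

lemma bounded_clinear_diff: "bounded_clinear A \<Longrightarrow> A (x - y) = A x - A y"
  by (simp add: bounded_clinear_def linear_simps)

lemma bounded_clinear_zero: "bounded_clinear A \<Longrightarrow> A 0 = 0"
  by (simp add: bounded_clinear_def linear_simps)

lemma bounded_clinear_scaleR: "bounded_clinear A \<Longrightarrow> A (r *\<^sub>R x) = r *\<^sub>R A x"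
  by (simp add: bounded_clinear_def linear_simps)

lemma bounded_clinear_sum: "bounded_clinear A \<Longrightarrow> A (\<Sum>i\<in>F. x i) = (\<Sum>i\<in>F. A (x i))"
  by (simp add: bounded_clinear_def linear_sum bounded_linear.linear)

lemma bounded_clinear_onorm: "bounded_clinear A \<Longrightarrow> norm (A x) \<le> onorm A * norm x"
  by (simp add: bounded_clinear_def onorm)

lemma bounded_clinear_id: "bounded_clinear (\<lambda>x. x)"
  by (simp add: bounded_clinear_def bounded_linear_ident)

lemma bounded_clinear_const_zero: "bounded_clinear (\<lambda>x. 0)"
  by (simp add: bounded_clinear_def bounded_linear_zero)

lemma bounded_clinear_compose:
  "bounded_clinear A \<Longrightarrow> bounded_clinear B \<Longrightarrow> bounded_clinear (\<lambda>x. A (B x))"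
  by (simp add: bounded_clinear_def bounded_linear_compose)

lemma bounded_clinear_plus:
  "bounded_clinear A \<Longrightarrow> bounded_clinear B \<Longrightarrow> bounded_clinear (\<lambda>x. A x + B x)"
  by (simp add: bounded_clinear_def bounded_linear_add scaleC_add_right)

lemma bounded_clinear_minus:
  "bounded_clinear A \<Longrightarrow> bounded_clinear B \<Longrightarrow> bounded_clinear (\<lambda>x. A x - B x)"
  by (simp add: bounded_clinear_def bounded_linear_sub scaleC_diff_right)

lemma bounded_clinear_cmult:
  "bounded_clinear A \<Longrightarrow> bounded_clinear (\<lambda>x. c *\<^sub>C A x)"
  by (rule bounded_clinearI[where K = "cmod c * onorm A"])
    (simp_all add: bounded_clinear_add bounded_clinear_scaleC scaleC_add_right scaleC_scaleC
      norm_scaleC mult.assoc mult_left_mono bounded_clinear_onorm mult.commute[of c])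

lemma bounded_clinear_sums:
  "(\<And>i. i \<in> F \<Longrightarrow> bounded_clinear (A i)) \<Longrightarrow> bounded_clinear (\<lambda>x. \<Sum>i\<in>F. A i x)"
  by (induction F rule: infinite_finite_induct)
    (auto intro: bounded_clinear_plus bounded_clinear_const_zero)

lemma bounded_clinear_word_op: "X \<in> op_tuples \<Longrightarrow> bounded_clinear (word_op X \<alpha>)"
  by (induction \<alpha>) (simp_all add: op_tuples_def id_def comp_def bounded_clinear_id bounded_clinear_compose)

lemma word_op_append: "word_op X (\<alpha> @ \<beta>) h = word_op X \<alpha> (word_op X \<beta> h)"
  by (induction \<alpha>) simp_all

section \<open>Riesz representation and adjoints\<close>

lemma riesz_representation:
  fixes \<phi> :: "'a::{real_inner, banach} \<Rightarrow> real"
  assumes "bounded_linear \<phi>"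
  shows "\<exists>y. \<forall>x. \<phi> x = inner x y"
proof -
  interpret bounded_linear \<phi> by fact
  \<comment> \<open>The Riesz vector is the minimizer of \<open>J\<close>: for
    \<open>\<phi> x = inner x y\<close> the value \<open>J x\<close> is the squared distance from
    \<open>x\<close> to \<open>y\<close> up to a constant. Boundedness of \<open>\<phi>\<close>
    bounds \<open>J\<close> below, and a parallelogram identity makes minimizing sequences
    Cauchy.\<close>
  define J where "J x = (norm x)\<^sup>2 - 2 * \<phi> x" for x
  obtain K where K: "\<And>x. norm (\<phi> x) \<le> norm x * K"
    using bounded by blast
  have "- (K\<^sup>2) \<le> J x" for x
  proof -
    have "\<phi> x \<le> norm x * K"
      using K[of x] by simp
    moreover have "0 \<le> (norm x - K)\<^sup>2"
      by simp
    ultimately show ?thesis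
      unfolding J_def by (simp add: power2_diff)
  qed
  hence bdd: "bdd_below (range J)"
    by (auto intro!: bdd_belowI)
  define m where "m = Inf (range J)"
  have m: "m \<le> J x" for x
    unfolding m_def by (rule cInf_lower[OF _ bdd]) simp
  have "\<exists>x. J x < m + inverse (Suc n)" for n
    using cInf_lessD[of "range J" "m + inverse (Suc n)"] unfolding m_def by auto
  then obtain x where x: "\<And>n. J (x n) < m + inverse (Suc n)"
    by metis
  have par: "(norm (a - b))\<^sup>2 = 2 * (J a + J b - 2 * J ((1/2) *\<^sub>R (a + b)))" for a b
    unfolding J_def power2_norm_eq_inner
    by (simp add: add scaleR inner_commute algebra_simps)
  have "Cauchy x"
  proof (rule CauchyI)
    fix e :: real assume e: "0 < e"
    \<comment> \<open>Two values of \<open>J\<close> within \<open>e\<^sup>2 / 4\<close> of the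
      infimum give, through \<open>par\<close> and \<open>m \<le> J\<close> at the midpoint, a
      squared distance below \<open>e\<^sup>2\<close>.\<close>
    obtain N where N: "inverse (Suc N) < e\<^sup>2 / 4"
      using reals_Archimedean[of "e\<^sup>2 / 4"] e by auto
    have "norm (x i - x j) < e" if "N \<le> i" "N \<le> j" for i j
    proof -
      have inv: "inverse (Suc k) \<le> inverse (Suc N)" if "N \<le> k" for k
        using that by (simp add: field_simps)
      have b: "J (x k) < m + e\<^sup>2 / 4" if "N \<le> k" for k
        using order_less_le_trans[OF x[of k] add_left_mono[OF inv[OF that]]] add_strict_left_mono[OF N]
        by (rule less_trans)
      have "(norm (x i - x j))\<^sup>2 < e\<^sup>2"
        unfolding par using b[OF that(1)] b[OF that(2)] m[of "(1/2) *\<^sub>R (x i + x j)"]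
        by argo
      thus ?thesis
        using e power2_less_imp_less by fastforce
    qed
    thus "\<exists>M. \<forall>m\<ge>M. \<forall>n\<ge>M. norm (x m - x n) < e"
      by blast
  qed
  then obtain y where y: "x \<longlonglongrightarrow> y"
    using Cauchy_convergent_iff convergent_def by blast
  have "(\<lambda>n. J (x n)) \<longlonglongrightarrow> J y"
    unfolding J_def by (intro tendsto_intros y tendsto)
  moreover have "(\<lambda>n. m + inverse (Suc n)) \<longlonglongrightarrow> m + 0"
    by (intro tendsto_intros LIMSEQ_inverse_real_of_nat)
  ultimately have Jy: "J y \<le> m"
    using LIMSEQ_le[of "\<lambda>n. J (x n)" "J y" "\<lambda>n. m + inverse (Suc n)"] x
    by (metis add.right_neutral less_imp_le)
  have "\<phi> z = inner z y" for z
  proof -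
    have q: "0 \<le> t\<^sup>2 * (norm z)\<^sup>2 + 2 * t * (inner z y - \<phi> z)" for t
    proof -
      have "J y \<le> J (y + t *\<^sub>R z)"
        using Jy m[of "y + t *\<^sub>R z"] by linarith
      thus ?thesis
        unfolding J_def power2_norm_eq_inner
        by (simp add: add scaleR inner_add_left inner_add_right inner_commute algebra_simps power2_eq_square)
    qed
    define d where "d = inner z y - \<phi> z"
    have "d = 0"
    proof (rule ccontr)
      assume "d \<noteq> 0"
      \<comment> \<open>Up to the added 1, which covers \<open>z = 0\<close>, this minimizes the
        quadratic in \<open>q\<close>. It makes that quadratic negative unless the first variation
        of \<open>J\<close> at \<open>y\<close> vanishes.\<close>
      define t where "t = - d / ((norm z)\<^sup>2 + 1)"
      have "t\<^sup>2 * (norm z)\<^sup>2 + 2 * t * d < 0"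
      proof -
        have p: "0 < (norm z)\<^sup>2 + 1" by (simp add: add_nonneg_pos)
        have "t\<^sup>2 * ((norm z)\<^sup>2 + 1) = - t * d"
          using p by (simp add: t_def power2_eq_square)
        moreover have "t * d = - (d\<^sup>2 / ((norm z)\<^sup>2 + 1))"
          by (simp add: t_def power2_eq_square)
        moreover have "0 < d\<^sup>2 / ((norm z)\<^sup>2 + 1)"
          using p \<open>d \<noteq> 0\<close> by (intro divide_pos_pos) auto
        moreover have "0 \<le> t\<^sup>2" by simp
        ultimately show ?thesis
          unfolding distrib_left mult.assoc by linarith
      qed
      thus False
        using q[of t] d_def by simp
    qed
    thus ?thesis
      by (simp add: d_def)
  qed
  thus ?thesis
    by blast
qed

text \<open>Riesz for the real functional \<open>inner (A _) y\<close> yields an adjoint for the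
  real inner product. Multiplication by \<open>\<i>\<close> is skew for it and commutes with
  \<open>A\<close>, so the imaginary part of \<open>cinner\<close> is respected too.\<close>

lemma cadj_exists:
  fixes A :: "'a::complex_hilbert \<Rightarrow> 'b::complex_hilbert"
  assumes A: "bounded_clinear A"
  shows "\<exists>B. \<forall>x y. cinner (A x) y = cinner x (B y)"
proof -
  have "\<exists>z. \<forall>x. inner (A x) y = inner x z" for y
    by (rule riesz_representation)
      (rule bounded_linear_inner_left_comp[OF bounded_clinear_linear[OF A]])
  then obtain B where B: "\<And>x y. inner (A x) y = inner x (B y)"
    by metis
  have rot: "inner x (\<i> *\<^sub>C y) = - inner (\<i> *\<^sub>C x) y" for x y :: "'c::complex_hilbert"
    unfolding Re_cinner[symmetric] by (simp add: cinner_scaleC_left cinner_scaleC_right)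
  have "cinner (A x) y = cinner x (B y)" for x y
    unfolding cinner_eq rot
    by (simp add: B bounded_clinear_scaleC[OF A, symmetric])
  thus ?thesis
    by blast
qed

lemma cinner_cadj: "bounded_clinear A \<Longrightarrow> cinner (A x) y = cinner x (cadj A y)"
  unfolding cadj_def using someI_ex[OF cadj_exists[of A]] by blast

lemma cinner_cadj': "bounded_clinear A \<Longrightarrow> cinner (cadj A y) x = cinner y (A x)"
  by (metis cinner_cadj cinner_commute)

text \<open>Since \<open>cadj\<close> is a choice, this uniqueness is what turns later identities
  for adjoints into checks of inner products.\<close>

lemma cadj_eqI:
  assumes "bounded_clinear A" "\<And>x. cinner (A x) y = cinner x z"
  shows "cadj A y = z"
  by (rule cinner_eqI) (metis assms cinner_cadj)

lemma norm_cadj_le: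
  assumes A: "bounded_clinear A"
  shows "norm (cadj A y) \<le> onorm A * norm y"
proof (cases "cadj A y = 0")
  case True
  thus ?thesis
    by (simp add: onorm_pos_le bounded_clinear_linear[OF A])
next
  case False
  have "(norm (cadj A y))\<^sup>2 = cmod (cinner (A (cadj A y)) y)"
    unfolding cinner_cadj[OF A] cinner_same by (simp add: norm_power)
  also have "\<dots> \<le> norm (A (cadj A y)) * norm y"
    by (rule cmod_cinner_le)
  also have "\<dots> \<le> onorm A * norm (cadj A y) * norm y"
    by (intro mult_right_mono bounded_clinear_onorm A) simp
  finally show ?thesis
    using False by (simp add: power2_eq_square algebra_simps)
qed

lemma bounded_clinear_cadj:
  assumes A: "bounded_clinear A"
  shows "bounded_clinear (cadj A)"
proof (rule bounded_clinearI)
  show "cadj A (x + y) = cadj A x + cadj A y" for x y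
    by (rule cadj_eqI[OF A]) (simp add: cinner_cadj[OF A] cinner_add_right)
  show "cadj A (c *\<^sub>C x) = c *\<^sub>C cadj A x" for c x
    by (rule cadj_eqI[OF A]) (simp add: cinner_cadj[OF A] cinner_scaleC_right)
qed (rule norm_cadj_le[OF A])

lemma cadj_compose:
  assumes "bounded_clinear A" "bounded_clinear B"
  shows "cadj (\<lambda>x. A (B x)) y = cadj B (cadj A y)"
  by (rule cadj_eqI) (simp_all add: bounded_clinear_compose assms cinner_cadj)

lemma cadj_word_op_Cons:
  assumes "X \<in> op_tuples"
  shows "cadj (word_op X (i # \<alpha>)) h = cadj (word_op X \<alpha>) (cadj (X i) h)"
  using cadj_compose[of "X i" "word_op X \<alpha>"] bounded_clinear_word_op[OF assms, of \<alpha>] assms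
  by (simp add: op_tuples_def comp_def)

lemma cadj_word_op_append:
  assumes "X \<in> op_tuples"
  shows "cadj (word_op X (\<alpha> @ \<beta>)) h = cadj (word_op X \<beta>) (cadj (word_op X \<alpha>) h)"
  using cadj_compose[OF bounded_clinear_word_op[OF assms, of \<alpha>] bounded_clinear_word_op[OF assms, of \<beta>]]
    word_op_append[of X \<alpha> \<beta>]
  by presburger

lemma cadj_word_op_Nil: "cadj (word_op X []) h = h"
  by (rule cadj_eqI) (simp_all add: id_def bounded_clinear_id)

section \<open>Square roots of positive operators\<close>

text \<open>Polarization over the complex scalars: the form \<open>s\<close> measuring asymmetry
  vanishes on the diagonal because the quadratic form of \<open>B\<close> is real. Evaluation at
  \<open>x + y\<close> and at \<open>x + \<i> *\<^sub>C y\<close> gives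
  \<open>s x y + s y x = 0\<close> and \<open>s y x = s x y\<close>.\<close>

lemma positive_op_selfadjoint:
  assumes B: "positive_op B"
  shows "cinner (B x) y = cinner x (B y)"
proof -
  have lin: "bounded_clinear B"
    using B by (simp add: positive_op_def)
  define s where "s a b = cinner (B a) b - cinner a (B b)" for a b
  have s0: "s z z = 0" for z
  proof -
    have "cinner (B z) z \<in> \<real>"
      using B nonneg_Reals_subset_Reals by (auto simp: positive_op_def)
    thus ?thesis
      unfolding s_def using cinner_commute[of z "B z"] Reals_cnj_iff[of "cinner (B z) z"] by simp
  qed
  have "s (x + y) (x + y) = s x x + s y y + s x y + s y x"
    by (simp add: s_def bounded_clinear_add[OF lin] cinner_add_left cinner_add_right)
  hence 1: "s x y + s y x = 0"
    by (simp add: s0)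
  have "s (x + \<i> *\<^sub>C y) (x + \<i> *\<^sub>C y) = s x x + s y y - \<i> * s x y + \<i> * s y x"
    by (simp add: s_def bounded_clinear_add[OF lin] bounded_clinear_scaleC[OF lin] cinner_add_left
        cinner_add_right cinner_scaleC_left cinner_scaleC_right algebra_simps)
  hence "\<i> * (s y x - s x y) = 0"
    by (simp add: s0 algebra_simps)
  hence 2: "s y x = s x y"
    by simp
  have "s x y = 0"
    using 1 2 by simp
  thus ?thesis
    by (simp add: s_def)
qed

text \<open>The Taylor coefficients of \<open>sqrt (1 - x)\<close>.\<close>

definition sqrt_coeff :: "nat \<Rightarrow> real" where
  "sqrt_coeff k = ((1/2) gchoose k) * (- 1) ^ k"

lemma sqrt_coeff_pochhammer: "sqrt_coeff k = pochhammer (- (1/2)) k / fact k"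
  by (simp add: sqrt_coeff_def gbinomial_pochhammer power_add[symmetric] mult.commute[of "(-1)^k"]
      power_mult_distrib[symmetric] flip: mult.assoc)

lemma sqrt_coeff_0 [simp]: "sqrt_coeff 0 = 1"
  by (simp add: sqrt_coeff_def)

lemma sqrt_coeff_Suc_nonpos: "sqrt_coeff (Suc k) \<le> 0"
proof -
  have "0 \<le> pochhammer (1/2 :: real) k"
    by (intro pochhammer_nonneg) simp
  thus ?thesis
    by (simp add: sqrt_coeff_pochhammer pochhammer_rec divide_nonpos_pos)
qed

text \<open>Partial sums of the coefficients of \<open>sqrt (1 - x)\<close> are the coefficients of
  \<open>sqrt (1 - x) / (1 - x)\<close>, the inverse square root, and these are
  \<open>pochhammer (1/2) m / fact m\<close>.\<close>

lemma sum_sqrt_coeff_nonneg: "0 \<le> (\<Sum>k\<le>m. sqrt_coeff k)"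
proof -
  have "(\<Sum>k\<le>m. sqrt_coeff k) = (- 1) ^ m * ((- (1/2)) gchoose m)"
    unfolding sqrt_coeff_def gbinomial_sum_lower_neg by simp
  also have "\<dots> = pochhammer (1/2) m / fact m"
    by (simp add: gbinomial_pochhammer flip: mult.assoc power_mult_distrib)
  also have "\<dots> \<ge> 0"
    by (intro divide_nonneg_nonneg pochhammer_nonneg) auto
  finally show ?thesis .
qed

text \<open>The square of \<open>sqrt (1 - x)\<close> is \<open>1 - x\<close>, read off
  coefficientwise by Vandermonde's identity.\<close>

lemma sqrt_coeff_convolution:
  "(\<Sum>k\<le>m. sqrt_coeff k * sqrt_coeff (m - k)) = (if m = 0 then 1 else if m = 1 then - 1 else 0)"
proof -
  have "(\<Sum>k\<le>m. sqrt_coeff k * sqrt_coeff (m - k)) =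
      (- 1) ^ m * (\<Sum>k\<le>m. ((1/2) gchoose k) * ((1/2) gchoose (m - k)))"
    unfolding sum_distrib_left
  proof (rule sum.cong)
    fix k assume "k \<in> {..m}"
    hence "(- 1 :: real) ^ m = (- 1) ^ k * (- 1) ^ (m - k)"
      by (simp flip: power_add)
    thus "sqrt_coeff k * sqrt_coeff (m - k) =
        (- 1) ^ m * (((1/2) gchoose k) * ((1/2) gchoose (m - k)))"
      by (simp add: sqrt_coeff_def)
  qed simp
  also have "\<dots> = (- 1) ^ m * ((1 :: real) gchoose m)"
    unfolding atMost_atLeast0 gbinomial_Vandermonde by simp
  also have "(1 :: real) gchoose m = of_nat (1 choose m)"
    using binomial_gbinomial[of 1 m, where ?'a = real] by simp
  also have "1 choose m = (if m \<le> 1 then 1 else 0)"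
    by (cases m rule: nat.exhaust; cases "m = 1") (auto simp: binomial_eq_0)
  finally show ?thesis
    by (auto simp: le_Suc_eq)
qed

lemma summable_sqrt_coeff: "summable (\<lambda>k. \<bar>sqrt_coeff k\<bar>)"
proof (rule summableI_nonneg_bounded)
  show "(\<Sum>k<n. \<bar>sqrt_coeff k\<bar>) \<le> 2" for n
  proof -
    \<comment> \<open>All coefficients but the first, which is 1, are nonpositive, so taking
      absolute values reflects the partial sums about 1.\<close>
    have "(\<Sum>k\<le>m. \<bar>sqrt_coeff k\<bar>) = 2 - (\<Sum>k\<le>m. sqrt_coeff k)" for m
      by (induction m) (auto simp: abs_of_nonpos[OF sqrt_coeff_Suc_nonpos])
    hence "(\<Sum>k\<le>n. \<bar>sqrt_coeff k\<bar>) \<le> 2"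
      using sum_sqrt_coeff_nonneg[of n] by simp
    moreover have "(\<Sum>k<n. \<bar>sqrt_coeff k\<bar>) \<le> (\<Sum>k\<le>n. \<bar>sqrt_coeff k\<bar>)"
      by (rule sum_mono2) auto
    ultimately show ?thesis
      by linarith
  qed
qed simp

text \<open>The root is the power series of \<open>sqrt (1 - x)\<close> at \<open>C\<close>;
  absolute summability of the coefficients makes it converge even when \<open>C\<close> has norm 1.
  Both conclusions are the properties by which \<open>op_sqrt\<close> is chosen, so one such
  operator proves them.\<close>

lemma op_sqrt_one_minus:
  fixes C :: "'a::complex_hilbert \<Rightarrow> 'a"
  assumes C: "positive_op C" and le: "\<And>x. norm (C x) \<le> norm x"
  shows "positive_op (op_sqrt (\<lambda>x. x - C x))"
    and "op_sqrt (\<lambda>x. x - C x) (op_sqrt (\<lambda>x. x - C x) x) = x - C x"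
proof -
  define p where "p k = C ^^ k" for k
  have p_0: "p 0 x = x" and p_Suc: "p (Suc k) x = C (p k x)" for k x
    by (simp_all add: p_def)
  have p_add: "p k (p l x) = p (k + l) x" for k l x
    by (simp add: p_def funpow_add)
  have p_lin: "bounded_clinear (p k)" for k
  proof (induction k)
    case 0
    show ?case
      using bounded_clinear_id by (simp add: p_def id_def)
  next
    case (Suc k)
    thus ?case
      using C bounded_clinear_compose[of C "p k"] by (simp add: p_def comp_def positive_op_def)
  qed
  have p_le: "norm (p k x) \<le> norm x" for k x
    by (induction k) (auto simp: p_def intro: order_trans[OF le])
  have p_sa: "cinner (p k x) y = cinner x (p k y)" for k x y
  proof (induction k arbitrary: x y)
    case (Suc k)
    have "cinner (p (Suc k) x) y = cinner x (p k (C y))"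
      by (simp add: p_Suc positive_op_selfadjoint[OF C] Suc)
    also have "p k (C y) = p (Suc k) y"
      by (simp add: p_def funpow_swap1)
    finally show ?case .
  qed (simp add: p_0)
  \<comment> \<open>For \<open>k = 2j\<close> the value is the squared norm of \<open>p j x\<close>;
    for \<open>k = 2j + 1\<close> it is the positive form of \<open>C\<close> at
    \<open>p j x\<close>. The upper bound is contractivity.\<close>
  have p_pos: "\<exists>t. 0 \<le> t \<and> t \<le> (norm x)\<^sup>2 \<and> cinner (p k x) x = of_real t" for k x
  proof -
    have real: "\<exists>t. 0 \<le> t \<and> cinner (p k x) x = of_real t"
    proof (cases "even k")
      case True
      then obtain j where "k = j + j"
        by (metis evenE mult_2)
      hence "cinner (p k x) x = of_real ((norm (p j x))\<^sup>2)"
        by (simp add: p_add[symmetric] p_sa[of j "p j x"] cinner_same del: of_real_power)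
      thus ?thesis
        by (metis zero_le_power2)
    next
      case False
      then obtain j where "k = j + Suc j"
        by (metis oddE mult_2 add.assoc Suc_eq_plus1)
      hence "cinner (p k x) x = cinner (C (p j x)) (p j x)"
        by (simp only: p_add[symmetric] p_sa[of j] p_Suc)
      moreover have "cinner (C (p j x)) (p j x) \<in> \<real>\<^sub>\<ge>\<^sub>0"
        using C by (simp add: positive_op_def)
      ultimately show ?thesis
        using nonneg_Reals_cases by metis
    qed
    then obtain t where t: "0 \<le> t" "cinner (p k x) x = of_real t"
      by blast
    have "t = cmod (cinner (p k x) x)"
      using t by simp
    also have "\<dots> \<le> norm (p k x) * norm x"
      by (rule cmod_cinner_le)
    also have "\<dots> \<le> norm x * norm x"
      by (intro mult_right_mono p_le) simp
    finally show ?thesis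
      using t by (auto simp: power2_eq_square)
  qed
  have c_summ: "(\<lambda>k. \<bar>sqrt_coeff k\<bar>) summable_on UNIV"
    using summable_sqrt_coeff by (intro norm_summable_imp_summable_on) simp
  have summ: "(\<lambda>k. sqrt_coeff k *\<^sub>R p k x) summable_on UNIV" for x
  proof (rule Infinite_Sum.abs_summable_summable, rule summable_on_comparison_test)
    show "(\<lambda>k. \<bar>sqrt_coeff k\<bar> * norm x) summable_on UNIV"
      by (intro summable_on_cmult_left c_summ)
  qed (auto intro!: mult_left_mono p_le)
  define B where "B x = (\<Sum>\<^sub>\<infinity>k. sqrt_coeff k *\<^sub>R p k x)" for x
  have B: "((\<lambda>k. sqrt_coeff k *\<^sub>R p k x) has_sum B x) UNIV" for x
    unfolding B_def by (rule has_sum_infsum[OF summ])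
  have B_lin: "bounded_clinear B"
  proof (rule bounded_clinearI)
    fix x y c
    have "((\<lambda>k. sqrt_coeff k *\<^sub>R p k (x + y)) has_sum B x + B y) UNIV"
      using has_sum_add[OF B[of x] B[of y]] by (simp add: bounded_clinear_add[OF p_lin] scaleR_add_right)
    thus "B (x + y) = B x + B y"
      using B has_sum_unique by blast
    have "((\<lambda>k. sqrt_coeff k *\<^sub>R p k (c *\<^sub>C x)) has_sum c *\<^sub>C B x) UNIV"
      using has_sum_bounded_linear[OF bounded_clinear_linear[OF bounded_clinear_cmult[OF bounded_clinear_id]] B[of x], of c]
      by (simp add: bounded_clinear_scaleC[OF p_lin] scaleR_scaleC)
    thus "B (c *\<^sub>C x) = c *\<^sub>C B x"
      using B has_sum_unique by blast
    show "norm (B x) \<le> (\<Sum>\<^sub>\<infinity>k. \<bar>sqrt_coeff k\<bar>) * norm x"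
      by (rule norm_infsum_le[OF B has_sum_cmult_left[OF has_sum_infsum[OF c_summ]]])
        (auto intro!: mult_left_mono p_le)
  qed
  have "cinner (B x) x \<in> \<real>\<^sub>\<ge>\<^sub>0" for x
  proof -
    obtain t where t: "\<And>k. 0 \<le> t k" "\<And>k. t k \<le> (norm x)\<^sup>2" "\<And>k. cinner (p k x) x = of_real (t k)"
      using p_pos by metis
    have "((\<lambda>k. cinner (sqrt_coeff k *\<^sub>R p k x) x) has_sum cinner (B x) x) UNIV"
      using has_sum_bounded_linear[OF bounded_linear_cinner_left B] .
    hence hs: "((\<lambda>k. of_real (sqrt_coeff k * t k)) has_sum cinner (B x) x) UNIV"
      by (simp add: cinner_scaleR_left t)
    have "0 \<le> Re (cinner (B x) x)"
    proof -
      have "(\<lambda>k. sqrt_coeff k * t k) sums Re (cinner (B x) x)"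
        using has_sum_imp_sums[OF has_sum_Re[OF hs]] by simp
      hence "(\<lambda>n. \<Sum>k\<le>n. sqrt_coeff k * t k) \<longlonglongrightarrow> Re (cinner (B x) x)"
        by (simp add: sums_def_le)
      moreover have "0 \<le> (\<Sum>k\<le>n. sqrt_coeff k * t k)" for n
      proof -
        \<comment> \<open>Replacing each \<open>t k\<close> by the larger squared norm of
          \<open>x\<close> can only decrease the sum, as the coefficients are nonpositive for
          \<open>k > 0\<close> and the two agree at \<open>k = 0\<close>. What remains is a partial
          sum of coefficients.\<close>
        have "0 \<le> (\<Sum>k\<le>n. sqrt_coeff k) * (norm x)\<^sup>2"
          by (intro mult_nonneg_nonneg sum_sqrt_coeff_nonneg) simp
        also have "\<dots> \<le> (\<Sum>k\<le>n. sqrt_coeff k * t k)"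
          unfolding sum_distrib_right
        proof (rule sum_mono)
          fix k
          show "sqrt_coeff k * (norm x)\<^sup>2 \<le> sqrt_coeff k * t k"
          proof (cases k)
            case 0
            have "of_real (t 0) = (of_real ((norm x)\<^sup>2) :: complex)"
              using t(3)[of 0] by (simp add: p_0 cinner_same)
            hence "t 0 = (norm x)\<^sup>2"
              by (simp only: of_real_eq_iff)
            thus ?thesis
              by (simp add: 0)
          next
            case (Suc j)
            thus ?thesis
              using t(2)[of k] sqrt_coeff_Suc_nonpos[of j] by (simp add: mult_left_mono_neg)
          qed
        qed
        finally show ?thesis .
      qed
      ultimately show ?thesis
        by (intro LIMSEQ_le_const) auto
    qed
    moreover have "Im (cinner (B x) x) = 0"
      using has_sum_Im[OF hs] has_sum_unique[OF _ has_sum_0] by force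
    ultimately show ?thesis
      by (simp add: complex_nonneg_Reals_iff)
  qed
  hence B_pos: "positive_op B"
    using B_lin by (simp add: positive_op_def)
  have B_sq: "B (B x) = x - C x" for x
  proof -
    \<comment> \<open>The terms of the formal product of the series with itself. They are dominated
      by a product of two absolutely summable families, so they may be regrouped by total degree,
      where the convolution identity leaves only degrees 0 and 1.\<close>
    define F where "F k l = (sqrt_coeff k * sqrt_coeff l) *\<^sub>R p (k + l) x" for k l
    have Fk: "(F k has_sum sqrt_coeff k *\<^sub>R p k (B x)) UNIV" for k
      using has_sum_bounded_linear[OF bounded_linear_compose[OF bounded_linear_scaleR_right
          bounded_clinear_linear[OF p_lin]] B[of x], of "sqrt_coeff k" k]
      by (simp add: F_def[abs_def] bounded_clinear_scaleR[OF p_lin] p_add)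
    have Fs: "(\<lambda>(k, l). F k l) summable_on UNIV \<times> UNIV"
    proof -
      have n: "norm (F k l) \<le> \<bar>sqrt_coeff k\<bar> * norm x * \<bar>sqrt_coeff l\<bar>" for k l
        using mult_left_mono[OF p_le[of "k + l" x], of "\<bar>sqrt_coeff k\<bar> * \<bar>sqrt_coeff l\<bar>"]
        by (simp add: F_def abs_mult algebra_simps)
      have s: "(\<lambda>l. norm (case (k, l) of (k, l) \<Rightarrow> F k l)) summable_on UNIV" for k
        by (rule Infinite_Sum.abs_summable_on_comparison_test'[OF summable_on_cmult_right[OF c_summ]])
          (simp, rule n)
      have s': "(\<lambda>k. norm (\<Sum>\<^sub>\<infinity>l. norm (case (k, l) of (k, l) \<Rightarrow> F k l))) summable_on UNIV"
      proof (rule Infinite_Sum.abs_summable_on_comparison_test'[OF summable_on_cmult_left[OF c_summ]])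
        fix k
        have "(\<Sum>\<^sub>\<infinity>l. norm (F k l)) \<le> (\<Sum>\<^sub>\<infinity>l. \<bar>sqrt_coeff k\<bar> * norm x * \<bar>sqrt_coeff l\<bar>)"
          by (rule infsum_mono[OF _ summable_on_cmult_right[OF c_summ] n]) (use s in simp)
        thus "norm (\<Sum>\<^sub>\<infinity>l. norm (case (k, l) of (k, l) \<Rightarrow> F k l))
            \<le> \<bar>sqrt_coeff k\<bar> * (norm x * (\<Sum>\<^sub>\<infinity>l. \<bar>sqrt_coeff l\<bar>))"
          by (simp add: infsum_cmult_right' infsum_nonneg mult.assoc)
      qed
      show ?thesis
        using s s' by (rule_tac Infinite_Sum.abs_summable_summable, rule_tac iffD2[OF Infinite_Sum.abs_summable_on_Sigma_iff])
          blast
    qed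
    have bij: "bij_betw (\<lambda>(m, k). (k, m - k)) (Sigma UNIV (\<lambda>m. {..m})) (UNIV \<times> UNIV :: (nat \<times> nat) set)"
      by (rule bij_betw_byWitness[where f' = "\<lambda>(k, l). (k + l, k)"]) auto
    have "B (B x) = (\<Sum>\<^sub>\<infinity>k. \<Sum>\<^sub>\<infinity>l. F k l)"
      unfolding B_def[of "B x"] using infsumI[OF Fk] by simp
    also have "\<dots> = (\<Sum>\<^sub>\<infinity>(k, l)\<in>UNIV \<times> UNIV. F k l)"
      by (rule infsum_Sigma'_banach[OF Fs])
    also have "\<dots> = (\<Sum>\<^sub>\<infinity>(m, k)\<in>Sigma UNIV (\<lambda>m. {..m}). F k (m - k))"
      using infsum_reindex_bij_betw[OF bij, of "\<lambda>(k, l). F k l"]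
      by (simp add: case_prod_unfold del: UNIV_Times_UNIV)
    also have "\<dots> = (\<Sum>\<^sub>\<infinity>m. \<Sum>\<^sub>\<infinity>k\<in>{..m}. F k (m - k))"
      using Fs summable_on_reindex_bij_betw[OF bij, of "\<lambda>(k, l). F k l"]
      by (intro infsum_Sigma'_banach[symmetric]) (simp add: case_prod_unfold del: UNIV_Times_UNIV)
    also have "\<dots> = (\<Sum>\<^sub>\<infinity>m. (\<Sum>k\<le>m. sqrt_coeff k * sqrt_coeff (m - k)) *\<^sub>R p m x)"
      by (intro infsum_cong) (simp add: F_def scaleR_sum_left)
    also have "\<dots> = (\<Sum>\<^sub>\<infinity>m\<in>{0, 1}. (\<Sum>k\<le>m. sqrt_coeff k * sqrt_coeff (m - k)) *\<^sub>R p m x)"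
      unfolding sqrt_coeff_convolution by (rule infsum_cong_neutral) auto
    also have "\<dots> = x - C x"
      unfolding sqrt_coeff_convolution by (simp add: p_def)
    finally show ?thesis .
  qed
  have "\<exists>B. positive_op B \<and> (\<forall>x. B (B x) = x - C x)"
    using B_pos B_sq by blast
  from someI_ex[OF this]
  show "positive_op (op_sqrt (\<lambda>x. x - C x))"
    "op_sqrt (\<lambda>x. x - C x) (op_sqrt (\<lambda>x. x - C x) x) = x - C x"
    unfolding op_sqrt_def by blast+
qed

section \<open>Square-summable families and amplifications\<close>

lemma has_sum_diff:
  fixes f g :: "'i \<Rightarrow> 'b::real_normed_vector"
  assumes "(f has_sum a) A" "(g has_sum b) A"
  shows "((\<lambda>i. f i - g i) has_sum a - b) A"
proof -
  have "((\<lambda>i. - g i) has_sum - b) A"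
    using assms(2) by (simp add: has_sum_uminus)
  from has_sum_add[OF assms(1) this] show ?thesis
    by simp
qed

text \<open>Unordered sums are limits of nets; increasing finite sets \<open>G n\<close> with tails
  below \<open>1 / (n + 1)\<close> reduce completeness to a Cauchy sequence.\<close>

lemma summable_on_Cauchy:
  fixes f :: "'i \<Rightarrow> 'b::banach"
  assumes "\<And>e. 0 < e \<Longrightarrow> \<exists>F0. finite F0 \<and> (\<forall>F. finite F \<and> F \<inter> F0 = {} \<longrightarrow> norm (sum f F) < e)"
  shows "f summable_on UNIV"
proof -
  have "\<exists>F0. finite F0 \<and> (\<forall>F. finite F \<and> F \<inter> F0 = {} \<longrightarrow> norm (sum f F) < inverse (real (Suc n)))" for n
    by (rule assms) simp
  then obtain F0 where F0: "\<And>n. finite (F0 n)"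
    "\<And>n F. finite F \<Longrightarrow> F \<inter> F0 n = {} \<Longrightarrow> norm (sum f F) < inverse (real (Suc n))"
    by metis
  define G where "G n = (\<Union>m\<le>n. F0 m)" for n
  have fin: "finite (G n)" for n
    by (simp add: G_def F0)
  have mono: "G m \<subseteq> G n" if "m \<le> n" for m n
    using that unfolding G_def by (intro UN_mono) auto
  have tail: "norm (sum f F - sum f (G n)) < inverse (real (Suc n))" if "finite F" "G n \<subseteq> F" for F n
  proof -
    have "sum f F - sum f (G n) = sum f (F - G n)"
      using that by (simp add: sum_diff)
    thus ?thesis
      using F0(2)[of "F - G n" n] that by (auto simp: G_def)
  qed
  have "Cauchy (\<lambda>n. sum f (G n))"
  proof (rule CauchyI')
    fix e :: real assume "0 < e"
    then obtain N where N: "inverse (real (Suc N)) < e"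
      using reals_Archimedean by blast
    have "dist (sum f (G m)) (sum f (G n)) < e" if "N \<le> m" "m < n" for m n
    proof -
      have "dist (sum f (G m)) (sum f (G n)) < inverse (real (Suc m))"
        using tail[OF fin mono] that by (simp add: dist_norm norm_minus_commute)
      also have "\<dots> \<le> inverse (real (Suc N))"
        using that by (simp add: field_simps)
      finally show ?thesis
        using N by linarith
    qed
    thus "\<exists>M. \<forall>m\<ge>M. \<forall>n>m. dist (sum f (G m)) (sum f (G n)) < e"
      by blast
  qed
  then obtain l where l: "(\<lambda>n. sum f (G n)) \<longlonglongrightarrow> l"
    using Cauchy_convergent_iff convergent_def by blast
  have "(f has_sum l) UNIV"
    unfolding has_sum_def
  proof (rule tendstoI)
    fix e :: real assume e: "0 < e"
    have "\<forall>\<^sub>F n in sequentially. dist (sum f (G n)) l < e / 2"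
      using l e by (intro tendstoD) auto
    moreover have "\<forall>\<^sub>F n in sequentially. inverse (real (Suc n)) < e / 2"
      using LIMSEQ_inverse_real_of_nat e by (intro order_tendstoD) auto
    ultimately have "\<forall>\<^sub>F n in sequentially. dist (sum f (G n)) l < e / 2 \<and> inverse (real (Suc n)) < e / 2"
      by (rule eventually_conj)
    then obtain n where n: "dist (sum f (G n)) l < e / 2" "inverse (real (Suc n)) < e / 2"
      using eventually_happens'[OF sequentially_bot] by blast
    have "dist (sum f F) l < e" if "finite F" "G n \<subseteq> F" for F
      using tail[OF that] n dist_triangle[of "sum f F" l "sum f (G n)"]
      by (simp add: dist_norm)
    thus "\<forall>\<^sub>F F in finite_subsets_at_top UNIV. dist (sum f F) l < e"
      using fin[of n] unfolding eventually_finite_subsets_at_top by blast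
  qed
  thus ?thesis
    by (rule has_sum_imp_summable)
qed

text \<open>Meant for families such as \<open>A e_i \<otimes> u_i\<close>, whose norms are
  square-summable but in general not summable; the quadratic bound on finite sums takes the place of
  absolute convergence.\<close>

lemma summable_on_if_sum_squares_le:
  fixes f :: "'i \<Rightarrow> 'b::banach"
  assumes h: "h summable_on UNIV" "\<And>i. 0 \<le> h i"
    and le: "\<And>F. finite F \<Longrightarrow> (norm (sum f F))\<^sup>2 \<le> C * sum h F"
  shows "f summable_on UNIV"
proof (rule summable_on_Cauchy)
  fix e :: real assume e: "0 < e"
  have C: "(norm (sum f F))\<^sup>2 \<le> \<bar>C\<bar> * sum h F" if "finite F" for F
    using le[OF that] mult_right_mono[of C "\<bar>C\<bar>" "sum h F"] sum_nonneg[of F h] h(2) by fastforce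
  define d where "d = e\<^sup>2 / (\<bar>C\<bar> + 1)"
  have d: "0 < d"
    using e by (simp add: d_def)
  obtain F0 where F0: "finite F0" "dist (sum h F0) (infsum h UNIV) \<le> d / 2"
    using infsum_finite_approximation[OF h(1), of "d / 2"] d by auto
  have "norm (sum f F) < e" if F: "finite F" "F \<inter> F0 = {}" for F
  proof -
    have "sum h F + sum h F0 = sum h (F \<union> F0)"
      using F F0 by (simp add: sum.union_disjoint)
    also have "\<dots> \<le> infsum h UNIV"
      using F F0 h by (intro finite_sum_le_infsum) auto
    finally have "sum h F < d"
      using F0(2) d by (simp add: dist_real_def abs_if split: if_splits)
    have "(norm (sum f F))\<^sup>2 \<le> \<bar>C\<bar> * sum h F"
      by (rule C[OF F(1)])
    also have "\<dots> \<le> (\<bar>C\<bar> + 1) * sum h F"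
      using h(2) by (intro mult_right_mono sum_nonneg) auto
    also have "\<dots> < (\<bar>C\<bar> + 1) * d"
      using \<open>sum h F < d\<close> by (intro mult_strict_left_mono) auto
    also have "\<dots> = e\<^sup>2"
      by (simp add: d_def)
    finally show ?thesis
      using e power2_less_imp_less by fastforce
  qed
  thus "\<exists>F0. finite F0 \<and> (\<forall>F. finite F \<and> F \<inter> F0 = {} \<longrightarrow> norm (sum f F) < e)"
    using F0(1) by blast
qed

section \<open>Coordinates, basis vectors and elementary tensors\<close>

lemma norm_ltwo_has_sum: "((\<lambda>i. (norm (coord u i))\<^sup>2) has_sum (norm u)\<^sup>2) UNIV"
proof -
  have "(norm u)\<^sup>2 = (\<Sum>\<^sub>\<infinity>i. (norm (coord u i))\<^sup>2)"
    by (simp add: power2_norm_eq_inner inner_ltwo_def)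
  thus ?thesis
    using square_summable_coord[of u] by (simp add: square_summable_def)
qed

lemma coord_sum: "coord (\<Sum>k\<in>F. u k) i = (\<Sum>k\<in>F. coord (u k) i)"
  by (induction F rule: infinite_finite_induct) simp_all

lemma bounded_clinear_coord: "bounded_clinear (\<lambda>u. coord u i)"
  by (rule bounded_clinearI[where K = 1]) (simp_all add: norm_coord_le)

lemma coord_tensor [simp]: "coord (tensor \<phi> x) i = coord \<phi> i *\<^sub>C x"
  unfolding tensor_def
  by (subst coord_Abs)
    (auto intro!: square_summable_bound[OF square_summable_coord, of _ "norm x"]
      simp: norm_scaleC mult.commute)

lemma coord_basis_elem [simp]: "coord (basis_elem i) j = (if j = i then 1 else 0)"
proof -
  have "finite {j. (if j = i then 1 else 0 :: complex) \<noteq> 0}"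
    by (rule finite_subset[of _ "{i}"]) (auto split: if_splits)
  hence "square_summable (\<lambda>j. if j = i then 1 else 0 :: complex)"
    unfolding square_summable_def
    by (intro finite_nonzero_values_imp_summable_on) (auto elim!: rev_finite_subset)
  thus ?thesis
    by (simp add: basis_elem_def coord_Abs)
qed

lemma tensor_add_left: "tensor (\<phi> + \<psi>) x = tensor \<phi> x + tensor \<psi> x"
  by (rule ltwo_eqI) (simp add: scaleC_add_left)

lemma tensor_add_right: "tensor \<phi> (x + y) = tensor \<phi> x + tensor \<phi> y"
  by (rule ltwo_eqI) (simp add: scaleC_add_right)

lemma tensor_diff_right: "tensor \<phi> (x - y) = tensor \<phi> x - tensor \<phi> y"
  by (rule ltwo_eqI) (simp add: scaleC_diff_right)

lemma tensor_scaleC_left: "tensor (c *\<^sub>C \<phi>) x = c *\<^sub>C tensor \<phi> x"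
  by (rule ltwo_eqI) (simp add: scaleC_complex_def scaleC_scaleC)

lemma tensor_scaleC_right: "tensor \<phi> (c *\<^sub>C x) = c *\<^sub>C tensor \<phi> x"
  by (rule ltwo_eqI) (simp add: scaleC_scaleC mult.commute)

lemma tensor_zero_right [simp]: "tensor \<phi> 0 = 0"
  by (rule ltwo_eqI) simp

lemma tensor_sum_left: "tensor (\<Sum>k\<in>F. \<phi> k) x = (\<Sum>k\<in>F. tensor (\<phi> k) x)"
  by (rule ltwo_eqI) (simp add: coord_sum scaleC_sum_left)

lemma norm_tensor: "norm (tensor \<phi> x) = norm \<phi> * norm x"
proof -
  have "((\<lambda>i. (norm (coord (tensor \<phi> x) i))\<^sup>2) has_sum (norm \<phi>)\<^sup>2 * (norm x)\<^sup>2) UNIV"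
    using has_sum_cmult_left[OF norm_ltwo_has_sum[of \<phi>], of "(norm x)\<^sup>2"]
    by (simp add: norm_scaleC power_mult_distrib)
  from has_sum_unique[OF norm_ltwo_has_sum this]
  have "(norm (tensor \<phi> x))\<^sup>2 = (norm \<phi> * norm x)\<^sup>2"
    by (simp add: power_mult_distrib)
  thus ?thesis
    by simp
qed

lemma bounded_clinear_tensor_left: "bounded_clinear (\<lambda>\<phi>. tensor \<phi> x)"
  by (rule bounded_clinearI[where K = "norm x"])
    (simp_all add: tensor_add_left tensor_scaleC_left norm_tensor)

lemma bounded_clinear_tensor_right: "bounded_clinear (\<lambda>x. tensor \<phi> x)"
  by (rule bounded_clinearI[where K = "norm \<phi>"])
    (simp_all add: tensor_add_right tensor_scaleC_right norm_tensor)

lemma cinner_ltwo_has_sum: "((\<lambda>i. cinner (coord u i) (coord v i)) has_sum cinner u v) UNIV"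
  unfolding cinner_ltwo_def by (rule has_sum_infsum[OF summable_cinner])

lemma cinner_tensor_basis: "cinner u (tensor (basis_elem i) x) = cinner (coord u i) x"
proof -
  have "((\<lambda>j. cinner (coord u j) (coord (tensor (basis_elem i) x) j)) has_sum
      cinner (coord u i) x) UNIV"
    by (rule has_sum_finite_neutralI[of "{i}"]) auto
  thus ?thesis
    using cinner_ltwo_has_sum has_sum_unique by blast
qed

lemma cinner_tensor_basis_left: "cinner (tensor (basis_elem i) x) u = cinner x (coord u i)"
  by (metis cinner_commute cinner_tensor_basis)

text \<open>By orthogonality, cutting \<open>u\<close> off outside a finite \<open>F\<close> leaves
  an error whose squared norm is exactly the missing part of the sum of squares.\<close>

lemma basis_expansion: "((\<lambda>i. tensor (basis_elem i) (coord u i)) has_sum u) UNIV"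
proof -
  define s where "s F = (\<Sum>i\<in>F. tensor (basis_elem i) (coord u i))" for F
  have eq: "(norm (s F - u))\<^sup>2 = (norm u)\<^sup>2 - (\<Sum>i\<in>F. (norm (coord u i))\<^sup>2)" if F: "finite F" for F
  proof -
    have c: "coord (s F) i = (if i \<in> F then coord u i else 0)" for i
      unfolding s_def coord_sum using F by (simp add: if_distrib if_distribR cong: if_cong)
    have "((\<lambda>i. (norm (coord u i))\<^sup>2 - (norm (coord (s F) i))\<^sup>2) has_sum
        (norm u)\<^sup>2 - (\<Sum>i\<in>F. (norm (coord u i))\<^sup>2)) UNIV"
    proof (rule has_sum_diff[OF norm_ltwo_has_sum])
      show "((\<lambda>i. (norm (coord (s F) i))\<^sup>2) has_sum (\<Sum>i\<in>F. (norm (coord u i))\<^sup>2)) UNIV"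
        using F by (intro has_sum_finite_neutralI[of F]) (auto simp: c)
    qed
    hence "((\<lambda>i. (norm (coord (s F - u) i))\<^sup>2) has_sum
        (norm u)\<^sup>2 - (\<Sum>i\<in>F. (norm (coord u i))\<^sup>2)) UNIV"
      by (rule iffD1[OF has_sum_cong, rotated]) (simp add: c)
    thus ?thesis
      using norm_ltwo_has_sum has_sum_unique by blast
  qed
  have "((\<lambda>F. (norm u)\<^sup>2 - (\<Sum>i\<in>F. (norm (coord u i))\<^sup>2)) \<longlongrightarrow> (norm u)\<^sup>2 - (norm u)\<^sup>2)
      (finite_subsets_at_top UNIV)"
    using norm_ltwo_has_sum[of u] unfolding has_sum_def by (intro tendsto_intros)
  hence "((\<lambda>F. (norm (s F - u))\<^sup>2) \<longlongrightarrow> (norm u)\<^sup>2 - (norm u)\<^sup>2) (finite_subsets_at_top UNIV)"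
    by (rule Lim_transform_eventually)
      (auto simp: eq intro: eventually_finite_subsets_at_top_weakI)
  hence "((\<lambda>F. (norm (s F - u))\<^sup>2) \<longlongrightarrow> 0) (finite_subsets_at_top UNIV)"
    by simp
  hence "((\<lambda>F. sqrt ((norm (s F - u))\<^sup>2)) \<longlongrightarrow> sqrt 0) (finite_subsets_at_top UNIV)"
    by (rule tendsto_real_sqrt)
  hence "((\<lambda>F. s F) \<longlongrightarrow> u) (finite_subsets_at_top UNIV)"
    by (simp add: tendsto_norm_zero_cancel Lim_null[of s u] tendsto_norm_zero_iff)
  thus ?thesis
    by (simp add: has_sum_def s_def)
qed

lemma basis_expansion_complex:
  fixes \<phi> :: "('i, complex) ltwo"
  shows "((\<lambda>i. coord \<phi> i *\<^sub>C basis_elem i) has_sum \<phi>) UNIV"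
proof -
  have "tensor (basis_elem i) (coord \<phi> i) = coord \<phi> i *\<^sub>C basis_elem i" for i
    by (rule ltwo_eqI) (simp add: scaleC_complex_def)
  thus ?thesis
    using basis_expansion[of \<phi>] by simp
qed

section \<open>Amplifications of operators\<close>

lemma bounded_clinear_has_sum:
  "bounded_clinear A \<Longrightarrow> (f has_sum x) S \<Longrightarrow> ((\<lambda>i. A (f i)) has_sum A x) S"
  using has_sum_bounded_linear bounded_clinear_linear by blast

text \<open>Every vector is the sum of its components along the basis, so bounded operators need
  comparing only there. Identities for amplifications, shifts and the adjoint of the kernel are
  checked in this way.\<close>

lemma bounded_clinear_eqI_tensor:
  assumes A: "bounded_clinear A" and B: "bounded_clinear B"
    and eq: "\<And>i x. A (tensor (basis_elem i) x) = B (tensor (basis_elem i) x)"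
  shows "A u = B u"
  using bounded_clinear_has_sum[OF A basis_expansion[of u]]
    bounded_clinear_has_sum[OF B basis_expansion[of u]]
  unfolding eq by (rule has_sum_unique)

lemma norm_sq_add_orthogonal: "cinner u v = 0 \<Longrightarrow> (norm (u + v))\<^sup>2 = (norm u)\<^sup>2 + (norm v)\<^sup>2"
  using Re_cinner[of u v] by (simp add: power2_norm_eq_inner inner_add_left inner_add_right inner_commute)

lemma cinner_tensor_orthogonal:
  assumes "cinner x y = 0"
  shows "cinner (tensor \<phi> x) (tensor \<psi> y) = 0"
  unfolding cinner_ltwo_def by (simp add: cinner_scaleC_left cinner_scaleC_right assms)

text \<open>Splitting off the component of all \<open>x k\<close> along one of them reduces the number of vectors and
  keeps the summands orthogonal.\<close>

lemma norm_sum_tensor_le: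
  fixes A :: "('i, complex) ltwo \<Rightarrow> ('i, complex) ltwo" and x :: "'k \<Rightarrow> 'b::complex_hilbert"
  assumes A: "bounded_clinear A" and K: "finite K"
  shows "norm (\<Sum>k\<in>K. tensor (A (\<phi> k)) (x k)) \<le> onorm A * norm (\<Sum>k\<in>K. tensor (\<phi> k) (x k))"
  using K
proof (induction K arbitrary: \<phi> x rule: finite_induct)
  case (insert k0 K)
  show ?case
  proof (cases "x k0 = 0")
    case True
    thus ?thesis
      using insert by simp
  next
    case False
    define c where "c k = cinner (x k) (x k0) / of_real ((norm (x k0))\<^sup>2)" for k
    define y where "y k = x k - c k *\<^sub>C x k0" for k
    define \<psi> where "\<psi> = \<phi> k0 + (\<Sum>k\<in>K. c k *\<^sub>C \<phi> k)"
    have "cinner (y k) (x k0) = 0" for k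
      using False by (simp add: y_def c_def cinner_diff_left cinner_scaleC_left cinner_same)
    hence orth0: "cinner (x k0) (y k) = 0" for k
      by (metis cinner_commute complex_cnj_zero)
    have orth: "cinner (tensor \<eta> (x k0)) (\<Sum>k\<in>K. tensor (\<theta> k) (y k)) = 0"
      for \<eta> and \<theta> :: "'k \<Rightarrow> ('i, complex) ltwo"
      by (simp add: cinner_sum_right cinner_tensor_orthogonal[OF orth0])
    \<comment> \<open>Stated for an arbitrary \<open>L\<close> so that \<open>L = A\<close> and the
      identity decompose both sides of the inequality in the same manner.\<close>
    have split: "(\<Sum>k\<in>insert k0 K. tensor (L (\<phi> k)) (x k)) =
        tensor (L \<psi>) (x k0) + (\<Sum>k\<in>K. tensor (L (\<phi> k)) (y k))"
      if "bounded_clinear L" for L :: "('i, complex) ltwo \<Rightarrow> ('i, complex) ltwo"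
    proof -
      have "(\<Sum>k\<in>K. tensor (L (\<phi> k)) (x k)) =
          tensor (\<Sum>k\<in>K. c k *\<^sub>C L (\<phi> k)) (x k0) + (\<Sum>k\<in>K. tensor (L (\<phi> k)) (y k))"
        by (simp add: y_def tensor_diff_right tensor_scaleC_right tensor_scaleC_left tensor_sum_left
            flip: sum.distrib)
      thus ?thesis
        using insert that
        by (simp add: \<psi>_def bounded_clinear_add bounded_clinear_sum bounded_clinear_scaleC
            tensor_add_left add.assoc)
    qed
    have "(norm (\<Sum>k\<in>insert k0 K. tensor (A (\<phi> k)) (x k)))\<^sup>2 =
        (norm (A \<psi>) * norm (x k0))\<^sup>2 + (norm (\<Sum>k\<in>K. tensor (A (\<phi> k)) (y k)))\<^sup>2"
      unfolding split[OF A] by (subst norm_sq_add_orthogonal[OF orth]) (simp add: norm_tensor)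
    also have "\<dots> \<le> (onorm A * norm \<psi> * norm (x k0))\<^sup>2 +
        (onorm A * norm (\<Sum>k\<in>K. tensor (\<phi> k) (y k)))\<^sup>2"
      by (intro add_mono power_mono insert.IH mult_right_mono bounded_clinear_onorm A) auto
    also have "\<dots> = (onorm A)\<^sup>2 * ((norm \<psi> * norm (x k0))\<^sup>2 + (norm (\<Sum>k\<in>K. tensor (\<phi> k) (y k)))\<^sup>2)"
      by (simp add: power_mult_distrib distrib_left mult.assoc)
    also have "(norm \<psi> * norm (x k0))\<^sup>2 + (norm (\<Sum>k\<in>K. tensor (\<phi> k) (y k)))\<^sup>2 =
        (norm (\<Sum>k\<in>insert k0 K. tensor (\<phi> k) (x k)))\<^sup>2"
      unfolding split[OF bounded_clinear_id] by (subst norm_sq_add_orthogonal[OF orth]) (simp add: norm_tensor)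
    finally have "(norm (\<Sum>k\<in>insert k0 K. tensor (A (\<phi> k)) (x k)))\<^sup>2 \<le>
        (onorm A * norm (\<Sum>k\<in>insert k0 K. tensor (\<phi> k) (x k)))\<^sup>2"
      by (simp add: power_mult_distrib)
    thus ?thesis
      by (rule power2_le_imp_le)
        (intro mult_nonneg_nonneg onorm_pos_le bounded_clinear_linear A norm_ge_zero)
  qed
qed simp

lemma summable_tensor_basis:
  fixes A :: "('i, complex) ltwo \<Rightarrow> ('i, complex) ltwo"
  assumes A: "bounded_clinear A"
  shows "(\<lambda>i. tensor (A (basis_elem i)) (coord u i)) summable_on UNIV"
proof (rule summable_on_if_sum_squares_le)
  show "(\<lambda>i. (norm (coord u i))\<^sup>2) summable_on UNIV"
    using norm_ltwo_has_sum has_sum_imp_summable by blast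
  fix F :: "'i set" assume F: "finite F"
  have c: "coord (\<Sum>i\<in>F. tensor (basis_elem i) (coord u i)) j = (if j \<in> F then coord u j else 0)" for j
    unfolding coord_sum using F by (simp add: if_distrib if_distribR cong: if_cong)
  have "((\<lambda>i. (norm (coord (\<Sum>i\<in>F. tensor (basis_elem i) (coord u i)) i))\<^sup>2) has_sum
      (\<Sum>i\<in>F. (norm (coord u i))\<^sup>2)) UNIV"
    using F by (intro has_sum_finite_neutralI[of F]) (auto simp: c)
  from has_sum_unique[OF norm_ltwo_has_sum this]
  have "(norm (\<Sum>i\<in>F. tensor (basis_elem i) (coord u i)))\<^sup>2 = (\<Sum>i\<in>F. (norm (coord u i))\<^sup>2)" .
  moreover have "(norm (\<Sum>i\<in>F. tensor (A (basis_elem i)) (coord u i)))\<^sup>2 \<le>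
      (onorm A * norm (\<Sum>i\<in>F. tensor (basis_elem i) (coord u i)))\<^sup>2"
    by (intro power_mono norm_sum_tensor_le[OF A F, of basis_elem] norm_ge_zero)
  ultimately show "(norm (\<Sum>i\<in>F. tensor (A (basis_elem i)) (coord u i)))\<^sup>2 \<le>
      (onorm A)\<^sup>2 * (\<Sum>i\<in>F. (norm (coord u i))\<^sup>2)"
    by (simp add: power_mult_distrib)
qed simp

text \<open>The choice in \<open>ampl\<close> says nothing until a witness is found. The witness
  sends each component \<open>e_i \<otimes> u_i\<close> to \<open>A e_i \<otimes> u_i\<close>; its
  boundedness is the estimate on finite sums carried to the limit.\<close>

lemma ampl_exists:
  assumes A: "bounded_clinear A"
  shows "\<exists>B :: ('i, 'b::complex_hilbert) ltwo \<Rightarrow> ('i, 'b) ltwo.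
    bounded_clinear B \<and> (\<forall>\<phi> x. B (tensor \<phi> x) = tensor (A \<phi>) x)"
proof -
  define B where "B u = (\<Sum>\<^sub>\<infinity>i. tensor (A (basis_elem i)) (coord u i))" for u :: "('i, 'b) ltwo"
  have B: "((\<lambda>i. tensor (A (basis_elem i)) (coord u i)) has_sum B u) UNIV" for u
    unfolding B_def by (rule has_sum_infsum[OF summable_tensor_basis[OF A]])
  have "bounded_clinear B"
  proof (rule bounded_clinearI)
    fix u v :: "('i, 'b) ltwo" and c
    show "B (u + v) = B u + B v"
      using has_sum_add[OF B[of u] B[of v]] by (intro has_sum_unique[OF B]) (simp add: tensor_add_right)
    show "B (c *\<^sub>C u) = c *\<^sub>C B u"
      using bounded_clinear_has_sum[OF bounded_clinear_cmult[OF bounded_clinear_id] B[of u], of c]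
      by (intro has_sum_unique[OF B]) (simp add: tensor_scaleC_right)
    show "norm (B u) \<le> onorm A * norm u"
    proof (rule tendsto_le)
      show "((\<lambda>F. norm (\<Sum>i\<in>F. tensor (A (basis_elem i)) (coord u i))) \<longlongrightarrow> norm (B u))
          (finite_subsets_at_top UNIV)"
        using B[of u] unfolding has_sum_def by (intro tendsto_norm)
      show "((\<lambda>F. onorm A * norm (\<Sum>i\<in>F. tensor (basis_elem i) (coord u i))) \<longlongrightarrow> onorm A * norm u)
          (finite_subsets_at_top UNIV)"
        using basis_expansion[of u] unfolding has_sum_def by (intro tendsto_intros)
    qed (auto intro!: eventually_finite_subsets_at_top_weakI norm_sum_tensor_le[OF A, of _ basis_elem])
  qed
  moreover have "B (tensor \<phi> x) = tensor (A \<phi>) x" for \<phi> x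
  proof (rule has_sum_unique[OF B])
    show "((\<lambda>i. tensor (A (basis_elem i)) (coord (tensor \<phi> x) i)) has_sum tensor (A \<phi>) x) UNIV"
      using bounded_clinear_has_sum[OF bounded_clinear_compose[OF bounded_clinear_tensor_left A]
          basis_expansion_complex[of \<phi>], of x]
      by (simp add: bounded_clinear_scaleC[OF A] tensor_scaleC_left tensor_scaleC_right)
  qed
  ultimately show ?thesis
    by blast
qed

lemma
  assumes "bounded_clinear A"
  shows bounded_clinear_ampl: "bounded_clinear (ampl A)"
    and ampl_tensor: "ampl A (tensor \<phi> x) = tensor (A \<phi>) x"
  using someI_ex[OF ampl_exists[OF assms]] unfolding ampl_def by blast+

lemma ampl_eqI:
  assumes "bounded_clinear A" "bounded_clinear B"
    and "\<And>i x. B (tensor (basis_elem i) x) = tensor (A (basis_elem i)) x"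
  shows "ampl A u = B u"
  by (rule bounded_clinear_eqI_tensor) (simp_all add: assms bounded_clinear_ampl ampl_tensor)

lemma ampl_has_sum:
  assumes A: "bounded_clinear A"
  shows "((\<lambda>i. tensor (A (basis_elem i)) (coord u i)) has_sum ampl A u) UNIV"
  using bounded_clinear_has_sum[OF bounded_clinear_ampl[OF A] basis_expansion[of u]]
  by (simp add: ampl_tensor[OF A])

lemma norm_ampl_le:
  assumes A: "bounded_clinear A"
  shows "norm (ampl A u) \<le> onorm A * norm u"
proof (rule tendsto_le)
  show "((\<lambda>F. norm (\<Sum>i\<in>F. tensor (A (basis_elem i)) (coord u i))) \<longlongrightarrow> norm (ampl A u))
      (finite_subsets_at_top UNIV)"
    using ampl_has_sum[OF A, of u] unfolding has_sum_def by (intro tendsto_norm)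
  show "((\<lambda>F. onorm A * norm (\<Sum>i\<in>F. tensor (basis_elem i) (coord u i))) \<longlongrightarrow> onorm A * norm u)
      (finite_subsets_at_top UNIV)"
    using basis_expansion[of u] unfolding has_sum_def by (intro tendsto_intros)
qed (auto intro!: eventually_finite_subsets_at_top_weakI norm_sum_tensor_le[OF A, of _ basis_elem])

lemma ampl_compose:
  assumes "bounded_clinear A" "bounded_clinear B"
  shows "ampl (\<lambda>\<phi>. A (B \<phi>)) u = ampl A (ampl B u)"
  by (rule ampl_eqI) (simp_all add: assms bounded_clinear_compose bounded_clinear_ampl ampl_tensor)

lemma ampl_word_op:
  assumes M: "M \<in> op_tuples"
  shows "ampl (word_op M \<alpha>) u = word_op (\<lambda>i. ampl (M i)) \<alpha> u"
proof (induction \<alpha>)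
  case Nil
  show ?case
    unfolding word_op.simps id_def by (rule ampl_eqI) (simp_all add: bounded_clinear_id)
next
  case (Cons i \<alpha>)
  thus ?case
    using ampl_compose[of "M i" "word_op M \<alpha>" u] M bounded_clinear_word_op[OF M, of \<alpha>]
    by (simp add: op_tuples_def comp_def)
qed

section \<open>Tensor subspaces and closed linear spans\<close>

lemma csubspace_tensor_space: "csubspace E \<Longrightarrow> csubspace (tensor_space E)"
  by (simp add: csubspace_def tensor_space_def)

lemma closed_tensor_space:
  fixes E :: "'b::complex_hilbert set"
  assumes "closed E"
  shows "closed (tensor_space E :: ('i, 'b) ltwo set)"
proof -
  have "closed ((\<lambda>u. coord u \<alpha>) -` E)" for \<alpha> :: 'i
    by (intro continuous_closed_vimage assms
        linear_continuous_at[OF bounded_clinear_linear[OF bounded_clinear_coord]])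
  moreover have "(tensor_space E :: ('i, 'b) ltwo set) = (\<Inter>\<alpha>. (\<lambda>u. coord u \<alpha>) -` E)"
    by (auto simp: tensor_space_def)
  ultimately show ?thesis
    by (simp add: closed_INT)
qed

lemma csubspace_sum: "csubspace S \<Longrightarrow> (\<And>i. i \<in> F \<Longrightarrow> x i \<in> S) \<Longrightarrow> (\<Sum>i\<in>F. x i) \<in> S"
  by (induction F rule: infinite_finite_induct) (auto simp: csubspace_def)

lemma csubspace_scaleC: "csubspace S \<Longrightarrow> x \<in> S \<Longrightarrow> c *\<^sub>C x \<in> S"
  by (simp add: csubspace_def)

lemma csubspace_scaleR: "csubspace S \<Longrightarrow> x \<in> S \<Longrightarrow> r *\<^sub>R x \<in> S"
  by (metis csubspace_scaleC scaleC_of_real)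

lemma csubspace_add: "csubspace S \<Longrightarrow> x \<in> S \<Longrightarrow> y \<in> S \<Longrightarrow> x + y \<in> S"
  by (simp add: csubspace_def)

lemma csubspace_diff: "csubspace S \<Longrightarrow> x \<in> S \<Longrightarrow> y \<in> S \<Longrightarrow> x - y \<in> S"
  using csubspace_add[of S x "(- 1) *\<^sub>C y"] csubspace_scaleC[of S y "- 1"]
  by (simp add: scaleC_minus_left)

lemma has_sum_in_closed_csubspace:
  assumes "closed S" "csubspace S" "(f has_sum x) UNIV" "\<And>i. f i \<in> S"
  shows "x \<in> S"
proof (rule Lim_in_closed_set[OF assms(1)])
  show "(sum f \<longlongrightarrow> x) (finite_subsets_at_top UNIV)"
    using assms(3) by (simp add: has_sum_def)
  show "\<forall>\<^sub>F F in finite_subsets_at_top UNIV. sum f F \<in> S"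
    by (intro always_eventually allI csubspace_sum assms)
qed simp

lemma tensor_in_tensor_space: "csubspace E \<Longrightarrow> x \<in> E \<Longrightarrow> tensor \<phi> x \<in> tensor_space E"
  by (simp add: tensor_space_def csubspace_def)

lemma ampl_tensor_space:
  assumes A: "bounded_clinear A" and E: "closed E" "csubspace E" and u: "u \<in> tensor_space E"
  shows "ampl A u \<in> tensor_space E"
  using E u
  by (intro has_sum_in_closed_csubspace[OF closed_tensor_space csubspace_tensor_space ampl_has_sum[OF A]]
      tensor_in_tensor_space) (auto simp: tensor_space_def)

lemma csubspace_hull: "csubspace (csubspace hull S)"
  unfolding hull_def csubspace_def by blast

lemma csubspace_closure:
  assumes S: "csubspace S"
  shows "csubspace (closure S)"
  unfolding csubspace_def
proof (intro conjI ballI allI)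
  show "0 \<in> closure S"
    using S closure_subset by (auto simp: csubspace_def)
  fix x y c assume "x \<in> closure S" "y \<in> closure S"
  then obtain a b where ab: "\<And>n. a n \<in> S" "a \<longlonglongrightarrow> x" "\<And>n. b n \<in> S" "b \<longlonglongrightarrow> y"
    unfolding closure_sequential by metis
  show "x + y \<in> closure S"
    unfolding closure_sequential
    by (intro exI[of _ "\<lambda>n. a n + b n"] conjI allI tendsto_add ab csubspace_add[OF S])
  show "c *\<^sub>C x \<in> closure S"
    unfolding closure_sequential
    by (intro exI[of _ "\<lambda>n. c *\<^sub>C a n"] conjI allI csubspace_scaleC[OF S] ab
        bounded_linear.tendsto[OF bounded_clinear_linear[OF bounded_clinear_cmult[OF bounded_clinear_id]]])
qed

lemma closed_closed_span: "closed (closed_span S)"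
  by (simp add: closed_span_def)

lemma csubspace_closed_span: "csubspace (closed_span S)"
  unfolding closed_span_def by (intro csubspace_closure csubspace_hull)

lemma closed_span_superset: "S \<subseteq> closed_span S"
  unfolding closed_span_def by (meson closure_subset hull_subset subset_trans)

lemma closed_span_minimal: "S \<subseteq> Y \<Longrightarrow> csubspace Y \<Longrightarrow> closed Y \<Longrightarrow> closed_span S \<subseteq> Y"
  unfolding closed_span_def by (intro closure_minimal hull_minimal)

text \<open>The vectors that \<open>A\<close> sends into the closed span form a closed subspace
  containing \<open>S\<close>, hence containing the whole span.\<close>

lemma closed_span_invariant:
  assumes A: "bounded_clinear A" and S: "\<And>x. x \<in> S \<Longrightarrow> A x \<in> closed_span S"
    and x: "x \<in> closed_span S"
  shows "A x \<in> closed_span S"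
proof -
  have "closed_span S \<subseteq> A -` closed_span S"
  proof (rule closed_span_minimal)
    show "csubspace (A -` closed_span S)"
      using csubspace_closed_span[of S]
      by (simp add: csubspace_def bounded_clinear_zero[OF A] bounded_clinear_add[OF A]
          bounded_clinear_scaleC[OF A])
    show "closed (A -` closed_span S)"
      using linear_continuous_at[OF bounded_clinear_linear[OF A]]
      by (intro continuous_closed_vimage closed_closed_span) auto
  qed (use S in auto)
  thus ?thesis
    using x by blast
qed

section \<open>Strong limits\<close>

text \<open>Baire category: the closed sets \<open>C k\<close>, on which all the operators are
  bounded by \<open>k\<close>, cover the space, so one of them contains a ball.\<close>

lemma uniform_boundedness:
  fixes A :: "nat \<Rightarrow> 'a::banach \<Rightarrow> 'b::real_normed_vector"
  assumes lin: "\<And>n. bounded_linear (A n)" and bd: "\<And>x. \<exists>k. \<forall>n. norm (A n x) \<le> k"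
  shows "\<exists>K\<ge>0. \<forall>n x. norm (A n x) \<le> K * norm x"
proof -
  define C where "C k = {x. \<forall>n. norm (A n x) \<le> real k}" for k
  have closed: "closed (C k)" for k
  proof -
    have "C k = (\<Inter>n. (\<lambda>x. norm (A n x)) -` {..real k})"
      by (auto simp: C_def)
    moreover have "closed ((\<lambda>x. norm (A n x)) -` {..real k})" for n
      using linear_continuous_at[OF lin[of n]] by (intro continuous_closed_vimage) (auto intro: continuous_intros)
    ultimately show ?thesis
      by auto
  qed
  have un: "(\<Union>k. C k) = UNIV"
  proof -
    have "\<exists>k. x \<in> C k" for x
    proof -
      obtain k where k: "\<And>n. norm (A n x) \<le> k"
        using bd by blast
      hence "x \<in> C (nat \<lceil>k\<rceil>)"
        unfolding C_def using order_trans real_nat_ceiling_ge by blast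
      thus ?thesis
        by blast
    qed
    thus ?thesis
      by blast
  qed
  have "\<exists>k. interior (C k) \<noteq> {}"
  proof (rule ccontr)
    assume "\<not> (\<exists>k. interior (C k) \<noteq> {})"
    hence "\<And>T. T \<in> range C \<Longrightarrow> closedin Met_TC.mtopology T \<and> Met_TC.mtopology interior_of T = {}"
      using closed by auto
    hence "Met_TC.mtopology interior_of \<Union>(range C) = {}"
      by (intro Met_TC.metric_Baire_category_alt) (auto simp: complete_UNIV)
    thus False
      by (simp add: un)
  qed
  then obtain k x0 r where r: "0 < r" "cball x0 r \<subseteq> C k"
    by (metis all_not_in_conv mem_interior_cball)
  have "norm (A n x) \<le> 2 * real k / r * norm x" for n x
  proof (cases "x = 0")
    case True
    thus ?thesis
      using bounded_linear.linear[OF lin[of n]] by (simp add: linear_0)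
  next
    case False
    \<comment> \<open>Rescaling to norm \<open>r\<close> keeps \<open>x0 + y\<close> in the ball.
      The constant \<open>2 * k / r\<close> arises because \<open>A n y\<close> is a difference of
      two values bounded by \<open>k\<close>.\<close>
    define y where "y = (r / norm x) *\<^sub>R x"
    have "x0 + y \<in> C k" "x0 \<in> C k"
      using r False by (auto simp: y_def dist_norm intro!: subsetD[OF r(2)])
    hence "norm (A n (x0 + y)) \<le> real k" "norm (A n x0) \<le> real k"
      by (auto simp: C_def)
    moreover have "A n y = A n (x0 + y) - A n x0"
      using bounded_linear.linear[OF lin[of n]] by (simp add: linear_add)
    ultimately have "norm (A n y) \<le> 2 * real k"
      using norm_triangle_ineq4[of "A n (x0 + y)" "A n x0"] by simp
    moreover have "norm (A n y) = r / norm x * norm (A n x)"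
      using bounded_linear.linear[OF lin[of n]] r False by (simp add: y_def linear_scale)
    ultimately show ?thesis
      using r False by (simp add: field_simps)
  qed
  thus ?thesis
    using r by (intro exI[of _ "2 * real k / r"]) simp
qed

text \<open>Convergence is immediate on finite sums of elementary tensors. The uniform bound on the
  \<open>A n\<close> is inherited by their amplifications and extends the convergence to all vectors
  by approximation.\<close>

lemma tendsto_ampl:
  assumes An: "\<And>n. bounded_clinear (A n)" and A: "bounded_clinear L"
    and lim: "\<And>\<phi>. (\<lambda>n. A n \<phi>) \<longlonglongrightarrow> L \<phi>"
  shows "(\<lambda>n. ampl (A n) u) \<longlonglongrightarrow> ampl L u"
proof -
  have "\<exists>k. \<forall>n. norm (A n \<phi>) \<le> k" for \<phi>
    using convergent_imp_Bseq[OF convergentI[OF lim[of \<phi>]]] by (meson BseqE)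
  then obtain K where K: "0 \<le> K" "\<And>n \<phi>. norm (A n \<phi>) \<le> K * norm \<phi>"
    using uniform_boundedness[of A] bounded_clinear_linear[OF An] by blast
  have aK: "norm (ampl (A n) v) \<le> K * norm v" for n and v :: "('a, 'b) ltwo"
    using norm_ampl_le[OF An] onorm_bound[OF K] mult_right_mono[of "onorm (A n)" K "norm v"]
    by (meson norm_ge_zero order_trans)
  show ?thesis
  proof (rule LIMSEQ_I)
    fix e :: real assume e: "0 < e"
    define d where "d = e / (2 * (K + onorm L + 1))"
    have oL: "0 \<le> onorm L"
      by (rule onorm_pos_le[OF bounded_clinear_linear[OF A]])
    have d: "0 < d" "(K + onorm L) * d < e / 2"
      using e K oL by (auto simp: d_def field_simps add_pos_nonneg)
    obtain F where F: "finite F" "dist (\<Sum>i\<in>F. tensor (basis_elem i) (coord u i)) u \<le> d"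
      using has_sum_finite_approximation[OF basis_expansion[of u] d(1)] by auto
    define s where "s = (\<Sum>i\<in>F. tensor (basis_elem i) (coord u i))"
    have "(\<lambda>n. \<Sum>i\<in>F. tensor (A n (basis_elem i)) (coord u i)) \<longlonglongrightarrow>
        (\<Sum>i\<in>F. tensor (L (basis_elem i)) (coord u i))"
      by (intro tendsto_sum bounded_linear.tendsto[OF bounded_clinear_linear[OF bounded_clinear_tensor_left]] lim)
    hence "(\<lambda>n. ampl (A n) s) \<longlonglongrightarrow> ampl L s"
      by (simp add: s_def bounded_clinear_sum[OF bounded_clinear_ampl[OF An]]
          bounded_clinear_sum[OF bounded_clinear_ampl[OF A]] ampl_tensor[OF An] ampl_tensor[OF A])
    then obtain N where N: "\<And>n. N \<le> n \<Longrightarrow> norm (ampl (A n) s - ampl L s) < e / 2"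
      using e by (metis LIMSEQ_D half_gt_zero)
    have "norm (ampl (A n) u - ampl L u) < e" if "N \<le> n" for n
    proof -
      have eq: "ampl (A n) u - ampl L u =
          ampl (A n) (u - s) - ampl L (u - s) + (ampl (A n) s - ampl L s)"
        by (simp add: bounded_clinear_diff[OF bounded_clinear_ampl[OF An]]
            bounded_clinear_diff[OF bounded_clinear_ampl[OF A]])
      have "norm (ampl (A n) u - ampl L u) \<le>
          norm (ampl (A n) (u - s)) + norm (ampl L (u - s)) + norm (ampl (A n) s - ampl L s)"
        using norm_triangle_ineq[of "ampl (A n) (u - s) - ampl L (u - s)" "ampl (A n) s - ampl L s"]
          norm_triangle_ineq4[of "ampl (A n) (u - s)" "ampl L (u - s)"]
        unfolding eq by linarith
      also have "\<dots> < K * norm (u - s) + onorm L * norm (u - s) + e / 2"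
        using aK norm_ampl_le[OF A] N[OF that] by (intro add_le_less_mono add_mono)
      also have "\<dots> = (K + onorm L) * norm (u - s) + e / 2"
        by (simp add: algebra_simps)
      also have "\<dots> \<le> (K + onorm L) * d + e / 2"
        using F(2) K oL by (intro add_right_mono mult_left_mono) (auto simp: s_def dist_norm norm_minus_commute)
      finally show ?thesis
        using d by linarith
    qed
    thus "\<exists>N. \<forall>n\<ge>N. norm (ampl (A n) u - ampl L u) < e"
      by blast
  qed
qed

section \<open>Abel summation\<close>

text \<open>The common consequence, at a single vector, of strong and of radial convergence. Asking
  for convergence only near \<open>r = 1\<close> absorbs the bound \<open>\<delta>\<close> in radial
  convergence.\<close>

definition abel_sums :: "(nat \<Rightarrow> 'a::real_normed_vector) \<Rightarrow> 'a \<Rightarrow> bool" where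
  "abel_sums a l \<longleftrightarrow>
    (\<exists>S. (\<forall>\<^sub>F r in at_left 1. (\<lambda>k. r ^ k *\<^sub>R a k) sums S r) \<and> (S \<longlongrightarrow> l) (at_left (1 :: real)))"

lemma abel_sums_unique:
  assumes "abel_sums a l" "abel_sums a l'"
  shows "l = l'"
proof -
  obtain S S' where S: "\<forall>\<^sub>F r in at_left 1. (\<lambda>k. r ^ k *\<^sub>R a k) sums S r" "(S \<longlongrightarrow> l) (at_left (1 :: real))"
    "\<forall>\<^sub>F r in at_left 1. (\<lambda>k. r ^ k *\<^sub>R a k) sums S' r" "(S' \<longlongrightarrow> l') (at_left 1)"
    using assms unfolding abel_sums_def by blast
  have "\<forall>\<^sub>F r in at_left 1. S r = S' r"
    using S(1,3) by eventually_elim (rule sums_unique2)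
  from Lim_transform_eventually[OF S(2) this] S(4) show ?thesis
    using tendsto_unique trivial_limit_at_left_real by blast
qed

lemma abel_sums_bounded_linear:
  assumes A: "bounded_linear A" and a: "abel_sums a l"
  shows "abel_sums (\<lambda>k. A (a k)) (A l)"
proof -
  interpret bounded_linear A by fact
  obtain S where S: "\<forall>\<^sub>F r in at_left 1. (\<lambda>k. r ^ k *\<^sub>R a k) sums S r" "(S \<longlongrightarrow> l) (at_left (1 :: real))"
    using a unfolding abel_sums_def by blast
  have "\<forall>\<^sub>F r in at_left 1. (\<lambda>k. r ^ k *\<^sub>R A (a k)) sums A (S r)"
    using S(1)
  proof eventually_elim
    case (elim r)
    from sums[OF this] show ?case
      by (simp add: scaleR)
  qed
  moreover have "((\<lambda>r. A (S r)) \<longlongrightarrow> A l) (at_left 1)"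
    by (rule tendsto[OF S(2)])
  ultimately show ?thesis
    unfolding abel_sums_def by (intro exI[of _ "\<lambda>r. A (S r)"]) simp
qed

text \<open>With the partial sums \<open>s\<close>, \<open>\<Sum> r\<^sup>k a\<^sub>k\<close> is the weighted mean \<open>\<Sum> (1 - r) r\<^sup>k s\<^sub>k\<^sub>+\<^sub>1\<close>.\<close>

lemma sums_imp_abel_sums:
  fixes a :: "nat \<Rightarrow> 'a::banach"
  assumes a: "a sums l"
  shows "abel_sums a l"
proof -
  define s where "s n = (\<Sum>k<n. a k)" for n
  have s: "s \<longlonglongrightarrow> l"
    using a by (simp add: s_def[abs_def] sums_def)
  obtain D where D: "0 < D" "\<And>n. norm (s n) \<le> D"
    using convergent_imp_Bseq[OF convergentI[OF s]] by (meson BseqE)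
  have l_le: "norm l \<le> D"
    using D s by (intro Lim_norm_ubound[OF sequentially_bot s]) auto
  define S where "S r = (\<Sum>k. (1 - r) *\<^sub>R r ^ k *\<^sub>R s (Suc k))" for r
  have summ: "summable (\<lambda>k. r ^ k *\<^sub>R s (Suc k))" if r: "0 < r" "r < 1" for r
  proof (rule summable_comparison_test)
    show "\<exists>N. \<forall>n\<ge>N. norm (r ^ n *\<^sub>R s (Suc n)) \<le> r ^ n * D"
      using r D(2) by (auto intro!: mult_left_mono)
    show "summable (\<lambda>n. r ^ n * D)"
      using r by (intro summable_mult2 summable_geometric) simp
  qed
  have Ss: "(\<lambda>k. (1 - r) *\<^sub>R r ^ k *\<^sub>R s (Suc k)) sums S r" if "0 < r" "r < 1" for r
    unfolding S_def by (intro summable_sums summable_scaleR_right summ that)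
  have sums: "(\<lambda>k. r ^ k *\<^sub>R a k) sums S r" if r: "0 < r" "r < 1" for r
  proof -
    define t where "t = (\<Sum>k. r ^ k *\<^sub>R s (Suc k))"
    have t: "(\<lambda>k. r ^ k *\<^sub>R s (Suc k)) sums t"
      unfolding t_def by (intro summable_sums summ r)
    have "(\<lambda>k. r ^ Suc k *\<^sub>R s (Suc k)) sums (r *\<^sub>R t)"
      using sums_scaleR_right[OF t, of r] by simp
    \<comment> \<open>The term gained by shifting the index is zero because
      \<open>s 0 = 0\<close>.\<close>
    hence "(\<lambda>k. r ^ k *\<^sub>R s k) sums (r *\<^sub>R t)"
      by (subst (asm) sums_Suc_iff) (simp add: s_def)
    from sums_diff[OF t this] have "(\<lambda>k. r ^ k *\<^sub>R a k) sums (t - r *\<^sub>R t)"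
      by (simp add: s_def flip: scaleR_diff_right)
    moreover have "S r = t - r *\<^sub>R t"
      using sums_unique2[OF Ss[OF r] sums_scaleR_right[OF t, of "1 - r"]]
      by (simp add: scaleR_diff_left)
    ultimately show ?thesis
      by simp
  qed
  have lim: "(S \<longlongrightarrow> l) (at_left 1)"
  proof (rule tendstoI)
    fix e :: real assume e: "0 < e"
    obtain N where N: "\<And>n. N \<le> n \<Longrightarrow> norm (s n - l) < e / 2"
      using LIMSEQ_D[OF s, of "e / 2"] e by auto
    \<comment> \<open>The weights \<open>(1 - r) * r ^ k\<close> have total mass 1. From index
      \<open>N\<close> on the distance to \<open>l\<close> is below \<open>e / 2\<close>; each of
      the first \<open>N\<close> terms has weight at most \<open>1 - r\<close> and distance at most
      \<open>2 * D\<close>.\<close>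
    have bound: "norm (S r - l) \<le> e / 2 + real N * ((1 - r) * (2 * D))" if r: "0 < r" "r < 1" for r
    proof -
      have geo: "(\<lambda>k. (1 - r) * r ^ k) sums 1"
        using sums_mult[OF geometric_sums[of r], of "1 - r"] r by simp
      have "(\<lambda>k. ((1 - r) * r ^ k) *\<^sub>R l) sums l"
        using sums_scaleR_left[OF geo, of l] by simp
      from sums_diff[OF Ss[OF r] this]
      have d: "(\<lambda>k. ((1 - r) * r ^ k) *\<^sub>R (s (Suc k) - l)) sums (S r - l)"
        by (simp add: scaleR_diff_right)
      have fin: "(\<lambda>k. if k \<in> {..<N} then (1 - r) * (2 * D) else 0) sums
          (\<Sum>k\<in>{..<N}. (1 - r) * (2 * D))"
        by (rule sums_If_finite_set) simp
      have b: "(\<lambda>k. (1 - r) * r ^ k * (e / 2) + (if k \<in> {..<N} then (1 - r) * (2 * D) else 0)) sums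
          (e / 2 + real N * ((1 - r) * (2 * D)))"
        using sums_add[OF sums_mult2[OF geo, of "e / 2"] fin] by simp
      have le: "norm (((1 - r) * r ^ k) *\<^sub>R (s (Suc k) - l)) \<le>
          (1 - r) * r ^ k * (e / 2) + (if k \<in> {..<N} then (1 - r) * (2 * D) else 0)" for k
      proof (cases "k < N")
        case True
        have "norm (s (Suc k) - l) \<le> 2 * D"
          using norm_triangle_ineq4[of "s (Suc k)" l] D(2)[of "Suc k"] l_le by linarith
        moreover have "(1 - r) * r ^ k \<le> 1 - r"
          using r by (simp add: mult_left_le power_le_one)
        ultimately have "(1 - r) * r ^ k * norm (s (Suc k) - l) \<le> (1 - r) * (2 * D)"
          using r by (intro mult_mono) auto
        thus ?thesis
          using r True e by (simp add: add_increasing)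
      next
        case False
        thus ?thesis
          using r N[of "Suc k"] by (simp add: mult_left_mono)
      qed
      show ?thesis
        using norm_suminf_le[OF le sums_summable[OF b]]
        unfolding sums_unique[OF d, symmetric] sums_unique[OF b, symmetric] .
    qed
    have "((\<lambda>r. e / 2 + real N * ((1 - r) * (2 * D))) \<longlongrightarrow> e / 2 + real N * ((1 - 1) * (2 * D))) (at_left 1)"
      by (intro tendsto_intros)
    hence "\<forall>\<^sub>F r in at_left 1. e / 2 + real N * ((1 - r) * (2 * D)) < e"
      by (rule order_tendstoD) (use e in simp)
    moreover have "\<forall>\<^sub>F r in at_left (1::real). r \<in> {0<..<1}"
      by (intro eventually_at_left_field[THEN iffD2] exI[of _ 0]) auto
    ultimately show "\<forall>\<^sub>F r in at_left 1. dist (S r) l < e"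
    proof eventually_elim
      case (elim r)
      thus ?case
        using bound[of r] by (simp add: dist_norm)
    qed
  qed
  have "\<forall>\<^sub>F r in at_left (1::real). r \<in> {0<..<1}"
    by (intro eventually_at_left_field[THEN iffD2] exI[of _ 0]) auto
  hence "\<forall>\<^sub>F r in at_left 1. (\<lambda>k. r ^ k *\<^sub>R a k) sums S r"
    by eventually_elim (simp add: sums)
  thus ?thesis
    using lim unfolding abel_sums_def by blast
qed

section \<open>Evaluation of series at operator tuples\<close>

lemma finite_words [simp]: "finite {\<alpha> :: 'n::finite list. length \<alpha> = k}"
  using finite_lists_length_eq[of "UNIV :: 'n set" k] by simp

lemma finite_words_le [simp]: "finite {\<alpha> :: 'n::finite list. length \<alpha> \<le> k}"
  using finite_lists_length_le[of "UNIV :: 'n set" k] by simp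

lemma bounded_clinear_hom_part: "X \<in> op_tuples \<Longrightarrow> bounded_clinear (hom_part c X k)"
  unfolding hom_part_def[abs_def]
  by (intro bounded_clinear_sums bounded_clinear_cmult bounded_clinear_word_op)

lemma word_op_scaleR:
  assumes "X \<in> op_tuples"
  shows "word_op (\<lambda>i h. r *\<^sub>R X i h) \<alpha> h = r ^ length \<alpha> *\<^sub>R word_op X \<alpha> h"
  using assms by (induction \<alpha>) (simp_all add: op_tuples_def bounded_clinear_scaleR)

lemma hom_part_scaleR:
  assumes "X \<in> op_tuples"
  shows "hom_part c (\<lambda>i h. r *\<^sub>R X i h) k h = r ^ k *\<^sub>R hom_part c X k h"
  by (simp add: hom_part_def word_op_scaleR[OF assms] scaleR_sum_right scaleR_scaleC)

lemma bounded_clinear_rmult: "bounded_clinear A \<Longrightarrow> bounded_clinear (\<lambda>x. r *\<^sub>R A x)"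
  unfolding scaleC_of_real[symmetric] by (rule bounded_clinear_cmult)

lemma op_tuples_scaleR: "X \<in> op_tuples \<Longrightarrow> (\<lambda>i h. r *\<^sub>R X i h) \<in> op_tuples"
  by (simp add: op_tuples_def bounded_clinear_rmult)

lemma norm_sums_imp_sums:
  assumes "norm_sums A L" and A: "\<And>k. bounded_clinear (A k)"
  shows "(\<lambda>k. A k h) sums L h"
proof -
  have L: "bounded_clinear L" and lim: "(\<lambda>N. onorm (\<lambda>h. (\<Sum>k<N. A k h) - L h)) \<longlonglongrightarrow> 0"
    using assms(1) by (simp_all add: norm_sums_def)
  have "(\<lambda>N. (\<Sum>k<N. A k h) - L h) \<longlonglongrightarrow> 0"
  proof (rule Lim_null_comparison)
    show "(\<lambda>N. onorm (\<lambda>h. (\<Sum>k<N. A k h) - L h) * norm h) \<longlonglongrightarrow> 0"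
      using tendsto_mult_left_zero[OF lim] by simp
    show "\<forall>\<^sub>F N in sequentially. norm ((\<Sum>k<N. A k h) - L h) \<le>
        onorm (\<lambda>h. (\<Sum>k<N. A k h) - L h) * norm h"
      by (intro always_eventually allI bounded_clinear_onorm bounded_clinear_minus
          bounded_clinear_sums A L)
  qed
  thus ?thesis
    unfolding sums_def by (subst Lim_null)
qed

text \<open>Scaling the tuple by \<open>r\<close> multiplies the homogeneous part of degree
  \<open>k\<close> by \<open>r ^ k\<close>, so a radial limit at a vector is an Abel limit;
  \<open>\<delta> < 1\<close> makes the interval a left neighbourhood of 1.\<close>

lemma radial_sums_imp_abel_sums:
  assumes "radial_sums \<delta> c X L" "\<delta> < 1" "X \<in> op_tuples"
  shows "abel_sums (\<lambda>k. hom_part c X k h) (L h)"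
proof -
  obtain S where S: "\<And>r. r \<in> {\<delta><..<1} \<Longrightarrow> norm_sums (hom_part c (\<lambda>i h. r *\<^sub>R X i h)) (S r)"
    "((\<lambda>r. S r h) \<longlongrightarrow> L h) (at_left 1)"
    using assms(1) unfolding radial_sums_def by blast
  have "\<forall>\<^sub>F r in at_left (1::real). r \<in> {\<delta><..<1}"
    using assms(2) by (intro eventually_at_left_field[THEN iffD2] exI[of _ \<delta>]) auto
  hence "\<forall>\<^sub>F r in at_left 1. (\<lambda>k. r ^ k *\<^sub>R hom_part c X k h) sums S r h"
  proof eventually_elim
    case (elim r)
    from norm_sums_imp_sums[OF S(1)[OF this] bounded_clinear_hom_part[OF op_tuples_scaleR[OF assms(3)]]]
    show ?case
      by (simp add: hom_part_scaleR[OF assms(3)])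
  qed
  thus ?thesis
    using S(2) unfolding abel_sums_def by (intro exI[of _ "\<lambda>r. S r h"]) simp
qed

lemma sot_sums_imp_abel_sums: "sot_sums A L \<Longrightarrow> abel_sums (\<lambda>k. A k h) (L h)"
  unfolding sot_sums_def by (blast intro: sums_imp_abel_sums)

text \<open>Resolves the two choices in \<open>nc_eval\<close>. In the radial case
  \<open>\<delta>\<close> may depend on \<open>j\<close>, being bound inside the choice made for
  each \<open>j\<close>.\<close>

lemma nc_eval_cases:
  assumes "X \<in> conv_sot f \<union> conv_rad f"
  obtains (sot) "sot_sums (hom_part (f j) X) (nc_eval f X j)"
  | (rad) \<delta> where "\<delta> \<in> {0<..<1}" "radial_sums \<delta> (f j) X (nc_eval f X j)"
proof (cases "X \<in> conv_sot f")
  case True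
  hence "\<exists>L. sot_sums (hom_part (f j) X) L"
    by (simp add: conv_sot_def)
  from someI_ex[OF this] show thesis
    using True sot by (simp add: nc_eval_def)
next
  case False
  hence "\<exists>\<delta>\<in>{0<..<1}. \<forall>j. \<exists>L. radial_sums \<delta> (f j) X L"
    using assms by (simp add: conv_rad_def)
  hence "\<exists>L. \<exists>\<delta>\<in>{0<..<1}. radial_sums \<delta> (f j) X L"
    by blast
  from someI_ex[OF this] show thesis
    using False rad by (auto simp: nc_eval_def)
qed

lemma conv_op_tuples: "X \<in> conv_sot f \<union> conv_rad f \<Longrightarrow> X \<in> op_tuples"
  by (auto simp: conv_sot_def conv_rad_def)

lemma nc_eval_op_tuples:
  assumes "X \<in> conv_sot f \<union> conv_rad f"
  shows "nc_eval f X \<in> op_tuples"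
proof -
  have "bounded_clinear (nc_eval f X j)" for j
    by (rule nc_eval_cases[OF assms, of j]) (auto simp: sot_sums_def radial_sums_def)
  thus ?thesis
    by (simp add: op_tuples_def)
qed

lemma abel_sums_nc_eval:
  assumes "X \<in> conv_sot f \<union> conv_rad f"
  shows "abel_sums (\<lambda>k. hom_part (f j) X k h) (nc_eval f X j h)"
  by (rule nc_eval_cases[OF assms, of j])
    (auto intro: sot_sums_imp_abel_sums radial_sums_imp_abel_sums conv_op_tuples[OF assms])

section \<open>Amplified series and invariant subspaces\<close>

lemma tensor_scaleR_left: "tensor (r *\<^sub>R \<phi>) x = r *\<^sub>R tensor \<phi> x"
  using tensor_scaleC_left[of "complex_of_real r" \<phi> x] by (simp add: scaleC_of_real)

lemma ampl_hom_part:
  assumes "X \<in> op_tuples"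
  shows "ampl (hom_part c X k) u = hom_part c (\<lambda>i. ampl (X i)) k u"
proof (rule ampl_eqI)
  have X': "(\<lambda>i. ampl (X i)) \<in> op_tuples"
    using assms by (simp add: op_tuples_def bounded_clinear_ampl)
  show "bounded_clinear (hom_part c X k)" "bounded_clinear (hom_part c (\<lambda>i. ampl (X i)) k)"
    by (intro bounded_clinear_hom_part assms X')+
  show "hom_part c (\<lambda>i. ampl (X i)) k (tensor (basis_elem i) x) = tensor (hom_part c X k (basis_elem i)) x"
    for i x
    by (simp add: hom_part_def tensor_sum_left tensor_scaleC_left bounded_clinear_word_op[OF assms]
        flip: ampl_word_op[OF assms] ampl_tensor)
qed

lemma ampl_nc_eval_invariant:
  assumes X: "X \<in> conv_sot f \<union> conv_rad f" and Y: "closed Y" "csubspace Y"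
    and inv: "\<And>i u. u \<in> Y \<Longrightarrow> ampl (X i) u \<in> Y" and u: "u \<in> Y"
  shows "ampl (nc_eval f X j) u \<in> Y"
proof -
  have Xt: "X \<in> op_tuples"
    by (rule conv_op_tuples[OF X])
  have w: "word_op (\<lambda>i. ampl (X i)) \<alpha> u \<in> Y" for \<alpha>
    using u inv by (induction \<alpha>) auto
  have h: "ampl (hom_part c X k) u \<in> Y" for c k
    unfolding ampl_hom_part[OF Xt] unfolding hom_part_def
    by (intro csubspace_sum csubspace_scaleC Y w)
  \<comment> \<open>Used twice: for the strong sums of \<open>f j\<close> at \<open>X\<close>, and
    in the radial case for the norm-convergent sums at the scaled tuple.\<close>
  have lim: "ampl L u \<in> Y"
    if "\<And>k. bounded_clinear (A k)" "bounded_clinear L" "\<And>\<phi>. (\<lambda>k. A k \<phi>) sums L \<phi>"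
      "\<And>k. ampl (A k) u \<in> Y" for A :: "nat \<Rightarrow> _" and L
  proof (rule Lim_in_closed_set[OF Y(1)])
    show "(\<lambda>N. ampl (\<lambda>\<phi>. \<Sum>k<N. A k \<phi>) u) \<longlonglongrightarrow> ampl L u"
      by (rule tendsto_ampl[OF bounded_clinear_sums[OF that(1)] that(2)])
        (rule that(3)[unfolded sums_def])
    have "ampl (\<lambda>\<phi>. \<Sum>k<N. A k \<phi>) u = (\<Sum>k<N. ampl (A k) u)" for N
      by (rule ampl_eqI[OF bounded_clinear_sums[OF that(1)] bounded_clinear_sums[OF bounded_clinear_ampl[OF that(1)]]])
        (simp add: ampl_tensor[OF that(1)] tensor_sum_left)
    thus "\<forall>\<^sub>F N in sequentially. ampl (\<lambda>\<phi>. \<Sum>k<N. A k \<phi>) u \<in> Y"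
      using that Y by (simp add: csubspace_sum)
  qed simp
  show ?thesis
  proof (rule nc_eval_cases[OF X, of j])
    assume "sot_sums (hom_part (f j) X) (nc_eval f X j)"
    thus ?thesis
      by (intro lim[OF bounded_clinear_hom_part[OF Xt] _ _ h]) (auto simp: sot_sums_def)
  next
    fix \<delta> :: real assume \<delta>: "\<delta> \<in> {0<..<1}" and "radial_sums \<delta> (f j) X (nc_eval f X j)"
    then obtain S where L: "bounded_clinear (nc_eval f X j)"
      and S: "\<And>r. r \<in> {\<delta><..<1} \<Longrightarrow> norm_sums (hom_part (f j) (\<lambda>i h. r *\<^sub>R X i h)) (S r)"
      and Sl: "\<And>h. ((\<lambda>r. S r h) \<longlongrightarrow> nc_eval f X j h) (at_left 1)"
      unfolding radial_sums_def by blast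
    have Slin: "bounded_clinear (S r)" if "r \<in> {\<delta><..<1}" for r
      using S[OF that] by (simp add: norm_sums_def)
    have SY: "ampl (S r) u \<in> Y" if r: "r \<in> {\<delta><..<1}" for r
    proof (rule lim[OF bounded_clinear_hom_part Slin[OF r] norm_sums_imp_sums[OF S[OF r] bounded_clinear_hom_part]])
      show "(\<lambda>i h. r *\<^sub>R X i h) \<in> op_tuples"
        by (rule op_tuples_scaleR[OF Xt])
      then show "(\<lambda>i h. r *\<^sub>R X i h) \<in> op_tuples" .
      have "ampl (hom_part (f j) (\<lambda>i h. r *\<^sub>R X i h) k) u = r ^ k *\<^sub>R ampl (hom_part (f j) X k) u" for k
      proof (rule ampl_eqI)
        show "bounded_clinear (hom_part (f j) (\<lambda>i h. r *\<^sub>R X i h) k)"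
          by (intro bounded_clinear_hom_part op_tuples_scaleR Xt)
        show "bounded_clinear (\<lambda>u. r ^ k *\<^sub>R ampl (hom_part (f j) X k) u)"
          by (intro bounded_clinear_rmult bounded_clinear_ampl bounded_clinear_hom_part Xt)
        show "r ^ k *\<^sub>R ampl (hom_part (f j) X k) (tensor (basis_elem i) x) =
            tensor (hom_part (f j) (\<lambda>i h. r *\<^sub>R X i h) k (basis_elem i)) x" for i x
          by (simp add: ampl_tensor bounded_clinear_hom_part Xt hom_part_scaleR tensor_scaleR_left)
      qed
      thus "ampl (hom_part (f j) (\<lambda>i h. r *\<^sub>R X i h) k) u \<in> Y" for k
        by (simp add: csubspace_scaleR Y h)
    qed
    \<comment> \<open>Uniform boundedness concerns sequences, so 1 is approached along one. The 2 in
      the denominator keeps \<open>r 0\<close> strictly above \<open>\<delta>\<close>.\<close>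
    define r where "r n = 1 - (1 - \<delta>) / real (n + 2)" for n
    have r: "r n \<in> {\<delta><..<1}" for n
    proof -
      have "(1 - \<delta>) * 1 < (1 - \<delta>) * real (n + 2)"
        using \<delta> by (intro mult_strict_left_mono) auto
      hence "(1 - \<delta>) / real (n + 2) < 1 - \<delta>"
        by (simp add: divide_less_eq)
      thus ?thesis
        using \<delta> by (simp add: r_def)
    qed
    have "(\<lambda>n. 1 - (1 - \<delta>) / real (n + 2)) \<longlonglongrightarrow> 1 - 0"
      by (intro tendsto_diff tendsto_const tendsto_divide_0[OF tendsto_const]
          filterlim_at_top_imp_at_infinity filterlim_compose[OF filterlim_real_sequentially filterlim_add_const_nat_at_top])
    hence "filterlim r (at_left 1) sequentially"
      using r by (auto simp: filterlim_at r_def[abs_def] intro!: always_eventually)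
    hence "(\<lambda>n. S (r n) \<phi>) \<longlonglongrightarrow> nc_eval f X j \<phi>" for \<phi>
      by (rule filterlim_compose[OF Sl])
    hence "(\<lambda>n. ampl (S (r n)) u) \<longlonglongrightarrow> ampl (nc_eval f X j) u"
      by (intro tendsto_ampl Slin r L)
    thus ?thesis
    proof (rule Lim_in_closed_set[OF Y(1), rotated 2])
      show "\<forall>\<^sub>F n in sequentially. ampl (S (r n)) u \<in> Y"
        by (intro always_eventually allI SY r)
    qed simp
  qed
qed

section \<open>Sums over words\<close>

lemma sum_words_Cons:
  fixes F :: "'n::finite list \<Rightarrow> 'b::comm_monoid_add"
  shows "(\<Sum>\<alpha> | length \<alpha> = Suc k. F \<alpha>) = (\<Sum>j\<in>UNIV. \<Sum>\<alpha> | length \<alpha> = k. F (j # \<alpha>))"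
proof -
  have "(\<Sum>\<alpha> | length \<alpha> = Suc k. F \<alpha>) = (\<Sum>(j, \<alpha>)\<in>UNIV \<times> {\<alpha>. length \<alpha> = k}. F (j # \<alpha>))"
  by (rule sum.reindex_bij_witness[where j = "\<lambda>\<alpha>. (hd \<alpha>, tl \<alpha>)" and i = "\<lambda>(j, \<alpha>). j # \<alpha>"])
    (force simp: length_Suc_conv)+
  thus ?thesis by (simp add: sum.cartesian_product)
qed

lemma sum_words_snoc:
  fixes F :: "'n::finite list \<Rightarrow> 'b::comm_monoid_add"
  shows "(\<Sum>\<alpha> | length \<alpha> = Suc k. F \<alpha>) = (\<Sum>\<alpha> | length \<alpha> = k. \<Sum>j\<in>UNIV. F (\<alpha> @ [j]))"
proof -
  have "(\<Sum>\<alpha> | length \<alpha> = Suc k. F \<alpha>) = (\<Sum>(\<alpha>, j)\<in>{\<alpha>. length \<alpha> = k} \<times> UNIV. F (\<alpha> @ [j]))"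
  by (rule sum.reindex_bij_witness[where j = "\<lambda>\<alpha>. (butlast \<alpha>, last \<alpha>)" and i = "\<lambda>(\<alpha>, j). \<alpha> @ [j]"])
    (force simp: length_Suc_conv_rev)+
  thus ?thesis by (simp add: sum.cartesian_product)
qed

lemma finite_words_less [simp]: "finite {\<alpha> :: 'n::finite list. length \<alpha> < k}"
  by (rule finite_subset[OF _ finite_words_le[of k]]) auto

lemma sum_words_less:
  fixes F :: "'n::finite list \<Rightarrow> 'b::comm_monoid_add"
  shows "(\<Sum>\<alpha> | length \<alpha> < N. F \<alpha>) = (\<Sum>k<N. \<Sum>\<alpha> | length \<alpha> = k. F \<alpha>)"
proof (induction N)
  case (Suc N)
  have "{\<alpha> :: 'n list. length \<alpha> < Suc N} = {\<alpha>. length \<alpha> < N} \<union> {\<alpha>. length \<alpha> = N}"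
    by auto
  thus ?case
    by (simp add: sum.union_disjoint disjoint_iff Suc)
qed simp

text \<open>Links the unordered sums natural in the tensor product to the summation by degree in
  \<open>hom_part\<close>: every finite set of words lies among the words shorter than some
  \<open>N\<close>.\<close>

lemma has_sum_words_imp_sums:
  fixes F :: "'n::finite list \<Rightarrow> 'b::real_normed_vector"
  assumes "(F has_sum s) UNIV"
  shows "(\<lambda>k. \<Sum>\<alpha> | length \<alpha> = k. F \<alpha>) sums s"
proof -
  have "filterlim (\<lambda>N. {\<alpha> :: 'n list. length \<alpha> < N}) (finite_subsets_at_top UNIV) sequentially"
    unfolding filterlim_finite_subsets_at_top
  proof (intro allI impI)
    fix X :: "'n list set" assume "finite X \<and> X \<subseteq> UNIV"
    hence X: "finite X"
      by simp
    have "\<And>\<alpha>. \<alpha> \<in> X \<Longrightarrow> length \<alpha> \<le> Max (length ` X)"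
      using X by simp
    hence "\<forall>\<^sub>F N in sequentially. X \<subseteq> {\<alpha>. length \<alpha> < N}"
      by (intro eventually_sequentiallyI[of "Suc (Max (length ` X))"]) (auto simp: Suc_le_eq intro: le_less_trans)
    thus "\<forall>\<^sub>F N in sequentially. finite {\<alpha> :: 'n list. length \<alpha> < N} \<and> X \<subseteq> {\<alpha>. length \<alpha> < N} \<and>
        {\<alpha> :: 'n list. length \<alpha> < N} \<subseteq> UNIV"
      by eventually_elim simp
  qed
  from filterlim_compose[OF _ this, of "sum F" "nhds s"]
  have "(\<lambda>N. \<Sum>\<alpha> | length \<alpha> < N. F \<alpha>) \<longlonglongrightarrow> s"
    using assms by (simp add: has_sum_def)
  thus ?thesis
    by (simp add: sums_def sum_words_less)
qed

text \<open>For nonnegative terms the sums by degree bound all finite sums. This turns the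
  telescoping identity for the defect into an unordered sum, as a norm in \<open>ltwo\<close>
  requires.\<close>

lemma sums_imp_has_sum_words:
  fixes F :: "'n::finite list \<Rightarrow> real"
  assumes "\<And>\<alpha>. 0 \<le> F \<alpha>" and s: "(\<lambda>k. \<Sum>\<alpha> | length \<alpha> = k. F \<alpha>) sums s"
  shows "(F has_sum s) UNIV"
proof -
  have "F summable_on UNIV"
  proof (rule nonneg_bdd_above_summable_on)
    show "bdd_above (sum F ` {X. X \<subseteq> UNIV \<and> finite X})"
    proof (rule bdd_aboveI2)
      fix X :: "'n list set" assume "X \<in> {X. X \<subseteq> UNIV \<and> finite X}"
      hence X: "finite X"
        by simp
      define N where "N = Suc (Max (length ` X))"
      have "X \<subseteq> {\<alpha>. length \<alpha> < N}"
        using Max_ge[of "length ` X"] X by (auto simp: N_def less_Suc_eq_le)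
      hence "sum F X \<le> (\<Sum>\<alpha> | length \<alpha> < N. F \<alpha>)"
        using assms(1) by (intro sum_mono2) auto
      also have "\<dots> \<le> s"
        unfolding sum_words_less using s assms(1) by (intro sum_le_suminf[of _ "{..<N}", THEN order_trans])
          (auto simp: sums_iff intro: sum_nonneg)
      finally show "sum F X \<le> s" .
    qed
  qed (rule assms(1))
  hence "(F has_sum infsum F UNIV) UNIV"
    by simp
  thus ?thesis
    using sums_unique2[OF has_sum_words_imp_sums s] by blast
qed

lemma has_sum_words_Cons:
  fixes F :: "'n::finite list \<Rightarrow> 'b::real_normed_vector"
  assumes "\<And>j. ((\<lambda>\<alpha>. F (j # \<alpha>)) has_sum s j) UNIV"
  shows "(F has_sum F [] + (\<Sum>j\<in>UNIV. s j)) UNIV"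
proof -
  have "(F has_sum s j) (range (Cons j))" for j
    using assms[of j] by (subst has_sum_reindex) (auto simp: comp_def)
  hence "(F has_sum (\<Sum>j\<in>UNIV. s j)) (\<Union>j\<in>UNIV. range (Cons j))"
    by (intro sum_has_sum) auto
  hence "(F has_sum F [] + (\<Sum>j\<in>UNIV. s j)) (insert [] (\<Union>j\<in>UNIV. range (Cons j)))"
    by (intro has_sum_insert) auto
  moreover have "insert [] (\<Union>j\<in>UNIV. range (Cons j)) = (UNIV :: 'n list set)"
  proof (intro set_eqI iffI UNIV_I)
    show "\<alpha> \<in> insert [] (\<Union>j\<in>UNIV. range (Cons j))" for \<alpha> :: "'n list"
      by (cases \<alpha>) auto
  qed
  ultimately show ?thesis
    by simp
qed

section \<open>Row contractions\<close>

lemma cinner_isometry: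
  assumes "isometry V"
  shows "cinner (V x) (V y) = cinner x y"
proof -
  have V: "bounded_clinear V" "\<And>x. norm (V x) = norm x"
    using assms by (simp_all add: isometry_def)
  have i: "inner (V a) (V b) = inner a b" for a b
    unfolding dot_norm by (simp add: V(2) flip: bounded_clinear_add[OF V(1)])
  show ?thesis
    unfolding cinner_eq by (simp add: i flip: bounded_clinear_scaleC[OF V(1)])
qed

lemma cadj_isometry: "isometry V \<Longrightarrow> cadj V (V x) = x"
  by (rule cadj_eqI) (simp add: isometry_def, rule cinner_isometry)

locale row_contraction =
  fixes A :: "'n::finite \<Rightarrow> 'h::complex_hilbert \<Rightarrow> 'h"
  assumes op_tuple: "A \<in> op_tuples" and row_norm_le: "row_norm A \<le> 1"
begin

definition sq :: "'h \<Rightarrow> 'h" where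
  "sq h = (\<Sum>j\<in>UNIV. A j (cadj (A j) h))"

definition defect :: "'h \<Rightarrow> 'h" where
  "defect = op_sqrt (\<lambda>h. h - sq h)"

lemma lin: "bounded_clinear (A j)"
  using op_tuple by (simp add: op_tuples_def)

lemma lin_word: "bounded_clinear (word_op A \<alpha>)"
  by (rule bounded_clinear_word_op[OF op_tuple])

lemma cinner_sq: "cinner (sq h) h = of_real (\<Sum>j\<in>UNIV. (norm (cadj (A j) h))\<^sup>2)"
  by (simp add: sq_def cinner_sum_left cinner_cadj[OF lin] cinner_same)

lemma bounded_clinear_sq: "bounded_clinear sq"
  unfolding sq_def[abs_def]
  by (rule bounded_clinear_sums) (rule bounded_clinear_compose[OF lin bounded_clinear_cadj[OF lin]])

lemma positive_op_sq: "positive_op sq"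
  unfolding positive_op_def cinner_sq
  by (simp only: nonneg_Reals_of_real_iff) (simp add: bounded_clinear_sq sum_nonneg)

lemma norm_sq_le: "norm (sq h) \<le> norm h"
proof -
  have "onorm sq \<le> 1"
    using row_norm_le by (simp add: row_norm_def sq_def[abs_def])
  hence "onorm sq * norm h \<le> 1 * norm h"
    by (rule mult_right_mono) simp
  thus ?thesis
    using bounded_clinear_onorm[OF bounded_clinear_sq, of h] by simp
qed

lemma positive_op_defect: "positive_op defect"
  unfolding defect_def by (rule op_sqrt_one_minus(1)[OF positive_op_sq norm_sq_le])

lemma defect_defect: "defect (defect h) = h - sq h"
  unfolding defect_def by (rule op_sqrt_one_minus(2)[OF positive_op_sq norm_sq_le])

lemma lin_defect: "bounded_clinear defect"
  using positive_op_defect by (simp add: positive_op_def)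

lemma norm_defect: "(norm (defect h))\<^sup>2 = (norm h)\<^sup>2 - (\<Sum>j\<in>UNIV. (norm (cadj (A j) h))\<^sup>2)"
proof -
  have "of_real ((norm (defect h))\<^sup>2) = cinner (defect (defect h)) h"
    by (simp only: positive_op_selfadjoint[OF positive_op_defect, of "defect h"] cinner_same)
  also have "\<dots> = of_real ((norm h)\<^sup>2 - (\<Sum>j\<in>UNIV. (norm (cadj (A j) h))\<^sup>2))"
    unfolding defect_defect cinner_diff_left cinner_sq cinner_same by simp
  finally show ?thesis
    by (simp only: of_real_eq_iff)
qed

lemma sums_norm_defect:
  assumes pure: "(\<lambda>k. \<Sum>\<alpha> | length \<alpha> = k. word_op A \<alpha> (cadj (word_op A \<alpha>) h)) \<longlonglongrightarrow> 0"
  shows "((\<lambda>\<alpha>. (norm (defect (cadj (word_op A \<alpha>) h)))\<^sup>2) has_sum (norm h)\<^sup>2) UNIV"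
proof (rule sums_imp_has_sum_words)
  define d where "d k = (\<Sum>\<alpha> | length \<alpha> = k. (norm (cadj (word_op A \<alpha>) h))\<^sup>2)" for k
  have d0: "d 0 = (norm h)\<^sup>2"
    by (simp add: d_def cadj_word_op_Nil del: word_op.simps)
  \<comment> \<open>Applying the identity for the defect at
    \<open>cadj (word_op A \<alpha>) h\<close> appends the new letter on the right of
    \<open>\<alpha>\<close>, because adjoints reverse products.\<close>
  have "(\<Sum>\<alpha> | length \<alpha> = k. (norm (defect (cadj (word_op A \<alpha>) h)))\<^sup>2) = d k - d (Suc k)" for k
    unfolding norm_defect d_def sum_words_snoc sum_subtractf
    by (simp add: cadj_word_op_append[OF op_tuple] cadj_word_op_Cons[OF op_tuple] cadj_word_op_Nil
        del: word_op.simps)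
  moreover have "d \<longlonglongrightarrow> 0"
  proof (rule Lim_null_comparison)
    show "(\<lambda>k. norm (\<Sum>\<alpha> | length \<alpha> = k. word_op A \<alpha> (cadj (word_op A \<alpha>) h)) * norm h) \<longlonglongrightarrow> 0"
      by (intro tendsto_mult_left_zero tendsto_norm_zero pure)
    \<comment> \<open>Purity speaks of vectors; pairing them with \<open>h\<close> gives the numbers
      \<open>d k\<close>.\<close>
    have "d k \<le> norm (\<Sum>\<alpha> | length \<alpha> = k. word_op A \<alpha> (cadj (word_op A \<alpha>) h)) * norm h" for k
    proof -
      have "cinner (\<Sum>\<alpha> | length \<alpha> = k. word_op A \<alpha> (cadj (word_op A \<alpha>) h)) h = of_real (d k)"
        by (simp add: cinner_sum_left cinner_cadj[OF lin_word] cinner_same d_def)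
      hence "d k \<le> cmod (cinner (\<Sum>\<alpha> | length \<alpha> = k. word_op A \<alpha> (cadj (word_op A \<alpha>) h)) h)"
        by simp
      thus ?thesis
        using cmod_cinner_le order_trans by blast
    qed
    moreover have "0 \<le> d k" for k
      by (simp add: d_def sum_nonneg)
    ultimately show "\<forall>\<^sub>F k in sequentially. norm (d k) \<le>
        norm (\<Sum>\<alpha> | length \<alpha> = k. word_op A \<alpha> (cadj (word_op A \<alpha>) h)) * norm h"
      by simp
  qed
  ultimately show "(\<lambda>k. \<Sum>\<alpha> | length \<alpha> = k. (norm (defect (cadj (word_op A \<alpha>) h)))\<^sup>2) sums (norm h)\<^sup>2"
    using telescope_sums'[of d 0] by (simp add: d0)
qed simp

end

section \<open>The Poisson kernel\<close>

lemma nc_mult_basis_append: "nc_mult p (coord (basis_elem \<beta>)) (\<alpha> @ \<beta>) = p \<alpha>"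
proof -
  have "nc_mult p (coord (basis_elem \<beta>)) (\<alpha> @ \<beta>) = (\<Sum>k\<in>{length \<alpha>}. p \<alpha>)"
    unfolding nc_mult_def
  proof (rule sum.mono_neutral_cong_right)
    show "\<forall>k\<in>{..length (\<alpha> @ \<beta>)} - {length \<alpha>}.
        p (take k (\<alpha> @ \<beta>)) * coord (basis_elem \<beta>) (drop k (\<alpha> @ \<beta>)) = 0"
    proof
      fix k assume k: "k \<in> {..length (\<alpha> @ \<beta>)} - {length \<alpha>}"
      hence "length (drop k (\<alpha> @ \<beta>)) \<noteq> length \<beta>"
        by auto
      hence "drop k (\<alpha> @ \<beta>) \<noteq> \<beta>"
        by metis
      thus "p (take k (\<alpha> @ \<beta>)) * coord (basis_elem \<beta>) (drop k (\<alpha> @ \<beta>)) = 0"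
        by simp
    qed
  qed auto
  thus ?thesis
    by simp
qed

lemma nc_mult_basis_eq_0:
  assumes "\<gamma> \<notin> range (\<lambda>\<alpha>. \<alpha> @ \<beta>)"
  shows "nc_mult p (coord (basis_elem \<beta>)) \<gamma> = 0"
proof -
  have "drop k \<gamma> \<noteq> \<beta>" for k
    using assms append_take_drop_id[of k \<gamma>] by (metis rangeI)
  thus ?thesis
    by (simp add: nc_mult_def)
qed

text \<open>\<open>coord_M\<close> is written as a product with a word rather than coordinate by
  coordinate, so that each case of the model property can substitute \<open>f\<close> into both
  sides and compare by its own injectivity argument.\<close>

locale universal_model =
  fixes f g :: "'n::finite \<Rightarrow> 'n nc_series"
    and M :: "'n \<Rightarrow> ('n list, complex) ltwo \<Rightarrow> ('n list, complex) ltwo"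
  assumes M_op_tuples: "M \<in> op_tuples"
    and M_conv: "M \<in> conv_sot f \<union> conv_rad f"
    and coord_M: "coord (M i (basis_elem \<beta>)) = nc_mult (g i) (coord (basis_elem \<beta>))"
    and nc_eval_M: "nc_eval f M j (basis_elem \<beta>) = basis_elem (j # \<beta>)"
begin

lemma lin_M: "bounded_clinear (M i)"
  using M_op_tuples by (simp add: op_tuples_def)

lemma lin_S: "bounded_clinear (nc_eval f M j)"
  using nc_eval_op_tuples[OF M_conv] by (simp add: op_tuples_def)

lemma coord_M_append: "coord (M i (basis_elem \<beta>)) (\<alpha> @ \<beta>) = g i \<alpha>"
  by (simp only: coord_M nc_mult_basis_append)

lemma coord_M_eq_0: "\<gamma> \<notin> range (\<lambda>\<alpha>. \<alpha> @ \<beta>) \<Longrightarrow> coord (M i (basis_elem \<beta>)) \<gamma> = 0"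
  by (simp only: coord_M nc_mult_basis_eq_0 not_False_eq_True)

lemma coord_ampl_S_Nil: "coord (ampl (nc_eval f M j) u) [] = 0"
proof (rule bounded_clinear_eqI_tensor[where B = "\<lambda>u. 0" and A = "\<lambda>u. coord (ampl (nc_eval f M j) u) []"])
  show "bounded_clinear (\<lambda>u. coord (ampl (nc_eval f M j) u) [])"
    by (intro bounded_clinear_compose[OF bounded_clinear_coord] bounded_clinear_ampl lin_S)
qed (simp_all add: bounded_clinear_const_zero ampl_tensor[OF lin_S] nc_eval_M)

lemma coord_ampl_S_Cons:
  "coord (ampl (nc_eval f M j) u) (i # \<alpha>) = (if i = j then coord u \<alpha> else 0)"
proof (rule bounded_clinear_eqI_tensor[where A = "\<lambda>u. coord (ampl (nc_eval f M j) u) (i # \<alpha>)"])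
  show "bounded_clinear (\<lambda>u. coord (ampl (nc_eval f M j) u) (i # \<alpha>))"
    by (intro bounded_clinear_compose[OF bounded_clinear_coord] bounded_clinear_ampl lin_S)
  show "bounded_clinear (\<lambda>u. if i = j then coord u \<alpha> else 0)"
    by (cases "i = j") (simp_all add: bounded_clinear_coord bounded_clinear_const_zero)
qed (auto simp: ampl_tensor[OF lin_S] nc_eval_M)

end

locale pure_tuple_in_domain = universal_model f g M
  for f g :: "'n::finite \<Rightarrow> 'n nc_series" and M +
  fixes T :: "'n \<Rightarrow> 'h::complex_hilbert \<Rightarrow> 'h"
  assumes T_domain: "T \<in> nc_domain f g" and T_pure: "pure_tuple f T"
begin

abbreviation A where "A \<equiv> nc_eval f T"

abbreviation K where "K \<equiv> poisson_kernel f T"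

lemma T_op_tuples: "T \<in> op_tuples"
  using T_domain by (simp add: nc_domain_def)

lemma lin_T: "bounded_clinear (T i)"
  using T_op_tuples by (simp add: op_tuples_def)

lemma T_conv: "T \<in> conv_sot f \<union> conv_rad f"
  using T_domain by (simp add: nc_domain_def inverts_at_def)

sublocale row_contraction A
  using T_domain nc_eval_op_tuples[OF T_conv] by unfold_locales (simp_all add: nc_domain_def)

lemma defect_op_eq: "defect_op f T = defect"
  by (simp add: defect_op_def defect_def sq_def)

lemma defect_space_eq: "defect_space f T = closure (range defect)"
  by (simp add: defect_space_def defect_op_eq)

lemma closed_defect_space: "closed (defect_space f T)"
  by (simp add: defect_space_eq)

lemma csubspace_defect_space: "csubspace (defect_space f T)"
proof -
  have "csubspace (range defect)"
    unfolding csubspace_def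
    by (auto simp: bounded_clinear_zero[OF lin_defect] simp flip: bounded_clinear_add[OF lin_defect]
        bounded_clinear_scaleC[OF lin_defect] intro: range_eqI[of _ _ 0])
  thus ?thesis
    unfolding defect_space_eq by (rule csubspace_closure)
qed

lemma defect_in_defect_space: "defect h \<in> defect_space f T"
  unfolding defect_space_eq by (rule subsetD[OF closure_subset rangeI])

lemma has_sum_norm_defect:
  "((\<lambda>\<alpha>. (norm (defect (cadj (word_op A \<alpha>) h)))\<^sup>2) has_sum (norm h)\<^sup>2) UNIV"
  by (rule sums_norm_defect) (rule T_pure[unfolded pure_tuple_def, rule_format])

text \<open>\<open>poisson_kernel\<close> is an \<open>infsum\<close>, which would be 0 for a
  divergent family. Purity gives square-summability beforehand, so the sum is the basis expansion of
  a genuine vector.\<close>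

lemma coord_K: "coord (K h) \<alpha> = defect (cadj (word_op A \<alpha>) h)"
proof -
  have "square_summable (\<lambda>\<alpha>. defect (cadj (word_op A \<alpha>) h))"
    unfolding square_summable_def by (rule has_sum_imp_summable[OF has_sum_norm_defect])
  hence c: "coord (Abs_ltwo (\<lambda>\<alpha>. defect (cadj (word_op A \<alpha>) h))) \<alpha> = defect (cadj (word_op A \<alpha>) h)" for \<alpha>
    by (simp add: coord_Abs)
  have "K h = Abs_ltwo (\<lambda>\<alpha>. defect (cadj (word_op A \<alpha>) h))"
    using infsumI[OF basis_expansion[of "Abs_ltwo (\<lambda>\<alpha>. defect (cadj (word_op A \<alpha>) h))"]]
    by (simp add: poisson_kernel_def defect_op_eq c)
  thus ?thesis
    by (simp add: c)
qed

lemma isometry_K: "isometry K"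
proof -
  have n: "norm (K h) = norm h" for h
  proof -
    have "(norm (K h))\<^sup>2 = (norm h)\<^sup>2"
      using norm_ltwo_has_sum[of "K h"] has_sum_norm_defect[of h]
      unfolding coord_K by (rule has_sum_unique)
    thus ?thesis
      by simp
  qed
  have "bounded_clinear K"
  proof (rule bounded_clinearI)
    note lin = bounded_clinear_compose[OF lin_defect bounded_clinear_cadj[OF lin_word]]
    show "K (x + y) = K x + K y" for x y
      by (rule ltwo_eqI) (simp add: coord_K bounded_clinear_add[OF lin])
    show "K (c *\<^sub>C x) = c *\<^sub>C K x" for c x
      by (rule ltwo_eqI) (simp add: coord_K bounded_clinear_scaleC[OF lin])
    show "norm (K x) \<le> 1 * norm x" for x
      by (simp add: n)
  qed
  thus ?thesis
    by (simp add: isometry_def n)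
qed

lemma lin_K: "bounded_clinear K"
  using isometry_K by (simp add: isometry_def)

lemma cadj_K_tensor: "cadj K (tensor (basis_elem \<beta>) x) = word_op A \<beta> (defect x)"
  by (rule cadj_eqI[OF lin_K])
    (simp only: cinner_tensor_basis coord_K positive_op_selfadjoint[OF positive_op_defect]
      cinner_cadj'[OF lin_word])

lemma abel_sums_T: "abel_sums (\<lambda>k. hom_part (g i) A k h) (T i h)"
proof -
  have "(\<forall>i. sot_sums (hom_part (g i) A) (T i)) \<or> (\<forall>i. radial_sums 0 (g i) A (T i))"
    using T_domain by (simp add: nc_domain_def inverts_at_def)
  thus ?thesis
  proof
    assume "\<forall>i. sot_sums (hom_part (g i) A) (T i)"
    thus ?thesis
      using sot_sums_imp_abel_sums by blast
  next
    assume "\<forall>i. radial_sums 0 (g i) A (T i)"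
    thus ?thesis
      using radial_sums_imp_abel_sums[OF _ zero_less_one op_tuple] by blast
  qed
qed

lemma cadj_K_ampl_M: "cadj K (ampl (M i) u) = T i (cadj K u)"
proof (rule bounded_clinear_eqI_tensor[where A = "\<lambda>u. cadj K (ampl (M i) u)"])
  show "bounded_clinear (\<lambda>u. cadj K (ampl (M i) u))"
    by (rule bounded_clinear_compose[OF bounded_clinear_cadj[OF lin_K] bounded_clinear_ampl[OF lin_M]])
  show "bounded_clinear (\<lambda>u. T i (cadj K u))"
    by (rule bounded_clinear_compose[OF lin_T bounded_clinear_cadj[OF lin_K]])
  fix \<beta> x
  define y where "y = word_op A \<beta> (defect x)"
  define \<phi> where "\<phi> = M i (basis_elem \<beta>)"
  have "((\<lambda>\<gamma>. coord \<phi> \<gamma> *\<^sub>C word_op A \<gamma> (defect x)) has_sum cadj K (tensor \<phi> x)) UNIV"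
    using bounded_clinear_has_sum[OF bounded_clinear_compose[OF bounded_clinear_cadj[OF lin_K]
        bounded_clinear_tensor_left] basis_expansion_complex[of \<phi>], of x]
    by (simp add: tensor_scaleC_left bounded_clinear_scaleC[OF bounded_clinear_cadj[OF lin_K]] cadj_K_tensor)
  \<comment> \<open>\<open>M i (basis_elem \<beta>)\<close> is supported on words ending in
    \<open>\<beta>\<close>. Reindexing by the part in front of \<open>\<beta>\<close> turns the sum
    into the series \<open>g i\<close> at \<open>A\<close>, applied to \<open>y\<close>.\<close>
  hence "((\<lambda>\<gamma>. coord \<phi> \<gamma> *\<^sub>C word_op A \<gamma> (defect x)) has_sum cadj K (tensor \<phi> x)) (range (\<lambda>\<alpha>. \<alpha> @ \<beta>))"
    by (rule iffD1[OF has_sum_cong_neutral, rotated -1]) (auto simp: \<phi>_def coord_M_eq_0)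
  hence "((\<lambda>\<alpha>. g i \<alpha> *\<^sub>C word_op A \<alpha> y) has_sum cadj K (tensor \<phi> x)) UNIV"
    by (subst (asm) has_sum_reindex)
      (auto simp: inj_on_def comp_def \<phi>_def coord_M_append word_op_append y_def)
  hence "(\<lambda>k. hom_part (g i) A k y) sums cadj K (tensor \<phi> x)"
    unfolding hom_part_def by (rule has_sum_words_imp_sums)
  \<comment> \<open>At \<open>y\<close> the series converges in the ordinary sense, while
    \<open>T i\<close> may be known only as its radial limit; both are Abel sums.\<close>
  from abel_sums_unique[OF sums_imp_abel_sums[OF this] abel_sums_T]
  show "cadj K (ampl (M i) (tensor (basis_elem \<beta>) x)) = T i (cadj K (tensor (basis_elem \<beta>) x))"
    by (simp add: ampl_tensor[OF lin_M] cadj_K_tensor \<phi>_def y_def)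
qed

lemma K_in_tensor_space: "K h \<in> tensor_space (defect_space f T)"
  by (simp add: tensor_space_def coord_K defect_in_defect_space)

end

section \<open>The Poisson kernel as a minimal dilation\<close>

lemma closure_range_sequence:
  fixes D :: "'h \<Rightarrow> 'b::real_normed_vector"
  assumes "x \<in> closure (range D)"
  obtains h where "(\<lambda>n. D (h n)) \<longlonglongrightarrow> x"
proof -
  obtain s where s: "\<forall>n. s n \<in> range D" "s \<longlonglongrightarrow> x"
    using assms unfolding closure_sequential by (elim exE conjE)
  have "\<forall>n. \<exists>h. s n = D h"
    using s(1) by (simp add: image_iff)
  then obtain h where "\<forall>n. s n = D (h n)"
    by (rule choice[THEN exE])
  hence "s = (\<lambda>n. D (h n))"
    by auto
  with s(2) show thesis
    by (simp add: that)
qed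

context pure_tuple_in_domain
begin

lemma isometric_dilation_K: "isometric_dilation M T (defect_space f T) K"
  unfolding isometric_dilation_def
proof (intro conjI allI)
  show "isometry K"
    by (rule isometry_K)
  show "range K \<subseteq> tensor_space (defect_space f T)"
    using K_in_tensor_space by blast
  fix i
  have "cadj (ampl (M i)) (K h) = K (cadj (T i) h)" for h
    by (rule cadj_eqI[OF bounded_clinear_ampl[OF lin_M]])
      (simp only: cinner_cadj'[OF lin_K, symmetric] cadj_K_ampl_M cinner_cadj[OF lin_T])
  thus "cadj (ampl (M i)) ` range K \<subseteq> range K"
    by auto
  show "T i = cadj K \<circ> ampl (M i) \<circ> K"
    by (rule ext) (simp add: cadj_K_ampl_M cadj_isometry[OF isometry_K])
qed

text \<open>Telescoping \<open>K\<close> against the shifts \<open>f\<^sub>j(M) \<otimes> I\<close> isolates the vacuum component.\<close>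

lemma tensor_Nil_defect:
  "tensor (basis_elem []) (defect h) = K h - (\<Sum>j\<in>UNIV. ampl (nc_eval f M j) (K (cadj (A j) h)))"
proof (rule ltwo_eqI)
  fix \<alpha>
  show "coord (tensor (basis_elem []) (defect h)) \<alpha> =
      coord (K h - (\<Sum>j\<in>UNIV. ampl (nc_eval f M j) (K (cadj (A j) h)))) \<alpha>"
    by (cases \<alpha>)
      (simp_all add: coord_sum coord_ampl_S_Nil coord_ampl_S_Cons coord_K cadj_word_op_Nil
        cadj_word_op_Cons[OF op_tuple]
        del: word_op.simps)
qed

lemma minimal_dilation_K: "minimal_dilation M (defect_space f T) K"
  unfolding minimal_dilation_def
proof (rule antisym)
  let ?G = "\<Union>\<alpha>. ampl (word_op M \<alpha>) ` range K"
  let ?Y = "closed_span ?G"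
  note lin_MM = bounded_clinear_word_op[OF M_op_tuples]
  show "?Y \<subseteq> tensor_space (defect_space f T)"
    by (intro closed_span_minimal csubspace_tensor_space closed_tensor_space closed_defect_space
        csubspace_defect_space)
      (auto intro!: ampl_tensor_space lin_MM closed_defect_space csubspace_defect_space K_in_tensor_space)
  have Y: "closed ?Y" "csubspace ?Y"
    by (rule closed_closed_span, rule csubspace_closed_span)
  have "ampl (M i) u \<in> ?Y" if "u \<in> ?Y" for i u
  proof (rule closed_span_invariant[OF bounded_clinear_ampl[OF lin_M] _ that])
    fix v assume "v \<in> ?G"
    then obtain \<alpha> h where "v = ampl (word_op M \<alpha>) (K h)"
      by blast
    hence "ampl (M i) v = ampl (word_op M (i # \<alpha>)) (K h)"
      using ampl_compose[OF lin_M lin_MM, of i \<alpha> "K h"] by (simp add: comp_def)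
    thus "ampl (M i) v \<in> ?Y"
      using closed_span_superset[of ?G] by blast
  qed
  hence S: "ampl (nc_eval f M j) u \<in> ?Y" if "u \<in> ?Y" for j u
    using that by (intro ampl_nc_eval_invariant[OF M_conv Y])
  have "ampl (word_op M []) (K h) = K h" for h
    using ampl_eqI[OF bounded_clinear_id bounded_clinear_id, of "K h"] by (simp add: id_def)
  hence "K h \<in> ampl (word_op M []) ` range K" for h
    by (metis image_eqI rangeI)
  hence KY: "K h \<in> ?Y" for h
    by (intro subsetD[OF closed_span_superset] UN_I[of "[]"]) simp_all
  \<comment> \<open>Each shift adds one letter on the left, so all words are generated from the
    vacuum vectors, which telescoping expresses through \<open>K\<close> and the shifts.\<close>
  have d: "tensor (basis_elem \<beta>) (defect h) \<in> ?Y" for \<beta> h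
  proof (induction \<beta>)
    case Nil
    show ?case
      unfolding tensor_Nil_defect by (intro csubspace_diff csubspace_sum Y S KY)
  next
    case (Cons j \<beta>)
    from S[OF Cons, of j] show ?case
      by (simp add: ampl_tensor[OF lin_S] nc_eval_M)
  qed
  have t: "tensor (basis_elem \<beta>) x \<in> ?Y" if "x \<in> defect_space f T" for \<beta> x
  proof -
    from that obtain h where h: "(\<lambda>n. defect (h n)) \<longlonglongrightarrow> x"
      unfolding defect_space_eq by (rule closure_range_sequence)
    show ?thesis
      by (rule Lim_in_closed_set[OF Y(1) always_eventually sequentially_bot
          bounded_linear.tendsto[OF bounded_clinear_linear[OF bounded_clinear_tensor_right] h]])
        (simp add: d)
  qed
  show "tensor_space (defect_space f T) \<subseteq> ?Y"
  proof
    fix u :: "('n list, 'h) ltwo" assume "u \<in> tensor_space (defect_space f T)"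
    thus "u \<in> ?Y"
      by (intro has_sum_in_closed_csubspace[OF Y basis_expansion[of u]] t) (simp add: tensor_space_def)
  qed
qed

end

section \<open>Uniqueness of the minimal dilation\<close>

text \<open>The graph of the extension is the closure of \<open>{(D h, G h)}\<close>, which is symmetric in \<open>D\<close> and \<open>G\<close>.\<close>

lemma isometric_extension:
  fixes D :: "'h::complex_hilbert \<Rightarrow> 'a::complex_hilbert" and G :: "'h \<Rightarrow> 'b::complex_hilbert"
  assumes D: "bounded_clinear D" and G: "bounded_clinear G" and eq: "\<And>h. norm (D h) = norm (G h)"
  obtains U where "\<And>h. U (D h) = G h"
    "\<And>x y. x \<in> closure (range D) \<Longrightarrow> y \<in> closure (range D) \<Longrightarrow> U (x + y) = U x + U y"
    "\<And>c x. x \<in> closure (range D) \<Longrightarrow> U (c *\<^sub>C x) = c *\<^sub>C U x"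
    "\<And>x. x \<in> closure (range D) \<Longrightarrow> norm (U x) = norm x"
    "U ` closure (range D) = closure (range G)"
proof -
  define R where "R x y \<longleftrightarrow> (\<exists>h. (\<lambda>n. D (h n)) \<longlonglongrightarrow> x \<and> (\<lambda>n. G (h n)) \<longlonglongrightarrow> y)" for x y
  have R_closure: "x \<in> closure (range D)" "y \<in> closure (range G)" if "R x y" for x y
  proof -
    obtain h where h: "(\<lambda>n. D (h n)) \<longlonglongrightarrow> x" "(\<lambda>n. G (h n)) \<longlonglongrightarrow> y"
      using \<open>R x y\<close> unfolding R_def by (elim exE conjE)
    show "x \<in> closure (range D)"
      unfolding closure_sequential using h(1) by (intro exI[of _ "\<lambda>n. D (h n)"]) simp
    show "y \<in> closure (range G)"
      unfolding closure_sequential using h(2) by (intro exI[of _ "\<lambda>n. G (h n)"]) simp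
  qed
  have R_add: "R (x + x') (y + y')" if "R x y" "R x' y'" for x y x' y'
  proof -
    obtain h h' where "(\<lambda>n. D (h n)) \<longlonglongrightarrow> x" "(\<lambda>n. G (h n)) \<longlonglongrightarrow> y"
      "(\<lambda>n. D (h' n)) \<longlonglongrightarrow> x'" "(\<lambda>n. G (h' n)) \<longlonglongrightarrow> y'"
      using \<open>R x y\<close> \<open>R x' y'\<close> unfolding R_def by blast
    thus ?thesis
      unfolding R_def
      by (intro exI[of _ "\<lambda>n. h n + h' n"])
        (simp add: bounded_clinear_add[OF D] bounded_clinear_add[OF G] tendsto_add)
  qed
  have R_scaleC: "R (c *\<^sub>C x) (c *\<^sub>C y)" if "R x y" for c x y
  proof -
    obtain h where h: "(\<lambda>n. D (h n)) \<longlonglongrightarrow> x" "(\<lambda>n. G (h n)) \<longlonglongrightarrow> y"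
      using \<open>R x y\<close> unfolding R_def by blast
    show ?thesis
      unfolding R_def
      using bounded_linear.tendsto[OF bounded_clinear_linear[OF bounded_clinear_cmult[OF bounded_clinear_id]] h(1), of c]
        bounded_linear.tendsto[OF bounded_clinear_linear[OF bounded_clinear_cmult[OF bounded_clinear_id]] h(2), of c]
      by (intro exI[of _ "\<lambda>n. c *\<^sub>C h n"])
        (simp add: bounded_clinear_scaleC[OF D] bounded_clinear_scaleC[OF G])
  qed
  have R_norm: "norm x = norm y" if "R x y" for x y
  proof -
    obtain h where h: "(\<lambda>n. D (h n)) \<longlonglongrightarrow> x" "(\<lambda>n. G (h n)) \<longlonglongrightarrow> y"
      using \<open>R x y\<close> unfolding R_def by blast
    show ?thesis
      using tendsto_norm[OF h(1)] tendsto_norm[OF h(2)] unfolding eq by (rule LIMSEQ_unique)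
  qed
  \<comment> \<open>Subtracting the pairs gives \<open>R 0 (y - y')\<close>, and \<open>R\<close>
    preserves norms.\<close>
  have R_unique: "y = y'" if "R x y" "R x y'" for x y y'
    using R_norm[OF R_add[OF that(1) R_scaleC[OF that(2), of "- 1"]]]
    by (simp add: scaleC_minus_left)
  \<comment> \<open>Formulated for any such pair so that it serves from \<open>D\<close> to
    \<open>G\<close> and, for surjectivity, from \<open>G\<close> to \<open>D\<close>.\<close>
  have cauchy: "\<exists>y. (\<lambda>n. G' (h n)) \<longlonglongrightarrow> y"
    if "(\<lambda>n. D' (h n)) \<longlonglongrightarrow> x" and D': "bounded_clinear D'" and G': "bounded_clinear G'"
      and eq': "\<And>h. norm (D' h) = norm (G' h)"
    for D' :: "'h \<Rightarrow> 'c::complex_hilbert" and G' :: "'h \<Rightarrow> 'd::complex_hilbert" and h x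
  proof -
    have "Cauchy (\<lambda>n. D' (h n))"
      using that(1) by (rule LIMSEQ_imp_Cauchy)
    moreover have "dist (D' (h m)) (D' (h n)) = dist (G' (h m)) (G' (h n))" for m n
      unfolding dist_norm bounded_clinear_diff[OF D', symmetric] bounded_clinear_diff[OF G', symmetric]
      by (rule eq')
    ultimately have "Cauchy (\<lambda>n. G' (h n))"
      by (simp add: Cauchy_def)
    thus ?thesis
      by (simp add: Cauchy_convergent_iff convergent_def)
  qed
  have R_ex: "\<exists>y. R x y" if "x \<in> closure (range D)" for x
  proof -
    from that obtain h where "(\<lambda>n. D (h n)) \<longlonglongrightarrow> x"
      by (rule closure_range_sequence)
    thus ?thesis
      using cauchy[OF _ D G eq] unfolding R_def by blast
  qed
  have R_ex': "\<exists>x. R x y" if "y \<in> closure (range G)" for y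
  proof -
    from that obtain h where "(\<lambda>n. G (h n)) \<longlonglongrightarrow> y"
      by (rule closure_range_sequence)
    thus ?thesis
      using cauchy[OF _ G D eq[symmetric]] unfolding R_def by blast
  qed
  have R_range: "R (D h) (G h)" for h
    unfolding R_def by (intro exI[of _ "\<lambda>_. h"]) simp
  define U where "U x = (SOME y. R x y)" for x
  have U_eq: "U x = y" if "R x y" for x y
    unfolding U_def by (rule some_equality, rule that) (rule R_unique[OF _ that])
  have U: "R x (U x)" if "x \<in> closure (range D)" for x
    unfolding U_def using R_ex[OF that] by (rule someI_ex)
  show thesis
  proof (rule that)
    show "U (D h) = G h" for h
      by (rule U_eq[OF R_range])
    show "U (x + y) = U x + U y" if "x \<in> closure (range D)" "y \<in> closure (range D)" for x y
      by (rule U_eq[OF R_add[OF U[OF that(1)] U[OF that(2)]]])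
    show "U (c *\<^sub>C x) = c *\<^sub>C U x" if "x \<in> closure (range D)" for c x
      by (rule U_eq[OF R_scaleC[OF U[OF that]]])
    show "norm (U x) = norm x" if "x \<in> closure (range D)" for x
      by (rule R_norm[OF U[OF that], symmetric])
    show "U ` closure (range D) = closure (range G)"
    proof (intro set_eqI iffI)
      fix y assume "y \<in> U ` closure (range D)"
      thus "y \<in> closure (range G)"
        using R_closure(2)[OF U] by (elim imageE) simp
    next
      fix y assume "y \<in> closure (range G)"
      then obtain x where "R x y"
        by (rule exE[OF R_ex'])
      thus "y \<in> U ` closure (range D)"
        using R_closure(1) U_eq by (metis imageI)
    qed
  qed
qed

lemma cinner_isometry_on:
  assumes S: "csubspace S"
    and add: "\<And>x y. x \<in> S \<Longrightarrow> y \<in> S \<Longrightarrow> U (x + y) = U x + U y"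
    and scaleC: "\<And>c x. x \<in> S \<Longrightarrow> U (c *\<^sub>C x) = c *\<^sub>C U x"
    and norm: "\<And>x. x \<in> S \<Longrightarrow> norm (U x) = norm x"
    and xy: "x \<in> S" "y \<in> S"
  shows "cinner (U x) (U y) = cinner x y"
proof -
  have i: "inner (U a) (U b) = inner a b" if "a \<in> S" "b \<in> S" for a b
    unfolding dot_norm using that by (simp add: norm csubspace_add[OF S] flip: add)
  show ?thesis
    unfolding cinner_eq by (simp add: i xy csubspace_scaleC[OF S] flip: scaleC)
qed

text \<open>\<open>W\<close> is \<open>U\<close> applied to every coordinate. Nothing is known about
  \<open>U\<close> outside \<open>D\<close>, so linearity, isometry and passage to limits are all
  argued inside \<open>tensor_space D\<close>.\<close>

lemma unitary_between_tensor_space: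
  fixes U :: "'a::complex_hilbert \<Rightarrow> 'b::complex_hilbert"
  assumes D: "closed D" "csubspace D"
    and add: "\<And>x y. x \<in> D \<Longrightarrow> y \<in> D \<Longrightarrow> U (x + y) = U x + U y"
    and scaleC: "\<And>c x. x \<in> D \<Longrightarrow> U (c *\<^sub>C x) = c *\<^sub>C U x"
    and norm: "\<And>x. x \<in> D \<Longrightarrow> norm (U x) = norm x"
    and E: "U ` D = E"
  obtains W :: "('i, 'a) ltwo \<Rightarrow> ('i, 'b) ltwo"
    where "unitary_between (tensor_space D) (tensor_space E) W"
      "\<And>u \<alpha>. u \<in> tensor_space D \<Longrightarrow> coord (W u) \<alpha> = U (coord u \<alpha>)"
      "\<And>A u. bounded_clinear A \<Longrightarrow> u \<in> tensor_space D \<Longrightarrow> W (ampl A u) = ampl A (W u)"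
proof -
  define W :: "('i, 'a) ltwo \<Rightarrow> ('i, 'b) ltwo" where "W u = Abs_ltwo (\<lambda>\<alpha>. U (coord u \<alpha>))" for u
  note TD = csubspace_tensor_space[OF D(2)]
  have mem: "coord u \<alpha> \<in> D" if "u \<in> tensor_space D" for u :: "('i, 'a) ltwo" and \<alpha>
    using that by (simp add: tensor_space_def)
  have W: "coord (W u) \<alpha> = U (coord u \<alpha>)" if "u \<in> tensor_space D" for u \<alpha>
    unfolding W_def
    by (subst coord_Abs)
      (auto intro!: square_summable_bound[OF square_summable_coord[of u], of _ 1] simp: norm mem[OF that])
  have W_add: "W (u + v) = W u + W v" if "u \<in> tensor_space D" "v \<in> tensor_space D" for u v
    by (rule ltwo_eqI) (simp add: W that csubspace_add[OF TD] add mem)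
  have W_scaleC: "W (c *\<^sub>C u) = c *\<^sub>C W u" if "u \<in> tensor_space D" for c u
    by (rule ltwo_eqI) (simp add: W that csubspace_scaleC[OF TD] scaleC mem)
  have W_norm: "norm (W u) = norm u" if "u \<in> tensor_space D" for u
  proof -
    have "(norm (W u))\<^sup>2 = (norm u)\<^sup>2"
      using norm_ltwo_has_sum[of "W u"] norm_ltwo_has_sum[of u]
      unfolding W[OF that] norm[OF mem[OF that]] by (rule has_sum_unique)
    thus ?thesis
      by simp
  qed
  have U_diff: "U (x - y) = U x - U y" if "x \<in> D" "y \<in> D" for x y
    using add[OF csubspace_diff[OF D(2) that] that(2)] by simp
  have U_inj: "x = y" if "x \<in> D" "y \<in> D" "U x = U y" for x y
  proof -
    have "norm (x - y) = 0"
      using norm[OF csubspace_diff[OF D(2) that(1,2)]] U_diff[OF that(1,2)] that(3) by simp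
    thus ?thesis
      by simp
  qed
  have "bij_betw W (tensor_space D) (tensor_space E)"
    unfolding bij_betw_def
  proof (intro conjI inj_onI set_eqI iffI)
    fix u v assume u: "u \<in> tensor_space D" and v: "v \<in> tensor_space D" and "W u = W v"
    hence "U (coord u \<alpha>) = U (coord v \<alpha>)" for \<alpha>
      by (simp only: W[symmetric])
    thus "u = v"
      by (intro ltwo_eqI U_inj mem u v)
  next
    fix v assume "v \<in> W ` tensor_space D"
    then obtain u where u: "u \<in> tensor_space D" "v = W u"
      by (elim imageE)
    have "U (coord u \<alpha>) \<in> E" for \<alpha>
      using mem[OF u(1)] by (simp add: E[symmetric])
    thus "v \<in> tensor_space E"
      by (simp add: tensor_space_def u(2) W[OF u(1)])
  next
    fix v :: "('i, 'b) ltwo" assume "v \<in> tensor_space E"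
    hence "coord v \<alpha> \<in> U ` D" for \<alpha>
      by (simp add: tensor_space_def E)
    hence "\<exists>x. x \<in> D \<and> U x = coord v \<alpha>" for \<alpha>
      by (metis imageE)
    then obtain x where x: "\<And>\<alpha>. x \<alpha> \<in> D" "\<And>\<alpha>. U (x \<alpha>) = coord v \<alpha>"
      by metis
    \<comment> \<open>Preimages chosen coordinate by coordinate keep the norms, hence form a
      square-summable family.\<close>
    have "norm (x \<alpha>) \<le> 1 * norm (coord v \<alpha>)" for \<alpha>
      using norm[OF x(1)[of \<alpha>]] x(2)[of \<alpha>] by simp
    hence c: "coord (Abs_ltwo x) = x"
      by (intro coord_Abs square_summable_bound[OF square_summable_coord[of v]])
    hence xD: "Abs_ltwo x \<in> tensor_space D"
      by (simp add: tensor_space_def x)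
    moreover have "W (Abs_ltwo x) = v"
      by (rule ltwo_eqI) (simp add: W[OF xD] c x)
    ultimately show "v \<in> W ` tensor_space D"
      by blast
  qed
  hence unitary: "unitary_between (tensor_space D) (tensor_space E) W"
    unfolding unitary_between_def
    by (auto simp: W_add W_scaleC intro!: cinner_isometry_on[OF TD] W_norm)
  have "W (ampl A u) = ampl A (W u)" if A: "bounded_clinear A" and u: "u \<in> tensor_space D" for A u
  proof -
    have t: "tensor \<phi> (coord u i) \<in> tensor_space D" for \<phi> i
      by (rule tensor_in_tensor_space[OF D(2) mem[OF u]])
    have W_tensor: "W (tensor \<phi> (coord u i)) = tensor \<phi> (U (coord u i))" for \<phi> i
      by (rule ltwo_eqI) (simp add: W[OF t] scaleC mem[OF u])
    have a: "ampl A u \<in> tensor_space D"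
      by (rule ampl_tensor_space[OF A D u])
    have W_sum: "(\<Sum>i\<in>F. tensor (A (basis_elem i)) (U (coord u i))) =
        W (\<Sum>i\<in>F. tensor (A (basis_elem i)) (coord u i))" for F
    proof (induction F rule: infinite_finite_induct)
      case (insert i F)
      thus ?case
        by (simp add: W_add csubspace_sum[OF TD t] t W_tensor)
    qed (use W_scaleC[of 0 0] TD in \<open>auto simp: csubspace_def\<close>)
    \<comment> \<open>The isometric \<open>W\<close> carries the partial sums for
      \<open>ampl A u\<close> to those on the right with the same error; this stands in for
      continuity of a globally defined operator.\<close>
    have "((\<lambda>i. tensor (A (basis_elem i)) (U (coord u i))) has_sum W (ampl A u)) UNIV"
      unfolding has_sum_def
    proof (rule tendstoI)
      fix e :: real assume "0 < e"
      hence "\<forall>\<^sub>F F in finite_subsets_at_top UNIV.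
          dist (\<Sum>i\<in>F. tensor (A (basis_elem i)) (coord u i)) (ampl A u) < e"
        using ampl_has_sum[OF A, of u] unfolding has_sum_def by (intro tendstoD)
      moreover have "dist (\<Sum>i\<in>F. tensor (A (basis_elem i)) (U (coord u i))) (W (ampl A u)) =
          dist (\<Sum>i\<in>F. tensor (A (basis_elem i)) (coord u i)) (ampl A u)" for F
      proof -
        define v where "v = (\<Sum>i\<in>F. tensor (A (basis_elem i)) (coord u i))"
        have v: "v \<in> tensor_space D"
          unfolding v_def by (intro csubspace_sum[OF TD] t)
        have "W (v - ampl A u) = W v - W (ampl A u)"
          by (rule ltwo_eqI) (simp add: W v a csubspace_diff[OF TD] U_diff mem)
        hence "norm (W v - W (ampl A u)) = norm (v - ampl A u)"
          using W_norm[OF csubspace_diff[OF TD v a]] by simp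
        thus ?thesis
          unfolding W_sum v_def[symmetric] dist_norm .
      qed
      ultimately show "\<forall>\<^sub>F F in finite_subsets_at_top UNIV.
          dist (\<Sum>i\<in>F. tensor (A (basis_elem i)) (U (coord u i))) (W (ampl A u)) < e"
        by simp
    qed
    thus ?thesis
      using ampl_has_sum[OF A, of "W u"] unfolding W[OF u] by (rule has_sum_unique)
  qed
  with unitary W show thesis
    by (rule that)
qed

section \<open>The structure of an arbitrary dilation\<close>

context pure_tuple_in_domain
begin

context
  fixes E :: "'e::complex_hilbert set" and V :: "'h \<Rightarrow> ('n list, 'e) ltwo"
  assumes E: "closed E" "csubspace E" and V: "isometric_dilation M T E V"
begin

lemma isometry_V: "isometry V"
  using V by (simp add: isometric_dilation_def)

lemma lin_V: "bounded_clinear V"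
  using isometry_V by (simp add: isometry_def)

text \<open>Co-invariance lets \<open>u\<close> be replaced by its projection
  \<open>V (cadj V u)\<close> without changing \<open>cadj V (ampl (M i) u)\<close>; the compression
  formula then evaluates the result.\<close>

lemma cadj_V_ampl_M: "cadj V (ampl (M i) u) = T i (cadj V u)"
proof (rule cinner_eqI)
  fix h
  obtain h' where h': "cadj (ampl (M i)) (V h) = V h'"
    using V unfolding isometric_dilation_def by blast
  have "T i (cadj V u) = cadj V (ampl (M i) (V (cadj V u)))"
    using V unfolding isometric_dilation_def by (metis comp_apply)
  hence "cinner h (T i (cadj V u)) = cinner h' (cadj V (V (cadj V u)))"
    by (simp only: cinner_cadj[OF lin_V, symmetric] cinner_cadj'[OF bounded_clinear_ampl[OF lin_M], symmetric] h')
  also have "\<dots> = cinner h (cadj V (ampl (M i) u))"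
    by (simp only: cadj_isometry[OF isometry_V] cinner_cadj[OF lin_V, symmetric]
        cinner_cadj'[OF bounded_clinear_ampl[OF lin_M], symmetric] h')
  finally show "cinner h (cadj V (ampl (M i) u)) = cinner h (T i (cadj V u))" ..
qed

text \<open>\<open>cadj V\<close> carries the homogeneous parts of \<open>f j\<close> at the
  amplified \<open>M\<close> to those at \<open>T\<close>. On elementary tensors the limit is taken
  in the scalar space and pulled through the bounded map sending \<open>\<phi>\<close> to
  \<open>cadj V (tensor \<phi> x)\<close>; Abel sums allow the two series to converge in different
  modes.\<close>

lemma cadj_V_ampl_S: "cadj V (ampl (nc_eval f M j) (tensor \<phi> x)) = A j (cadj V (tensor \<phi> x))"
proof (rule abel_sums_unique)
  note lin = bounded_clinear_compose[OF bounded_clinear_cadj[OF lin_V] bounded_clinear_tensor_left]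
  show "abel_sums (\<lambda>k. cadj V (tensor (hom_part (f j) M k \<phi>) x)) (cadj V (ampl (nc_eval f M j) (tensor \<phi> x)))"
    unfolding ampl_tensor[OF lin_S]
    by (rule abel_sums_bounded_linear[OF bounded_clinear_linear[OF lin] abel_sums_nc_eval[OF M_conv]])
  have word: "cadj V (word_op (\<lambda>i. ampl (M i)) \<alpha> u) = word_op T \<alpha> (cadj V u)" for \<alpha> u
    by (induction \<alpha>) (simp_all add: cadj_V_ampl_M)
  have "cadj V (tensor (hom_part (f j) M k \<phi>) x) = hom_part (f j) T k (cadj V (tensor \<phi> x))" for k
    unfolding ampl_tensor[OF bounded_clinear_hom_part[OF M_op_tuples], symmetric]
      ampl_hom_part[OF M_op_tuples]
    unfolding hom_part_def
    by (simp add: bounded_clinear_sum[OF bounded_clinear_cadj[OF lin_V]]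
        bounded_clinear_scaleC[OF bounded_clinear_cadj[OF lin_V]] word)
  thus "abel_sums (\<lambda>k. cadj V (tensor (hom_part (f j) M k \<phi>) x)) (A j (cadj V (tensor \<phi> x)))"
    by (simp add: abel_sums_nc_eval[OF T_conv])
qed

lemma cadj_V_tensor:
  "cadj V (tensor (basis_elem \<alpha>) x) = word_op A \<alpha> (cadj V (tensor (basis_elem []) x))"
proof (induction \<alpha>)
  case (Cons j \<alpha>)
  have "cadj V (tensor (basis_elem (j # \<alpha>)) x) = cadj V (ampl (nc_eval f M j) (tensor (basis_elem \<alpha>) x))"
    by (simp add: ampl_tensor[OF lin_S] nc_eval_M)
  thus ?case
    by (simp add: cadj_V_ampl_S Cons)
qed simp

text \<open>The dual form of \<open>cadj_V_tensor\<close>: the vacuum coordinate determines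
  \<open>V\<close> altogether.\<close>

lemma coord_V: "coord (V h) \<alpha> = coord (V (cadj (word_op A \<alpha>) h)) []"
proof (rule cinner_eqI)
  fix x
  have "cinner x (coord (V h) \<alpha>) = cinner (cadj V (tensor (basis_elem \<alpha>) x)) h"
    by (simp add: cinner_cadj'[OF lin_V] cinner_tensor_basis_left)
  also have "\<dots> = cinner (cadj V (tensor (basis_elem []) x)) (cadj (word_op A \<alpha>) h)"
    unfolding cadj_V_tensor[of \<alpha>] by (rule cinner_cadj[OF lin_word])
  also have "\<dots> = cinner x (coord (V (cadj (word_op A \<alpha>) h)) [])"
    by (simp add: cinner_cadj'[OF lin_V] cinner_tensor_basis_left)
  finally show "cinner x (coord (V h) \<alpha>) = cinner x (coord (V (cadj (word_op A \<alpha>) h)) [])" .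
qed

text \<open>The coordinates of \<open>V h\<close> at words starting with \<open>j\<close> are those
  of \<open>V (cadj (A j) h)\<close>. As \<open>V\<close> is isometric, splitting its norm by the
  first letter leaves the squared norm of \<open>h\<close> minus those of the
  \<open>cadj (A j) h\<close> for the empty word, which is the formula for the defect.\<close>

lemma norm_coord_V_Nil: "norm (coord (V h) []) = norm (defect h)"
proof -
  have "((\<lambda>\<alpha>. (norm (coord (V h) (j # \<alpha>)))\<^sup>2) has_sum (norm (cadj (A j) h))\<^sup>2) UNIV" for j
  proof -
    have "coord (V h) (j # \<alpha>) = coord (V (cadj (A j) h)) \<alpha>" for \<alpha>
      using coord_V[of h "j # \<alpha>"] coord_V[of "cadj (A j) h" \<alpha>]
      by (simp only: cadj_word_op_Cons[OF op_tuple])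
    moreover have "norm (V (cadj (A j) h)) = norm (cadj (A j) h)"
      using isometry_V by (simp add: isometry_def)
    ultimately show ?thesis
      using norm_ltwo_has_sum[of "V (cadj (A j) h)"] by simp
  qed
  from has_sum_unique[OF norm_ltwo_has_sum has_sum_words_Cons[OF this]]
  have "(norm (V h))\<^sup>2 = (norm (coord (V h) []))\<^sup>2 + (\<Sum>j\<in>UNIV. (norm (cadj (A j) h))\<^sup>2)" .
  moreover have "norm (V h) = norm h"
    using isometry_V by (simp add: isometry_def)
  ultimately have "(norm (coord (V h) []))\<^sup>2 = (norm (defect h))\<^sup>2"
    unfolding norm_defect by simp
  thus ?thesis
    by simp
qed

lemma minimal_dilation_unique:
  assumes min: "minimal_dilation M E V"
  shows "\<exists>W :: ('n list, 'h) ltwo \<Rightarrow> ('n list, 'e) ltwo.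
    unitary_between (tensor_space (defect_space f T)) (tensor_space E) W \<and>
    (\<forall>i. \<forall>u \<in> tensor_space (defect_space f T). W (ampl (M i) u) = ampl (M i) (W u)) \<and>
    W \<circ> K = V"
proof -
  define G where "G h = coord (V h) []" for h
  have G: "bounded_clinear G"
    unfolding G_def[abs_def] by (rule bounded_clinear_compose[OF bounded_clinear_coord lin_V])
  have "csubspace (range G)"
    unfolding csubspace_def
    by (auto simp: bounded_clinear_zero[OF G] simp flip: bounded_clinear_add[OF G]
        bounded_clinear_scaleC[OF G] intro: range_eqI[of _ _ 0])
  hence E': "closed (closure (range G))" "csubspace (closure (range G))"
    by (auto intro: csubspace_closure)
  \<comment> \<open>Minimality enters here: every \<open>V h\<close> has its coordinates in the
    closure of \<open>range G\<close>, amplifications preserve this, so all of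
    \<open>tensor_space E\<close> does. A vector \<open>x\<close> of \<open>E\<close> is then tested
    as the vacuum coordinate.\<close>
  have "closure (range G) = E"
  proof (rule antisym)
    have "V h \<in> tensor_space E" for h
      using V by (auto simp: isometric_dilation_def)
    hence "G h \<in> E" for h
      by (simp add: G_def tensor_space_def)
    thus "closure (range G) \<subseteq> E"
      by (intro closure_minimal E) auto
    have "V h \<in> tensor_space (closure (range G))" for h
    proof -
      have "coord (V h) \<alpha> \<in> closure (range G)" for \<alpha>
        unfolding coord_V[of h \<alpha>] G_def[symmetric] by (rule subsetD[OF closure_subset rangeI])
      thus ?thesis
        by (simp add: tensor_space_def)
    qed
    hence "closed_span (\<Union>\<alpha>. ampl (word_op M \<alpha>) ` range V) \<subseteq> tensor_space (closure (range G))"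
      by (intro closed_span_minimal csubspace_tensor_space closed_tensor_space E')
        (auto intro!: ampl_tensor_space E' bounded_clinear_word_op[OF M_op_tuples])
    hence sub: "(tensor_space E :: ('n list, 'e) ltwo set) \<subseteq> tensor_space (closure (range G))"
      using min by (simp add: minimal_dilation_def)
    show "E \<subseteq> closure (range G)"
    proof
      fix x assume "x \<in> E"
      from subsetD[OF sub tensor_in_tensor_space[OF E(2) this, of "basis_elem []"]]
      show "x \<in> closure (range G)"
        unfolding tensor_space_def by (auto dest: spec[of _ "[]"])
    qed
  qed
  have "norm (defect h) = norm (G h)" for h
    by (simp add: G_def norm_coord_V_Nil)
  from isometric_extension[OF lin_defect G this, folded defect_space_eq]
  obtain U where U: "\<And>h. U (defect h) = G h"
    "\<And>x y. x \<in> defect_space f T \<Longrightarrow> y \<in> defect_space f T \<Longrightarrow> U (x + y) = U x + U y"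
    "\<And>c x. x \<in> defect_space f T \<Longrightarrow> U (c *\<^sub>C x) = c *\<^sub>C U x"
    "\<And>x. x \<in> defect_space f T \<Longrightarrow> norm (U x) = norm x"
    "U ` defect_space f T = closure (range G)"
    by blast
  obtain W :: "('n list, 'h) ltwo \<Rightarrow> ('n list, 'e) ltwo"
    where W: "unitary_between (tensor_space (defect_space f T)) (tensor_space E) W"
      "\<And>u \<alpha>. u \<in> tensor_space (defect_space f T) \<Longrightarrow> coord (W u) \<alpha> = U (coord u \<alpha>)"
      "\<And>A u. bounded_clinear A \<Longrightarrow> u \<in> tensor_space (defect_space f T) \<Longrightarrow> W (ampl A u) = ampl A (W u)"
    using unitary_between_tensor_space[OF closed_defect_space csubspace_defect_space U(2-5)]
    unfolding \<open>closure (range G) = E\<close> by blast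
  \<comment> \<open>At the coordinate \<open>\<alpha>\<close> this is
    \<open>U (defect k) = G k\<close> for \<open>k = cadj (word_op A \<alpha>) h\<close>.\<close>
  have "W (K h) = V h" for h
    by (rule ltwo_eqI) (simp add: W(2) K_in_tensor_space coord_K U coord_V[of h] G_def)
  thus ?thesis
    using W(1) W(3)[OF lin_M] by (intro exI[of _ W]) (auto simp: comp_def)
qed

end

end

section \<open>Noncommutative power series\<close>

lemma nc_mult_assoc: "nc_mult (nc_mult p q) r = nc_mult p (nc_mult q r)"
proof
  fix \<alpha>
  have "nc_mult (nc_mult p q) r \<alpha> =
      (\<Sum>(k, l)\<in>Sigma {..length \<alpha>} (\<lambda>k. {..k}). p (take l \<alpha>) * q (take (k - l) (drop l \<alpha>)) * r (drop k \<alpha>))"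
    unfolding nc_mult_def sum_distrib_right
    by (subst sum.Sigma[symmetric]) (auto intro!: sum.cong simp: min_def drop_take)
  also have "\<dots> = (\<Sum>(l, m)\<in>Sigma {..length \<alpha>} (\<lambda>l. {..length \<alpha> - l}).
      p (take l \<alpha>) * (q (take m (drop l \<alpha>)) * r (drop m (drop l \<alpha>))))"
    by (rule sum.reindex_bij_witness[where i = "\<lambda>(l, m). (l + m, l)" and j = "\<lambda>(k, l). (l, k - l)"])
      (auto simp: add.commute)
  also have "\<dots> = nc_mult p (nc_mult q r) \<alpha>"
    unfolding nc_mult_def sum_distrib_left
    by (subst sum.Sigma[symmetric]) auto
  finally show "nc_mult (nc_mult p q) r \<alpha> = nc_mult p (nc_mult q r) \<alpha>" .
qed

lemma nc_mult_one_left [simp]: "nc_mult nc_one p = p"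
proof
  fix \<alpha>
  have "nc_mult nc_one p \<alpha> = (\<Sum>k\<in>{0::nat}. p \<alpha>)"
    unfolding nc_mult_def by (rule sum.mono_neutral_cong_right) (auto simp: nc_one_def)
  thus "nc_mult nc_one p \<alpha> = p \<alpha>"
    by simp
qed

lemma nc_word_append: "nc_word f (\<alpha> @ \<beta>) = nc_mult (nc_word f \<alpha>) (nc_word f \<beta>)"
  by (induction \<alpha>) (simp_all add: nc_mult_assoc)

lemma has_sum_sum:
  fixes F :: "'k \<Rightarrow> 'i \<Rightarrow> 'b::real_normed_vector"
  assumes "\<And>k. k \<in> K \<Longrightarrow> (F k has_sum s k) A"
  shows "((\<lambda>i. \<Sum>k\<in>K. F k i) has_sum (\<Sum>k\<in>K. s k)) A"
  using assms by (induction K rule: infinite_finite_induct) (auto intro: has_sum_add)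

lemma nc_word_var: "nc_word nc_var \<alpha> = coord (basis_elem \<alpha>)"
proof (induction \<alpha>)
  case Nil
  show ?case
    by (auto simp: nc_one_def)
next
  case (Cons i \<alpha>)
  show ?case
  proof
    fix \<gamma>
    show "nc_word nc_var (i # \<alpha>) \<gamma> = coord (basis_elem (i # \<alpha>)) \<gamma>"
    proof (cases "\<gamma> \<in> range (\<lambda>\<beta>. \<beta> @ \<alpha>)")
      case True
      then obtain \<beta> where "\<gamma> = \<beta> @ \<alpha>"
        by blast
      thus ?thesis
        unfolding nc_word.simps Cons using append_same_eq[of \<beta> \<alpha> "[i]"]
        by (simp only: nc_mult_basis_append coord_basis_elem) (simp add: nc_var_def)
    next
      case False
      hence "\<gamma> \<noteq> i # \<alpha>"
        using range_eqI[of "i # \<alpha>" "\<lambda>\<beta>. \<beta> @ \<alpha>" "[i]"] by auto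
      thus ?thesis
        unfolding nc_word.simps Cons nc_mult_basis_eq_0[OF False] by simp
    qed
  qed
qed

text \<open>A divergent \<open>infsum\<close> is \<open>0\<close>, so \<^const>\<open>nc_comp\<close> is meaningful for composable arguments only.\<close>

definition composable :: "'n nc_series \<Rightarrow> ('n \<Rightarrow> 'n nc_series) \<Rightarrow> bool" where
  "composable a f \<longleftrightarrow> (\<forall>\<beta>. (\<lambda>\<alpha>. a \<alpha> * nc_word f \<alpha> \<beta>) summable_on UNIV)"

lemma nc_comp_has_sum:
  "composable a f \<Longrightarrow> ((\<lambda>\<alpha>. a \<alpha> * nc_word f \<alpha> \<beta>) has_sum nc_comp a f \<beta>) UNIV"
  by (simp add: composable_def nc_comp_def)

lemma nc_comp_basis: "nc_comp (coord (basis_elem \<beta>)) f = nc_word f \<beta>"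
proof
  fix \<delta>
  have "((\<lambda>\<alpha>. coord (basis_elem \<beta>) \<alpha> * nc_word f \<alpha> \<delta>) has_sum nc_word f \<beta> \<delta>) UNIV"
    by (rule has_sum_finite_neutralI[of "{\<beta>}"]) auto
  thus "nc_comp (coord (basis_elem \<beta>)) f \<delta> = nc_word f \<beta> \<delta>"
    unfolding nc_comp_def by (rule infsumI)
qed

text \<open>Composition is multiplicative when the right factor is a single word: each coefficient
  of a product is a finite sum over splittings of \<open>\<delta>\<close>, which commutes with the
  infinite sum over \<open>\<alpha>\<close>. This covers series \<open>g i\<close> with infinitely
  many terms.\<close>

lemma has_sum_nc_mult_basis:
  assumes "composable p f"
  shows "((\<lambda>\<gamma>. nc_mult p (coord (basis_elem \<beta>)) \<gamma> * nc_word f \<gamma> \<delta>) has_sum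
    nc_mult (nc_comp p f) (nc_word f \<beta>) \<delta>) UNIV"
proof -
  have "((\<lambda>\<alpha>. \<Sum>k\<le>length \<delta>. p \<alpha> * nc_word f \<alpha> (take k \<delta>) * nc_word f \<beta> (drop k \<delta>)) has_sum
      nc_mult (nc_comp p f) (nc_word f \<beta>) \<delta>) UNIV"
    unfolding nc_mult_def
    by (intro has_sum_sum has_sum_cmult_left nc_comp_has_sum[OF assms])
  hence "((\<lambda>\<alpha>. nc_mult p (coord (basis_elem \<beta>)) (\<alpha> @ \<beta>) * nc_word f (\<alpha> @ \<beta>) \<delta>) has_sum
      nc_mult (nc_comp p f) (nc_word f \<beta>) \<delta>) UNIV"
    unfolding nc_mult_basis_append nc_word_append
    by (simp add: nc_mult_def[of "nc_word f _"] sum_distrib_left mult.assoc)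
  hence "((\<lambda>\<gamma>. nc_mult p (coord (basis_elem \<beta>)) \<gamma> * nc_word f \<gamma> \<delta>) has_sum
      nc_mult (nc_comp p f) (nc_word f \<beta>) \<delta>) (range (\<lambda>\<alpha>. \<alpha> @ \<beta>))"
    by (subst has_sum_reindex) (auto simp: inj_on_def comp_def)
  thus ?thesis
    by (rule iffD1[OF has_sum_cong_neutral, rotated -1]) (auto simp: nc_mult_basis_eq_0)
qed

lemma nc_comp_mult_basis:
  assumes "composable p f"
  shows "nc_comp (nc_mult p (coord (basis_elem \<beta>))) f = nc_mult (nc_comp p f) (nc_word f \<beta>)"
  unfolding nc_comp_def[of "nc_mult p (coord (basis_elem \<beta>))"]
  by (rule ext) (rule infsumI[OF has_sum_nc_mult_basis[OF assms]])

lemma nc_comp_diff: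
  assumes "composable a f" "composable b f"
  shows "nc_comp (\<lambda>\<alpha>. a \<alpha> - b \<alpha>) f \<beta> = nc_comp a f \<beta> - nc_comp b f \<beta>"
  unfolding nc_comp_def[of "\<lambda>\<alpha>. a \<alpha> - b \<alpha>"]
  using has_sum_diff[OF nc_comp_has_sum[OF assms(1)] nc_comp_has_sum[OF assms(2)]]
  by (intro infsumI) (simp add: left_diff_distrib)

subsection \<open>Series without constant term\<close>

text \<open>Each factor without constant term consumes at least one letter of
  \<open>\<beta>\<close>.\<close>

lemma nc_word_eq_0:
  assumes "\<forall>j. f j [] = 0" "length \<beta> < length \<alpha>"
  shows "nc_word f \<alpha> \<beta> = 0"
  using assms(2)
proof (induction \<alpha> arbitrary: \<beta>)
  case (Cons i \<alpha>)
  show ?case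
    unfolding nc_word.simps nc_mult_def
  proof (intro sum.neutral ballI)
    fix k assume k: "k \<in> {..length \<beta>}"
    show "f i (take k \<beta>) * nc_word f \<alpha> (drop k \<beta>) = 0"
    proof (cases k)
      case 0
      thus ?thesis
        by (simp add: assms(1))
    next
      case (Suc m)
      hence "nc_word f \<alpha> (drop k \<beta>) = 0"
        using Cons.prems k by (intro Cons.IH) auto
      thus ?thesis
        by simp
    qed
  qed
qed simp

text \<open>Only the splitting after one letter survives: giving \<open>f i\<close> no letter meets
  its zero constant term, and giving it two or more leaves too few letters for
  \<open>\<alpha>\<close>.\<close>

lemma nc_word_Cons_Cons:
  assumes "\<forall>j. f j [] = 0" "length \<beta> \<le> length \<alpha>"
  shows "nc_word f (i # \<alpha>) (j # \<beta>) = f i [j] * nc_word f \<alpha> \<beta>"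
proof -
  have "nc_word f (i # \<alpha>) (j # \<beta>) = (\<Sum>k\<in>{1::nat}. f i [j] * nc_word f \<alpha> \<beta>)"
    unfolding nc_word.simps nc_mult_def
  proof (rule sum.mono_neutral_cong_right)
    show "\<forall>k\<in>{..length (j # \<beta>)} - {1}. f i (take k (j # \<beta>)) * nc_word f \<alpha> (drop k (j # \<beta>)) = 0"
    proof
      fix k assume k: "k \<in> {..length (j # \<beta>)} - {1}"
      show "f i (take k (j # \<beta>)) * nc_word f \<alpha> (drop k (j # \<beta>)) = 0"
      proof (cases "k = 0")
        case True
        thus ?thesis
          by (simp add: assms(1))
      next
        case False
        hence "nc_word f \<alpha> (drop k (j # \<beta>)) = 0"
          using k assms(2) by (intro nc_word_eq_0 assms(1)) auto
        thus ?thesis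
          by simp
      qed
    qed
  qed auto
  thus ?thesis
    by simp
qed

lemma composable_no_constant:
  fixes f :: "'n::finite \<Rightarrow> 'n nc_series"
  assumes "\<forall>j. f j [] = 0"
  shows "composable a f"
  unfolding composable_def
proof (intro allI finite_nonzero_values_imp_summable_on)
  fix \<beta> :: "'n list"
  have "a \<alpha> * nc_word f \<alpha> \<beta> = 0" if "length \<beta> < length \<alpha>" for \<alpha>
    by (simp add: nc_word_eq_0[of f, OF assms that])
  hence "{\<alpha> \<in> UNIV. a \<alpha> * nc_word f \<alpha> \<beta> \<noteq> 0} \<subseteq> {\<alpha>. length \<alpha> \<le> length \<beta>}"
    using not_le by blast
  thus "finite {\<alpha> \<in> UNIV. a \<alpha> * nc_word f \<alpha> \<beta> \<noteq> 0}"
    by (rule finite_subset) simp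
qed

text \<open>The leading part of \<open>nc_comp d f\<close> is obtained from that of \<open>d\<close> by a tensor power of the
  Jacobian; inverting one tensor factor at a time shows that it does not vanish.\<close>

lemma leading_part_eq_0:
  fixes f :: "'n::finite \<Rightarrow> 'n nc_series"
  assumes f0: "\<forall>j. f j [] = 0" and J: "det (jacobian_0 f) \<noteq> 0"
    and "\<And>\<beta>. length \<beta> = k \<Longrightarrow> (\<Sum>\<alpha> | length \<alpha> = k. d \<alpha> * nc_word f \<alpha> \<beta>) = 0" and "length \<alpha> = k"
  shows "d \<alpha> = 0"
  using assms(3,4)
proof (induction k arbitrary: d \<alpha>)
  case 0
  thus ?case
    using 0(1)[of "[]"] by (simp add: nc_one_def)
next
  case (Suc k)
  obtain J' where "jacobian_0 f ** J' = mat 1"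
    using J unfolding invertible_det_nz[symmetric] invertible_def by blast
  hence J': "(\<Sum>j\<in>UNIV. f i [j] * J' $ j $ l) = (if i = l then 1 else 0)" for i l
    by (simp add: matrix_matrix_mult_def jacobian_0_def mat_def vec_eq_iff)
  \<comment> \<open>For fixed \<open>j\<close>, contracting the first letter of \<open>d\<close>
    with the Jacobian yields a family of degree \<open>k\<close> that satisfies the same hypothesis,
    so the induction hypothesis annihilates it. Contraction with \<open>J'\<close> then recovers
    \<open>d\<close>.\<close>
  have 1: "(\<Sum>i\<in>UNIV. d (i # \<alpha>) * f i [j]) = 0" if \<alpha>: "length \<alpha> = k" for j \<alpha>
  proof (rule Suc.IH[OF _ \<alpha>])
    fix \<beta> :: "'n list" assume \<beta>: "length \<beta> = k"
    have "(\<Sum>\<alpha> | length \<alpha> = k. (\<Sum>i\<in>UNIV. d (i # \<alpha>) * f i [j]) * nc_word f \<alpha> \<beta>) =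
        (\<Sum>i\<in>UNIV. \<Sum>\<alpha> | length \<alpha> = k. d (i # \<alpha>) * f i [j] * nc_word f \<alpha> \<beta>)"
      unfolding sum_distrib_right by (rule sum.swap)
    also have "\<dots> = (\<Sum>\<alpha> | length \<alpha> = Suc k. d \<alpha> * nc_word f \<alpha> (j # \<beta>))"
      unfolding sum_words_Cons
      by (intro sum.cong refl) (simp add: nc_word_Cons_Cons[of f, OF f0] \<beta> mult.assoc del: nc_word.simps)
    also have "\<dots> = 0"
      by (rule Suc.prems(1)) (simp add: \<beta>)
    finally show "(\<Sum>\<alpha> | length \<alpha> = k. (\<Sum>i\<in>UNIV. d (i # \<alpha>) * f i [j]) * nc_word f \<alpha> \<beta>) = 0" .
  qed
  obtain l \<alpha>' where \<alpha>: "\<alpha> = l # \<alpha>'" "length \<alpha>' = k"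
    using Suc.prems(2) by (auto simp: length_Suc_conv)
  have "d (l # \<alpha>') = (\<Sum>i\<in>UNIV. d (i # \<alpha>') * (if i = l then 1 else 0))"
    by (simp add: if_distrib cong: if_cong)
  also have "\<dots> = (\<Sum>i\<in>UNIV. \<Sum>j\<in>UNIV. d (i # \<alpha>') * f i [j] * J' $ j $ l)"
    unfolding J'[symmetric] sum_distrib_left by (simp add: mult.assoc)
  also have "\<dots> = (\<Sum>j\<in>UNIV. (\<Sum>i\<in>UNIV. d (i # \<alpha>') * f i [j]) * J' $ j $ l)"
    unfolding sum_distrib_right by (rule sum.swap)
  finally show ?case
    by (simp add: \<alpha> 1)
qed

text \<open>Composition is triangular with respect to degree: once the shorter coefficients of the
  difference vanish, its coefficients of length \<open>k\<close> alone contribute to degree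
  \<open>k\<close> of the composite, since longer words start in higher degree.\<close>

lemma nc_comp_inj:
  fixes f :: "'n::finite \<Rightarrow> 'n nc_series"
  assumes f0: "\<forall>j. f j [] = 0" and J: "det (jacobian_0 f) \<noteq> 0" and eq: "nc_comp a f = nc_comp b f"
  shows "a = b"
proof (rule ext)
  define d where "d \<alpha> = a \<alpha> - b \<alpha>" for \<alpha>
  have d: "nc_comp d f \<beta> = 0" for \<beta>
    unfolding d_def[abs_def] using nc_comp_diff[OF composable_no_constant[of f, OF f0] composable_no_constant[of f, OF f0], of a b] eq
    by simp
  have "d \<alpha> = 0" for \<alpha>
  proof (induction "length \<alpha>" arbitrary: \<alpha> rule: less_induct)
    case less
    show ?case
    proof (rule leading_part_eq_0[of f, OF f0 J _ refl])
      fix \<beta> :: "'n list" assume \<beta>: "length \<beta> = length \<alpha>"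
      have "((\<lambda>\<alpha>. d \<alpha> * nc_word f \<alpha> \<beta>) has_sum (\<Sum>\<alpha>' | length \<alpha>' = length \<alpha>. d \<alpha>' * nc_word f \<alpha>' \<beta>)) UNIV"
      proof (rule has_sum_finite_neutralI)
        fix \<gamma> :: "'n list" assume "\<gamma> \<in> UNIV - {\<alpha>'. length \<alpha>' = length \<alpha>}"
        hence "length \<gamma> < length \<alpha> \<or> length \<beta> < length \<gamma>"
          using \<beta> by auto
        thus "d \<gamma> * nc_word f \<gamma> \<beta> = 0"
          using less nc_word_eq_0[of f \<beta> \<gamma>, OF f0] by auto
      qed auto
      hence "nc_comp d f \<beta> = (\<Sum>\<alpha>' | length \<alpha>' = length \<alpha>. d \<alpha>' * nc_word f \<alpha>' \<beta>)"
        unfolding nc_comp_def by (rule infsumI)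
      thus "(\<Sum>\<alpha>' | length \<alpha>' = length \<alpha>. d \<alpha>' * nc_word f \<alpha>' \<beta>) = 0"
        by (simp add: d)
    qed
  qed
  thus "a \<alpha> = b \<alpha>" for \<alpha>
    by (simp add: d_def)
qed

lemma universal_model_series:
  assumes "series_model f g M"
  shows "universal_model f g M"
proof -
  have f0: "\<forall>j. f j [] = 0" and J: "det (jacobian_0 f) \<noteq> 0" and g: "nc_comp (g i) f = nc_var i"
    and M: "series_left_mult f (nc_var i) (M i)" and conv: "M \<in> conv_sot f \<union> conv_rad f"
    and S: "series_left_mult f (f j) (nc_eval f M j)" for i j
    using assms by (simp_all add: series_model_def)
  note inj = nc_comp_inj[of f, OF f0 J]
  show ?thesis
  proof
    show "M \<in> op_tuples"
      by (rule conv_op_tuples[OF conv])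
    show "coord (M i (basis_elem \<beta>)) = nc_mult (g i) (coord (basis_elem \<beta>))" for i \<beta>
    proof (rule inj)
      have "nc_comp (coord (M i (basis_elem \<beta>))) f = nc_mult (nc_var i) (nc_word f \<beta>)"
        using M unfolding series_left_mult_def by (simp add: nc_comp_basis)
      thus "nc_comp (coord (M i (basis_elem \<beta>))) f = nc_comp (nc_mult (g i) (coord (basis_elem \<beta>))) f"
        by (simp add: nc_comp_mult_basis[OF composable_no_constant[of f, OF f0]] g)
    qed
    show "nc_eval f M j (basis_elem \<beta>) = basis_elem (j # \<beta>)" for j \<beta>
    proof (rule iffD1[OF coord_inject], rule inj)
      show "nc_comp (coord (nc_eval f M j (basis_elem \<beta>))) f = nc_comp (coord (basis_elem (j # \<beta>))) f"
        using S unfolding series_left_mult_def by (simp add: nc_comp_basis)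
    qed
  qed (rule conv)
qed

subsection \<open>Polynomials\<close>

lemma composable_polynomial:
  assumes "nc_polynomial a"
  shows "composable a f"
  unfolding composable_def
proof (intro allI finite_nonzero_values_imp_summable_on)
  fix \<beta>
  have "{\<alpha> \<in> UNIV. a \<alpha> * nc_word f \<alpha> \<beta> \<noteq> 0} \<subseteq> {\<alpha>. a \<alpha> \<noteq> 0}"
    by auto
  thus "finite {\<alpha> \<in> UNIV. a \<alpha> * nc_word f \<alpha> \<beta> \<noteq> 0}"
    using assms unfolding nc_polynomial_def by (rule finite_subset)
qed

lemma nc_comp_polynomial:
  assumes "finite F" "\<And>\<alpha>. \<alpha> \<notin> F \<Longrightarrow> a \<alpha> = 0"
  shows "nc_comp a f \<beta> = (\<Sum>\<alpha>\<in>F. a \<alpha> * nc_word f \<alpha> \<beta>)"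
proof -
  have "((\<lambda>\<alpha>. a \<alpha> * nc_word f \<alpha> \<beta>) has_sum (\<Sum>\<alpha>\<in>F. a \<alpha> * nc_word f \<alpha> \<beta>)) UNIV"
    using assms by (intro has_sum_finite_neutralI[of F]) auto
  thus ?thesis
    unfolding nc_comp_def by (rule infsumI)
qed

lemma nc_polynomial_mult:
  assumes "nc_polynomial p" "nc_polynomial q"
  shows "nc_polynomial (nc_mult p q)"
  unfolding nc_polynomial_def
proof (rule finite_subset)
  show "{\<alpha>. nc_mult p q \<alpha> \<noteq> 0} \<subseteq> (\<lambda>(\<alpha>, \<beta>). \<alpha> @ \<beta>) ` ({\<alpha>. p \<alpha> \<noteq> 0} \<times> {\<alpha>. q \<alpha> \<noteq> 0})"
  proof
    fix \<alpha> assume "\<alpha> \<in> {\<alpha>. nc_mult p q \<alpha> \<noteq> 0}"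
    hence "(\<Sum>k\<le>length \<alpha>. p (take k \<alpha>) * q (drop k \<alpha>)) \<noteq> 0"
      by (simp add: nc_mult_def)
    then obtain k where "p (take k \<alpha>) * q (drop k \<alpha>) \<noteq> 0"
      by (rule sum.not_neutral_contains_not_neutral)
    thus "\<alpha> \<in> (\<lambda>(\<alpha>, \<beta>). \<alpha> @ \<beta>) ` ({\<alpha>. p \<alpha> \<noteq> 0} \<times> {\<alpha>. q \<alpha> \<noteq> 0})"
      by (intro image_eqI[of _ _ "(take k \<alpha>, drop k \<alpha>)"]) auto
  qed
  show "finite ((\<lambda>(\<alpha>, \<beta>). \<alpha> @ \<beta>) ` ({\<alpha>. p \<alpha> \<noteq> 0} \<times> {\<alpha>. q \<alpha> \<noteq> 0}))"
    using assms by (simp add: nc_polynomial_def)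
qed

lemma nc_polynomial_basis: "nc_polynomial (coord (basis_elem \<beta>))"
  unfolding nc_polynomial_def by (rule finite_subset[of _ "{\<beta>}"]) auto

lemma nc_polynomial_word: "(\<And>i. nc_polynomial (f i)) \<Longrightarrow> nc_polynomial (nc_word f \<alpha>)"
proof (induction \<alpha>)
  case Nil
  show ?case
    unfolding nc_polynomial_def by (rule finite_subset[of _ "{[]}"]) (auto simp: nc_one_def)
qed (simp add: nc_polynomial_mult)

lemma nc_polynomial_sum:
  assumes "finite F" "\<And>k. k \<in> F \<Longrightarrow> nc_polynomial (p k)"
  shows "nc_polynomial (\<lambda>\<alpha>. \<Sum>k\<in>F. c k * p k \<alpha>)"
  unfolding nc_polynomial_def
proof (rule finite_subset)
  show "{\<alpha>. (\<Sum>k\<in>F. c k * p k \<alpha>) \<noteq> 0} \<subseteq> (\<Union>k\<in>F. {\<alpha>. p k \<alpha> \<noteq> 0})"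
  proof
    fix \<alpha> assume "\<alpha> \<in> {\<alpha>. (\<Sum>k\<in>F. c k * p k \<alpha>) \<noteq> 0}"
    hence "(\<Sum>k\<in>F. c k * p k \<alpha>) \<noteq> 0"
      by simp
    then obtain k where "k \<in> F" "c k * p k \<alpha> \<noteq> 0"
      by (rule sum.not_neutral_contains_not_neutral)
    thus "\<alpha> \<in> (\<Union>k\<in>F. {\<alpha>. p k \<alpha> \<noteq> 0})"
      by auto
  qed
  show "finite (\<Union>k\<in>F. {\<alpha>. p k \<alpha> \<noteq> 0})"
    using assms by (auto simp: nc_polynomial_def)
qed

lemma nc_comp_sum:
  assumes "\<And>k. k \<in> F \<Longrightarrow> composable (p k) f"
  shows "nc_comp (\<lambda>\<alpha>. \<Sum>k\<in>F. c k * p k \<alpha>) f \<beta> = (\<Sum>k\<in>F. c k * nc_comp (p k) f \<beta>)"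
proof -
  have "((\<lambda>\<alpha>. \<Sum>k\<in>F. c k * (p k \<alpha> * nc_word f \<alpha> \<beta>)) has_sum (\<Sum>k\<in>F. c k * nc_comp (p k) f \<beta>)) UNIV"
    by (intro has_sum_sum has_sum_cmult_right nc_comp_has_sum assms)
  thus ?thesis
    unfolding nc_comp_def[of "\<lambda>\<alpha>. \<Sum>k\<in>F. c k * p k \<alpha>"]
    by (intro infsumI) (simp add: sum_distrib_right mult.assoc)
qed

lemma polynomial_expansion:
  assumes "nc_polynomial q"
  shows "q = (\<lambda>\<alpha>. \<Sum>\<beta> | q \<beta> \<noteq> 0. q \<beta> * coord (basis_elem \<beta>) \<alpha>)"
proof
  fix \<alpha>
  have "(\<Sum>\<beta> | q \<beta> \<noteq> 0. q \<beta> * coord (basis_elem \<beta>) \<alpha>) = (\<Sum>\<beta> | q \<beta> \<noteq> 0. if \<beta> = \<alpha> then q \<alpha> else 0)"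
    by (rule sum.cong) auto
  also have "\<dots> = q \<alpha>"
    using assms by (simp add: nc_polynomial_def)
  finally show "q \<alpha> = (\<Sum>\<beta> | q \<beta> \<noteq> 0. q \<beta> * coord (basis_elem \<beta>) \<alpha>)" ..
qed

lemma nc_mult_sum_right: "nc_mult p (\<lambda>\<alpha>. \<Sum>k\<in>F. c k * q k \<alpha>) \<beta> = (\<Sum>k\<in>F. c k * nc_mult p (q k) \<beta>)"
  unfolding nc_mult_def sum_distrib_left by (subst sum.swap) (simp add: mult.left_commute)

lemma nc_comp_mult:
  assumes p: "nc_polynomial p" and q: "nc_polynomial q"
  shows "nc_comp (nc_mult p q) f = nc_mult (nc_comp p f) (nc_comp q f)"
proof
  fix \<delta>
  let ?F = "{\<beta>. q \<beta> \<noteq> 0}"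
  have "nc_mult p q = (\<lambda>\<alpha>. \<Sum>\<beta>\<in>?F. q \<beta> * nc_mult p (coord (basis_elem \<beta>)) \<alpha>)"
    by (subst polynomial_expansion[OF q]) (rule ext, rule nc_mult_sum_right)
  hence "nc_comp (nc_mult p q) f \<delta> = (\<Sum>\<beta>\<in>?F. q \<beta> * nc_comp (nc_mult p (coord (basis_elem \<beta>))) f \<delta>)"
    by (simp only:) (intro nc_comp_sum composable_polynomial nc_polynomial_mult p nc_polynomial_basis)
  also have "\<dots> = (\<Sum>\<beta>\<in>?F. q \<beta> * nc_mult (nc_comp p f) (nc_word f \<beta>) \<delta>)"
    by (simp only: nc_comp_mult_basis[OF composable_polynomial[OF p]])
  also have "\<dots> = nc_mult (nc_comp p f) (\<lambda>\<gamma>. \<Sum>\<beta>\<in>?F. q \<beta> * nc_word f \<beta> \<gamma>) \<delta>"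
    by (rule nc_mult_sum_right[symmetric])
  also have "(\<lambda>\<gamma>. \<Sum>\<beta>\<in>?F. q \<beta> * nc_word f \<beta> \<gamma>) = nc_comp q f"
    using q by (intro ext nc_comp_polynomial[symmetric]) (auto simp: nc_polynomial_def)
  finally show "nc_comp (nc_mult p q) f \<delta> = nc_mult (nc_comp p f) (nc_comp q f) \<delta>" .
qed

lemma nc_comp_word:
  fixes f g :: "'n \<Rightarrow> 'n nc_series"
  assumes "\<And>i. nc_polynomial (f i)"
  shows "nc_comp (nc_word f \<alpha>) g = nc_word (\<lambda>i. nc_comp (f i) g) \<alpha>"
proof (induction \<alpha>)
  case Nil
  have "coord (basis_elem ([] :: 'n list)) = nc_one"
    by (auto simp: nc_one_def)
  thus ?case
    using nc_comp_basis[of "[]" g] by (simp only: nc_word.simps)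
qed (simp add: nc_comp_mult assms nc_polynomial_word)

lemma nc_comp_inj_polynomial:
  assumes f: "\<And>i. nc_polynomial (f i)" and fg: "\<And>i. nc_comp (f i) g = nc_var i"
    and a: "nc_polynomial a" and b: "nc_polynomial b" and eq: "nc_comp a f = nc_comp b f"
  shows "a = b"
proof -
  have inv: "nc_comp (nc_comp a f) g = a" if a: "nc_polynomial a" for a
  proof
    fix \<delta>
    have "nc_comp a f = (\<lambda>\<beta>. \<Sum>\<alpha> | a \<alpha> \<noteq> 0. a \<alpha> * nc_word f \<alpha> \<beta>)"
      using a by (intro ext nc_comp_polynomial) (auto simp: nc_polynomial_def)
    hence "nc_comp (nc_comp a f) g \<delta> = (\<Sum>\<alpha> | a \<alpha> \<noteq> 0. a \<alpha> * nc_comp (nc_word f \<alpha>) g \<delta>)"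
      by (simp only:) (intro nc_comp_sum composable_polynomial nc_polynomial_word f)
    also have "\<dots> = (\<Sum>\<alpha> | a \<alpha> \<noteq> 0. a \<alpha> * coord (basis_elem \<alpha>) \<delta>)"
      unfolding nc_comp_word[of f, OF f] fg nc_word_var ..
    also have "\<dots> = a \<delta>"
      using polynomial_expansion[OF a] by metis
    finally show "nc_comp (nc_comp a f) g \<delta> = a \<delta>" .
  qed
  show ?thesis
    using inv[OF a] inv[OF b] eq by metis
qed

lemma hom_part_finite:
  assumes F: "finite F" "\<And>\<alpha>. \<alpha> \<notin> F \<Longrightarrow> c \<alpha> = 0"
  shows "(\<lambda>k. hom_part c X k h) sums (\<Sum>\<alpha>\<in>F. c \<alpha> *\<^sub>C word_op X \<alpha> h)"
  unfolding hom_part_def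
  using F by (intro has_sum_words_imp_sums has_sum_finite_neutralI[of F]) auto

text \<open>Unlike the other two cases, this one does not assume that \<open>f j\<close> can be
  evaluated at \<open>M\<close> or that the value is left multiplication by \<open>f j\<close>. Both
  are derived, the series being finite sums.\<close>

lemma universal_model_polynomial:
  assumes "poly_model f g M"
  shows "universal_model f g M"
proof -
  have f: "nc_polynomial (f i)" and g: "nc_polynomial (g i)"
    and fg: "nc_comp (f i) g = nc_var i" and gf: "nc_comp (g i) f = nc_var i"
    and lin: "bounded_clinear (M i)"
    and Mp: "nc_polynomial (coord b) \<Longrightarrow> nc_polynomial (coord (M i b))"
    and M: "nc_polynomial (coord b) \<Longrightarrow>
      nc_comp (coord (M i b)) f = nc_mult (nc_var i) (nc_comp (coord b) f)" for i b
    using assms by (simp_all add: poly_model_def)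
  have Mt: "M \<in> op_tuples"
    by (simp add: op_tuples_def lin)
  note inj = nc_comp_inj_polynomial[of f g, OF f fg]
  have "sot_sums (hom_part (f j) M) (\<lambda>h. \<Sum>\<alpha> | f j \<alpha> \<noteq> 0. f j \<alpha> *\<^sub>C word_op M \<alpha> h)" for j
    unfolding sot_sums_def
  proof (intro conjI allI)
    show "bounded_clinear (\<lambda>h. \<Sum>\<alpha> | f j \<alpha> \<noteq> 0. f j \<alpha> *\<^sub>C word_op M \<alpha> h)"
      by (intro bounded_clinear_sums bounded_clinear_cmult bounded_clinear_word_op Mt)
    show "(\<lambda>k. hom_part (f j) M k h) sums (\<Sum>\<alpha> | f j \<alpha> \<noteq> 0. f j \<alpha> *\<^sub>C word_op M \<alpha> h)" for h
      using f by (intro hom_part_finite) (auto simp: nc_polynomial_def)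
  qed
  hence conv: "M \<in> conv_sot f"
    using Mt by (auto simp: conv_sot_def)
  \<comment> \<open>The finite sum is one strong limit; uniqueness of Abel sums shows it to be the
    one chosen by \<open>nc_eval\<close>.\<close>
  have S: "nc_eval f M j h = (\<Sum>\<alpha> | f j \<alpha> \<noteq> 0. f j \<alpha> *\<^sub>C word_op M \<alpha> h)" for j h
  proof (rule abel_sums_unique)
    show "abel_sums (\<lambda>k. hom_part (f j) M k h) (nc_eval f M j h)"
      using conv by (intro abel_sums_nc_eval) simp
    show "abel_sums (\<lambda>k. hom_part (f j) M k h) (\<Sum>\<alpha> | f j \<alpha> \<noteq> 0. f j \<alpha> *\<^sub>C word_op M \<alpha> h)"
      using f by (intro sums_imp_abel_sums hom_part_finite) (auto simp: nc_polynomial_def)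
  qed
  \<comment> \<open>Polynomiality is carried along because the defining relation of
    \<open>M i\<close> is available only at polynomials.\<close>
  have word: "nc_polynomial (coord (word_op M \<alpha> (basis_elem \<beta>)))"
    "nc_comp (coord (word_op M \<alpha> (basis_elem \<beta>))) f = nc_mult (coord (basis_elem \<alpha>)) (nc_word f \<beta>)" for \<alpha> \<beta>
  proof (induction \<alpha>)
    case Nil
    have one: "coord (basis_elem []) = nc_one"
      by (auto simp: nc_one_def)
    show "nc_polynomial (coord (word_op M [] (basis_elem \<beta>)))"
      by (simp add: nc_polynomial_basis del: coord_basis_elem)
    show "nc_comp (coord (word_op M [] (basis_elem \<beta>))) f = nc_mult (coord (basis_elem [])) (nc_word f \<beta>)"
      unfolding one by (simp add: nc_comp_basis)
  next
    case (Cons i \<alpha>)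
    show "nc_polynomial (coord (word_op M (i # \<alpha>) (basis_elem \<beta>)))"
      using Mp[OF Cons(1)] by simp
    have "nc_comp (coord (word_op M (i # \<alpha>) (basis_elem \<beta>))) f =
        nc_mult (nc_mult (nc_var i) (coord (basis_elem \<alpha>))) (nc_word f \<beta>)"
      using M[OF Cons(1)] by (simp add: Cons(2) nc_mult_assoc del: coord_basis_elem)
    thus "nc_comp (coord (word_op M (i # \<alpha>) (basis_elem \<beta>))) f =
        nc_mult (coord (basis_elem (i # \<alpha>))) (nc_word f \<beta>)"
      unfolding nc_word_var[symmetric] by simp
  qed
  show ?thesis
  proof
    show "M \<in> op_tuples" "M \<in> conv_sot f \<union> conv_rad f"
      using Mt conv by auto
    show "coord (M i (basis_elem \<beta>)) = nc_mult (g i) (coord (basis_elem \<beta>))" for i \<beta>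
    proof (rule inj)
      show "nc_polynomial (coord (M i (basis_elem \<beta>)))" "nc_polynomial (nc_mult (g i) (coord (basis_elem \<beta>)))"
        by (intro Mp nc_polynomial_mult g nc_polynomial_basis)+
      show "nc_comp (coord (M i (basis_elem \<beta>))) f = nc_comp (nc_mult (g i) (coord (basis_elem \<beta>))) f"
        unfolding M[OF nc_polynomial_basis] nc_comp_mult_basis[OF composable_polynomial[OF g]] gf nc_comp_basis ..
    qed
    show "nc_eval f M j (basis_elem \<beta>) = basis_elem (j # \<beta>)" for j \<beta>
    proof (rule iffD1[OF coord_inject], rule inj)
      have c: "coord (nc_eval f M j (basis_elem \<beta>)) =
          (\<lambda>\<gamma>. \<Sum>\<alpha> | f j \<alpha> \<noteq> 0. f j \<alpha> * coord (word_op M \<alpha> (basis_elem \<beta>)) \<gamma>)"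
        by (rule ext) (simp add: S coord_sum scaleC_complex_def)
      show "nc_polynomial (coord (nc_eval f M j (basis_elem \<beta>)))"
        unfolding c using f[of j] by (intro nc_polynomial_sum word) (simp add: nc_polynomial_def)
      show "nc_polynomial (coord (basis_elem (j # \<beta>)))"
        by (rule nc_polynomial_basis)
      show "nc_comp (coord (nc_eval f M j (basis_elem \<beta>))) f = nc_comp (coord (basis_elem (j # \<beta>))) f"
      proof
        fix \<delta>
        have "nc_comp (coord (nc_eval f M j (basis_elem \<beta>))) f \<delta> =
            (\<Sum>\<alpha> | f j \<alpha> \<noteq> 0. f j \<alpha> * nc_mult (coord (basis_elem \<alpha>)) (nc_word f \<beta>) \<delta>)"
          unfolding c word(2)[symmetric] by (intro nc_comp_sum composable_polynomial word)
        also have "\<dots> = nc_mult (\<lambda>\<gamma>. \<Sum>\<alpha> | f j \<alpha> \<noteq> 0. f j \<alpha> * coord (basis_elem \<alpha>) \<gamma>) (nc_word f \<beta>) \<delta>"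
          unfolding nc_mult_def sum_distrib_left sum_distrib_right by (subst sum.swap) (simp add: mult.assoc)
        also have "\<dots> = nc_word f (j # \<beta>) \<delta>"
          using polynomial_expansion[OF f[of j]] by simp
        finally show "nc_comp (coord (nc_eval f M j (basis_elem \<beta>))) f \<delta> = nc_comp (coord (basis_elem (j # \<beta>))) f \<delta>"
          by (simp only: nc_comp_basis)
      qed
    qed
  qed
qed

subsection \<open>Free holomorphic functions\<close>

lemma row_norm_nonneg:
  assumes "Y \<in> op_tuples"
  shows "0 \<le> row_norm Y"
proof -
  have lin: "bounded_clinear (Y j)" for j
    using assms by (simp add: op_tuples_def)
  have "bounded_clinear (\<lambda>h. \<Sum>j\<in>UNIV. Y j (cadj (Y j) h))"
    by (rule bounded_clinear_sums) (rule bounded_clinear_compose[OF lin bounded_clinear_cadj[OF lin]])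
  thus ?thesis
    by (simp add: row_norm_def onorm_pos_le bounded_clinear_linear)
qed

text \<open>One letter costs the factor \<open>(row_norm Y)\<^sup>2\<close>, the norm of the sum of
  the \<open>Y j\<close> times their adjoints, seen by pairing that operator with \<open>v\<close>.
  Summing over all words of length \<open>k\<close> iterates this with no factor for their
  number.\<close>

lemma sum_norm_cadj_word_op:
  fixes Y :: "'n::finite \<Rightarrow> 'h::complex_hilbert \<Rightarrow> 'h"
  assumes Y: "Y \<in> op_tuples"
  shows "(\<Sum>\<alpha> | length \<alpha> = k. (norm (cadj (word_op Y \<alpha>) v))\<^sup>2) \<le> ((row_norm Y)\<^sup>2) ^ k * (norm v)\<^sup>2"
proof (induction k arbitrary: v)
  case 0
  show ?case
    by (simp add: cadj_word_op_Nil del: word_op.simps)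
next
  case (Suc k)
  have lin: "bounded_clinear (Y j)" for j
    using Y by (simp add: op_tuples_def)
  define C where "C h = (\<Sum>j\<in>UNIV. Y j (cadj (Y j) h))" for h
  have C: "bounded_clinear C"
    unfolding C_def[abs_def]
    by (rule bounded_clinear_sums) (rule bounded_clinear_compose[OF lin bounded_clinear_cadj[OF lin]])
  have rn: "(row_norm Y)\<^sup>2 = onorm C"
    by (simp add: row_norm_def C_def[abs_def] onorm_pos_le bounded_clinear_linear[OF C[unfolded C_def[abs_def]]])
  have "cinner (C v) v = of_real (\<Sum>j\<in>UNIV. (norm (cadj (Y j) v))\<^sup>2)"
    by (simp add: C_def cinner_sum_left cinner_cadj[OF lin] cinner_same)
  hence "(\<Sum>j\<in>UNIV. (norm (cadj (Y j) v))\<^sup>2) \<le> cmod (cinner (C v) v)"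
    by (simp only: norm_of_real abs_ge_self)
  also have "\<dots> \<le> norm (C v) * norm v"
    by (rule cmod_cinner_le)
  also have "\<dots> \<le> onorm C * norm v * norm v"
    by (intro mult_right_mono bounded_clinear_onorm C) simp
  finally have row: "(\<Sum>j\<in>UNIV. (norm (cadj (Y j) v))\<^sup>2) \<le> (row_norm Y)\<^sup>2 * (norm v)\<^sup>2"
    unfolding rn power2_eq_square[of "norm v"] by (simp only: mult.assoc)
  have "(\<Sum>\<alpha> | length \<alpha> = Suc k. (norm (cadj (word_op Y \<alpha>) v))\<^sup>2) =
      (\<Sum>j\<in>UNIV. \<Sum>\<alpha> | length \<alpha> = k. (norm (cadj (word_op Y \<alpha>) (cadj (Y j) v)))\<^sup>2)"
    unfolding sum_words_Cons cadj_word_op_Cons[OF Y] ..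
  also have "\<dots> \<le> (\<Sum>j\<in>UNIV. ((row_norm Y)\<^sup>2) ^ k * (norm (cadj (Y j) v))\<^sup>2)"
    by (intro sum_mono Suc)
  also have "\<dots> \<le> ((row_norm Y)\<^sup>2) ^ k * ((row_norm Y)\<^sup>2 * (norm v)\<^sup>2)"
    unfolding sum_distrib_left[symmetric] by (intro mult_left_mono row) simp
  finally show ?case
    by (simp add: mult.assoc mult.left_commute)
qed

lemma sum_words_norm_le:
  assumes "square_summable c"
  shows "(\<Sum>\<alpha> | length \<alpha> = k. (norm (c \<alpha>))\<^sup>2) \<le> (\<Sum>\<^sub>\<infinity>\<alpha>. (norm (c (\<alpha> :: 'n::finite list)))\<^sup>2)"
  using assms unfolding square_summable_def by (intro finite_sum_le_infsum) auto

text \<open>Pairing \<open>v\<close> with itself moves the words to adjoints acting on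
  \<open>v\<close>, and Cauchy-Schwarz over the words separates coefficients from operators.
  Estimating the words one by one would instead bring in their number.\<close>

lemma norm_hom_part_le:
  assumes Y: "Y \<in> op_tuples" and c: "square_summable c"
  shows "norm (hom_part c Y k h) \<le>
    sqrt (\<Sum>\<^sub>\<infinity>\<alpha>. (norm (c \<alpha>))\<^sup>2) * norm h * row_norm Y ^ k"
proof -
  define v where "v = hom_part c Y k h"
  define N where "N = (\<Sum>\<^sub>\<infinity>\<alpha>. (norm (c \<alpha>))\<^sup>2)"
  let ?W = "{\<alpha> :: 'a list. length \<alpha> = k}"
  have "(norm v)\<^sup>2 = cmod (cinner v v)"
    by (simp add: cinner_same norm_power)
  also have "cinner v v = (\<Sum>\<alpha>\<in>?W. c \<alpha> * cinner h (cadj (word_op Y \<alpha>) v))"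
    by (subst v_def) (simp add: hom_part_def cinner_sum_left cinner_scaleC_left
        cinner_cadj[OF bounded_clinear_word_op[OF Y]])
  also have "cmod \<dots> \<le> (\<Sum>\<alpha>\<in>?W. norm (c \<alpha>) * (norm h * norm (cadj (word_op Y \<alpha>) v)))"
    by (rule order_trans[OF norm_sum]) (auto intro!: sum_mono mult_left_mono cmod_cinner_le simp: norm_mult)
  also have "\<dots> = norm h * (\<Sum>\<alpha>\<in>?W. norm (c \<alpha>) * norm (cadj (word_op Y \<alpha>) v))"
    by (simp add: sum_distrib_left mult.left_commute)
  also have "\<dots> \<le> norm h * (sqrt N * (row_norm Y ^ k * norm v))"
  proof (intro mult_left_mono)
    have "(\<Sum>\<alpha>\<in>?W. norm (c \<alpha>) * norm (cadj (word_op Y \<alpha>) v)) \<le>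
        L2_set (\<lambda>\<alpha>. norm (c \<alpha>)) ?W * L2_set (\<lambda>\<alpha>. norm (cadj (word_op Y \<alpha>) v)) ?W"
      using L2_set_mult_ineq[of "\<lambda>\<alpha>. norm (c \<alpha>)" "\<lambda>\<alpha>. norm (cadj (word_op Y \<alpha>) v)" ?W] by simp
    also have "\<dots> \<le> sqrt N * (row_norm Y ^ k * norm v)"
    proof (rule mult_mono)
      show "L2_set (\<lambda>\<alpha>. norm (c \<alpha>)) ?W \<le> sqrt N"
        unfolding L2_set_def N_def by (intro real_sqrt_le_mono sum_words_norm_le c)
      have "L2_set (\<lambda>\<alpha>. norm (cadj (word_op Y \<alpha>) v)) ?W \<le> sqrt (((row_norm Y)\<^sup>2) ^ k * (norm v)\<^sup>2)"
        unfolding L2_set_def by (intro real_sqrt_le_mono sum_norm_cadj_word_op Y)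
      also have "((row_norm Y)\<^sup>2) ^ k * (norm v)\<^sup>2 = (row_norm Y ^ k * norm v)\<^sup>2"
        by (simp add: power_mult_distrib power_mult[symmetric] mult.commute)
      finally show "L2_set (\<lambda>\<alpha>. norm (cadj (word_op Y \<alpha>) v)) ?W \<le> row_norm Y ^ k * norm v"
        using row_norm_nonneg[OF Y] by simp
    qed (auto simp: N_def infsum_nonneg L2_set_nonneg)
    finally show "(\<Sum>\<alpha>\<in>?W. norm (c \<alpha>) * norm (cadj (word_op Y \<alpha>) v)) \<le> sqrt N * (row_norm Y ^ k * norm v)" .
  qed simp
  finally have "norm v * norm v \<le> (sqrt N * norm h * row_norm Y ^ k) * norm v"
    by (simp add: power2_eq_square mult_ac)
  moreover have "0 \<le> sqrt N * norm h * row_norm Y ^ k"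
    using row_norm_nonneg[OF Y] by (simp add: N_def infsum_nonneg)
  ultimately have "norm v \<le> sqrt N * norm h * row_norm Y ^ k"
    by (cases "v = 0") (auto simp: mult_le_cancel_right)
  thus ?thesis
    by (simp add: v_def N_def)
qed

lemma summable_hom_part:
  assumes Y: "Y \<in> op_ball 1" and c: "square_summable c"
  shows "summable (\<lambda>k. hom_part c Y k h)"
proof (rule summable_comparison_test)
  have Y': "Y \<in> op_tuples" and rn: "row_norm Y < 1"
    using Y by (simp_all add: op_ball_def)
  show "\<exists>N. \<forall>k\<ge>N. norm (hom_part c Y k h) \<le> sqrt (\<Sum>\<^sub>\<infinity>\<alpha>. (norm (c \<alpha>))\<^sup>2) * norm h * row_norm Y ^ k"
    using norm_hom_part_le[OF Y' c] by blast
  show "summable (\<lambda>k. sqrt (\<Sum>\<^sub>\<infinity>\<alpha>. (norm (c \<alpha>))\<^sup>2) * norm h * row_norm Y ^ k)"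
    using rn row_norm_nonneg[OF Y'] by (intro summable_mult summable_geometric) simp
qed

lemma nc_map_sums:
  "Y \<in> op_ball 1 \<Longrightarrow> square_summable c \<Longrightarrow> (\<lambda>k. hom_part c Y k h) sums nc_map c Y h"
  unfolding nc_map_def by (intro summable_sums summable_hom_part)

text \<open>The coefficient norms of all degrees share one bound, so a geometric series dominates.
  The nondegeneracy hypothesis in the function case thereby applies to elements of the Hilbert
  space.\<close>

lemma nc_radius_square_summable:
  assumes c: "square_summable c"
  shows "1 \<le> nc_radius c"
  unfolding nc_radius_def
proof (rule conv_radius_geI_ex')
  fix r :: real assume r: "0 < r" "ereal r < 1"
  show "summable (\<lambda>k. sqrt (\<Sum>\<alpha> | length \<alpha> = k. (cmod (c \<alpha>))\<^sup>2) * of_real r ^ k)"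
  proof (rule summable_comparison_test)
    show "\<exists>N. \<forall>k\<ge>N. norm (sqrt (\<Sum>\<alpha> | length \<alpha> = k. (cmod (c \<alpha>))\<^sup>2) * of_real r ^ k) \<le>
        sqrt (\<Sum>\<^sub>\<infinity>\<alpha>. (norm (c \<alpha>))\<^sup>2) * r ^ k"
      using r by (intro exI[of _ 0] allI impI) (auto simp: abs_mult abs_of_nonneg[OF real_sqrt_ge_zero[OF sum_nonneg]]
          intro!: mult_right_mono real_sqrt_le_mono sum_words_norm_le c)
    show "summable (\<lambda>k. sqrt (\<Sum>\<^sub>\<infinity>\<alpha>. (norm (c \<alpha>))\<^sup>2) * r ^ k)"
      using r by (intro summable_mult summable_geometric) simp
  qed
qed

lemma square_summable_diff:
  assumes "square_summable a" "square_summable b"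
  shows "square_summable (\<lambda>i. a i - b i)"
  using square_summable_add[OF assms(1) square_summable_bound[OF assms(2), of "\<lambda>i. - b i" 1]] by simp

lemma square_summable_nc_mult_basis:
  assumes "square_summable p"
  shows "square_summable (nc_mult p (coord (basis_elem \<beta>)))"
  unfolding square_summable_def
proof -
  have "(\<lambda>\<alpha>. (norm (nc_mult p (coord (basis_elem \<beta>)) (\<alpha> @ \<beta>)))\<^sup>2) summable_on UNIV"
    using assms by (simp only: nc_mult_basis_append square_summable_def)
  hence "(\<lambda>\<gamma>. (norm (nc_mult p (coord (basis_elem \<beta>)) \<gamma>))\<^sup>2) summable_on (range (\<lambda>\<alpha>. \<alpha> @ \<beta>))"
    by (subst summable_on_reindex) (auto simp: inj_on_def comp_def simp del: coord_basis_elem)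
  thus "(\<lambda>\<gamma>. (norm (nc_mult p (coord (basis_elem \<beta>)) \<gamma>))\<^sup>2) summable_on UNIV"
    by (rule iffD1[OF summable_on_cong_neutral, rotated -1])
      (auto simp: nc_mult_basis_eq_0 simp del: coord_basis_elem)
qed

lemma nc_map_basis: "nc_map (coord (basis_elem \<beta>)) Y h = word_op Y \<beta> h"
proof -
  have "((\<lambda>\<alpha>. coord (basis_elem \<beta>) \<alpha> *\<^sub>C word_op Y \<alpha> h) has_sum word_op Y \<beta> h) UNIV"
    by (rule has_sum_finite_neutralI[of "{\<beta>}"]) auto
  from sums_unique[OF has_sum_words_imp_sums[OF this]] show ?thesis
    by (simp add: nc_map_def hom_part_def)
qed

lemma nc_map_var: "nc_map (nc_var i) Y h = Y i h"
proof -
  have "((\<lambda>\<alpha>. nc_var i \<alpha> *\<^sub>C word_op Y \<alpha> h) has_sum Y i h) UNIV"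
    by (rule has_sum_finite_neutralI[of "{[i]}"]) (auto simp: nc_var_def)
  from sums_unique[OF has_sum_words_imp_sums[OF this]] show ?thesis
    by (simp add: nc_map_def hom_part_def)
qed

lemma hom_part_nc_mult_basis:
  "hom_part (nc_mult p (coord (basis_elem \<beta>))) Y (k + length \<beta>) h = hom_part p Y k (word_op Y \<beta> h)"
proof -
  let ?q = "nc_mult p (coord (basis_elem \<beta>))"
  have "hom_part ?q Y (k + length \<beta>) h =
      (\<Sum>\<gamma>\<in>(\<lambda>\<alpha>. \<alpha> @ \<beta>) ` {\<alpha>. length \<alpha> = k}. ?q \<gamma> *\<^sub>C word_op Y \<gamma> h)"
    unfolding hom_part_def
  proof (rule sum.mono_neutral_right)
    show "\<forall>\<gamma>\<in>{\<gamma>. length \<gamma> = k + length \<beta>} - (\<lambda>\<alpha>. \<alpha> @ \<beta>) ` {\<alpha>. length \<alpha> = k}.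
        ?q \<gamma> *\<^sub>C word_op Y \<gamma> h = 0"
    proof
      fix \<gamma> assume \<gamma>: "\<gamma> \<in> {\<gamma>. length \<gamma> = k + length \<beta>} - (\<lambda>\<alpha>. \<alpha> @ \<beta>) ` {\<alpha>. length \<alpha> = k}"
      hence "\<gamma> \<notin> range (\<lambda>\<alpha>. \<alpha> @ \<beta>)"
        by auto
      thus "?q \<gamma> *\<^sub>C word_op Y \<gamma> h = 0"
        by (simp only: nc_mult_basis_eq_0 scaleC_zero_left not_False_eq_True)
    qed
  qed auto
  also have "\<dots> = (\<Sum>\<alpha> | length \<alpha> = k. ?q (\<alpha> @ \<beta>) *\<^sub>C word_op Y (\<alpha> @ \<beta>) h)"
    by (subst sum.reindex) (auto simp: inj_on_def)
  also have "\<dots> = hom_part p Y k (word_op Y \<beta> h)"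
    unfolding nc_mult_basis_append word_op_append hom_part_def ..
  finally show ?thesis .
qed

lemma hom_part_nc_mult_basis_0:
  assumes "k < length \<beta>"
  shows "hom_part (nc_mult p (coord (basis_elem \<beta>))) Y k h = 0"
proof -
  have "nc_mult p (coord (basis_elem \<beta>)) \<gamma> = 0" if "length \<gamma> = k" for \<gamma>
    using assms that by (intro nc_mult_basis_eq_0) auto
  thus ?thesis
    by (simp add: hom_part_def del: coord_basis_elem)
qed

text \<open>The word on the right delays the series by \<open>length \<beta>\<close> degrees, and
  the skipped homogeneous parts vanish, so the sums agree.\<close>

lemma nc_map_nc_mult_basis:
  assumes Y: "Y \<in> op_ball 1" and p: "square_summable p"
  shows "nc_map (nc_mult p (coord (basis_elem \<beta>))) Y h = nc_map p Y (word_op Y \<beta> h)"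
proof -
  have "(\<lambda>k. hom_part (nc_mult p (coord (basis_elem \<beta>))) Y (k + length \<beta>) h) sums
      nc_map p Y (word_op Y \<beta> h)"
    unfolding hom_part_nc_mult_basis by (rule nc_map_sums[OF Y p])
  hence "(\<lambda>k. hom_part (nc_mult p (coord (basis_elem \<beta>))) Y k h) sums nc_map p Y (word_op Y \<beta> h)"
    by (subst (asm) sums_zero_iff_shift) (auto simp: hom_part_nc_mult_basis_0 simp del: coord_basis_elem)
  thus ?thesis
    unfolding nc_map_def[of "nc_mult p (coord (basis_elem \<beta>))"] by (rule sums_unique[symmetric])
qed

lemma universal_model_function:
  fixes f g :: "'n::finite \<Rightarrow> 'n nc_series"
  assumes "function_model f g M"
  shows "universal_model f g M"
proof -
  obtain \<gamma> :: real where
    range: "\<And>X :: 'n \<Rightarrow> (nat, complex) ltwo \<Rightarrow> (nat, complex) ltwo. X \<in> op_ball \<gamma> \<Longrightarrow>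
      (\<lambda>j. nc_map (f j) X) \<in> op_ball 1"
    and uniq: "\<And>G. 1 \<le> nc_radius G \<Longrightarrow> G \<noteq> (\<lambda>_. 0) \<Longrightarrow>
      \<exists>X\<in>(op_ball \<gamma> :: ('n \<Rightarrow> (nat, complex) ltwo \<Rightarrow> (nat, complex) ltwo) set).
        nc_map G (\<lambda>j. nc_map (f j) X) \<noteq> (\<lambda>_. 0)"
    and g_sq: "\<And>i. square_summable (g i)"
    and gf: "\<And>i (X :: 'n \<Rightarrow> (nat, complex) ltwo \<Rightarrow> (nat, complex) ltwo). X \<in> op_ball \<gamma> \<Longrightarrow>
      nc_map (g i) (\<lambda>j. nc_map (f j) X) = X i"
    and M: "\<And>i. function_left_mult \<gamma> f (nc_var i) (M i)"
    and conv: "M \<in> conv_sot f \<union> conv_rad f"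
    and S: "\<And>j. function_left_mult \<gamma> f (f j) (nc_eval f M j)"
    using assms unfolding function_model_def Let_def by blast
  \<comment> \<open>This replaces injectivity on formal series: a nonzero difference of coordinate
    families would be a free holomorphic function on the unit ball vanishing along the range of
    \<open>f\<close>.\<close>
  have inj: "a = b" if a: "square_summable a" and b: "square_summable b"
    and eq: "\<And>(X :: 'n \<Rightarrow> (nat, complex) ltwo \<Rightarrow> (nat, complex) ltwo) h. X \<in> op_ball \<gamma> \<Longrightarrow>
      nc_map a (\<lambda>j. nc_map (f j) X) h = nc_map b (\<lambda>j. nc_map (f j) X) h" for a b
  proof (rule ccontr)
    assume "a \<noteq> b"
    define G where "G = (\<lambda>\<alpha>. a \<alpha> - b \<alpha>)"
    have "G \<noteq> (\<lambda>_. 0)"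
      using \<open>a \<noteq> b\<close> by (auto simp: G_def fun_eq_iff)
    moreover have "1 \<le> nc_radius G"
      unfolding G_def by (intro nc_radius_square_summable square_summable_diff a b)
    ultimately obtain X :: "'n \<Rightarrow> (nat, complex) ltwo \<Rightarrow> (nat, complex) ltwo"
      where X: "X \<in> op_ball \<gamma>" "nc_map G (\<lambda>j. nc_map (f j) X) \<noteq> (\<lambda>_. 0)"
      using uniq by blast
    let ?Y = "\<lambda>j. nc_map (f j) X"
    have "nc_map G ?Y h = 0" for h
    proof -
      have "(\<lambda>k. hom_part a ?Y k h - hom_part b ?Y k h) sums (nc_map a ?Y h - nc_map b ?Y h)"
        by (intro sums_diff nc_map_sums range X a b)
      moreover have "hom_part a ?Y k h - hom_part b ?Y k h = hom_part G ?Y k h" for k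
        by (simp add: hom_part_def G_def scaleC_diff_left sum_subtractf)
      ultimately have "(\<lambda>k. hom_part G ?Y k h) sums 0"
        using eq[OF X(1)] by simp
      thus ?thesis
        unfolding nc_map_def[of G] by (rule sums_unique[symmetric])
    qed
    thus False
      using X(2) by auto
  qed
  show ?thesis
  proof
    show "M \<in> op_tuples"
      by (rule conv_op_tuples[OF conv])
    show "coord (M i (basis_elem \<beta>)) = nc_mult (g i) (coord (basis_elem \<beta>))" for i \<beta>
    proof (rule inj)
      fix X :: "'n \<Rightarrow> (nat, complex) ltwo \<Rightarrow> (nat, complex) ltwo" and h
      assume X: "X \<in> op_ball \<gamma>"
      let ?Y = "\<lambda>j. nc_map (f j) X"
      have "nc_map (coord (M i (basis_elem \<beta>))) ?Y = nc_map (nc_var i) X \<circ> nc_map (coord (basis_elem \<beta>)) ?Y"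
        using M X unfolding function_left_mult_def by blast
      hence "nc_map (coord (M i (basis_elem \<beta>))) ?Y h = X i (word_op ?Y \<beta> h)"
        by (simp add: nc_map_var nc_map_basis del: coord_basis_elem)
      thus "nc_map (coord (M i (basis_elem \<beta>))) ?Y h = nc_map (nc_mult (g i) (coord (basis_elem \<beta>))) ?Y h"
        by (simp only: nc_map_nc_mult_basis[OF range[OF X] g_sq] gf[OF X])
    qed (intro square_summable_coord square_summable_nc_mult_basis g_sq)+
    show "nc_eval f M j (basis_elem \<beta>) = basis_elem (j # \<beta>)" for j \<beta>
    proof (rule iffD1[OF coord_inject], rule inj)
      fix X :: "'n \<Rightarrow> (nat, complex) ltwo \<Rightarrow> (nat, complex) ltwo" and h
      assume X: "X \<in> op_ball \<gamma>"
      let ?Y = "\<lambda>j. nc_map (f j) X"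
      have "nc_map (coord (nc_eval f M j (basis_elem \<beta>))) ?Y =
          nc_map (f j) X \<circ> nc_map (coord (basis_elem \<beta>)) ?Y"
        using S X unfolding function_left_mult_def by blast
      thus "nc_map (coord (nc_eval f M j (basis_elem \<beta>))) ?Y h = nc_map (coord (basis_elem (j # \<beta>))) ?Y h"
        by (simp add: nc_map_basis del: coord_basis_elem)
    qed (rule square_summable_coord)+
  qed (rule conv)
qed

theorem theorem5p5:
  fixes f g :: "'n::finite \<Rightarrow> 'n nc_series"
    and M :: "'n \<Rightarrow> ('n list, complex) ltwo \<Rightarrow> ('n list, complex) ltwo"
    and T :: "'n \<Rightarrow> 'h::complex_hilbert \<Rightarrow> 'h"
  assumes "model f g M"
    and "T \<in> nc_domain f g"
    and "pure_tuple f T"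
  shows "isometric_dilation M T (defect_space f T) (poisson_kernel f T) \<and>
    minimal_dilation M (defect_space f T) (poisson_kernel f T) \<and>
    (\<forall>(E :: 'e::complex_hilbert set) (V :: 'h \<Rightarrow> ('n list, 'e) ltwo).
      closed E \<and> csubspace E \<and> isometric_dilation M T E V \<and> minimal_dilation M E V \<longrightarrow>
      (\<exists>W :: ('n list, 'h) ltwo \<Rightarrow> ('n list, 'e) ltwo.
        unitary_between (tensor_space (defect_space f T)) (tensor_space E) W \<and>
        (\<forall>i. \<forall>u \<in> tensor_space (defect_space f T). W (ampl (M i) u) = ampl (M i) (W u)) \<and>
        W \<circ> poisson_kernel f T = V))"
proof -
  have "universal_model f g M"
    using assms(1) unfolding model_def
    by (blast intro: universal_model_polynomial universal_model_series universal_model_function)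
  then interpret pure_tuple_in_domain f g M T
    by (rule pure_tuple_in_domain.intro) (rule pure_tuple_in_domain_axioms.intro[OF assms(2,3)])
  show ?thesis
    using isometric_dilation_K minimal_dilation_K minimal_dilation_unique by blast
qed

end
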